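(* Let $\phi=(\phi^x)_{x\in X}$ be the centered complex Gaussian field with covariance $\mathbb{E}_\phi(\phi^x\overline{\phi}^y)=2G^{x,y}$, and let $\mathcal{L}_1$ be the Poisson process of loops of intensity $\mu$, with occupation field $\widehat{\mathcal{L}_1}$. Then: (a) The random fields $\widehat{\mathcal{L}_1}=(\widehat{\mathcal{L}_1}^x)_{x\in X}$ and $\frac12\phi\overline{\phi}=(\frac12\phi^x\overline{\phi}^x)_{x\in X}$ have the same distribution. (b) For all $x,y\in X$ and every bounded measurable function $F:[0,\infty)^X\to\mathbb{R}$, $$\mathbb{E}_\phi\Big(\tfrac12\,\phi^x\overline{\phi}^y\,F\big(\tfrac12\phi\overline{\phi}\big)\Big)=\int \mathbb{E}\big(F(\widehat{\mathcal{L}_1}+\widehat{\gamma})\big)\,\mu^{x,y}(d\gamma),$$ where on the right $\mathbb{E}$ is the expectation over $\mathcal{L}_1$ and $\mu^{x,y}$ is the bridge measure on paths from $x$ to $y$.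
   Context: Setting. $X$ is a finite set; $C=(C_{x,y})_{x,y\in X}$ is a symmetric matrix with nonnegative entries and zero diagonal (conductances), irreducible; $\kappa=(\kappa_x)_{x\in X}$ is a nonnegative killing measure; $\lambda_x=\kappa_x+\sum_y C_{x,y}>0$; $M_\lambda$ is the diagonal matrix with entries $\lambda_x$. The energy is $e(z)=\sum_x\lambda_x|z^x|^2-\sum_{x,y}C_{x,y}z^x\overline{z}^y$ for $z\in\mathbb{C}^X$, and it is assumed positive definite (mass gap). The Green function is $G=(M_\lambda-C)^{-1}$. Loops. A based loop is a pair $(\xi,\tau^* )$ with $p\ge1$, $\xi=(\xi_i)_{i\in\mathbb{Z}/p\mathbb{Z}}\in X^p$ and $\tau^*=(\tau_i^* )_{i\in\mathbb{Z}/p\mathbb{Z}}\in(0,\infty)^p$ (intrinsic holding times). A loop $l$ is an equivalence class of based loops under cyclic rotation of the index. The loop measure $\mu$ is the image on loops of the measure on based loops which is $e^{-\lambda_x\tau^*}\frac{d\tau^*}{\tau^*}$ on one-point (trivial) loops at $x$, for each $x\in X$, and, for $p\ge2$ and each $\xi\in X^p$, is $\frac1p\prod_{i\in\mathbb{Z}/p\mathbb{Z}}C_{\xi_i,\xi_{i+1}}e^{-\lambda_{\xi_i}\tau_i^*}d\tau_i^*$. The occupation field of a loop is $\widehat{l}^x=\sum_{i}1_{\{\xi_i=x\}}\tau_i^*$. $\mathcal{L}_1$ is the Poisson point process on loops with intensity $\mu$, and $\widehat{\mathcal{L}_1}^x=\sum_{l\in\mathcal{L}_1}\widehat{l}^x$.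 Bridge measure. $\mu^{x,y}$ is the measure on paths $\gamma=((x_1,\dots,x_k),(\tau_1^*,\dots,\tau_k^* ))$, $k\ge1$, with $x_1=x$, $x_k=y$, $x_i\in X$, $\tau_i^*>0$, equal to $\prod_{i=1}^{k-1}C_{x_i,x_{i+1}}\prod_{i=1}^k e^{-\lambda_{x_i}\tau_i^*}d\tau_i^*$ for each discrete path $(x_1,\dots,x_k)$ (the case $k=1$ occurs only if $x=y$). Its total mass is $G^{x,y}$. The occupation field of a path is $\widehat{\gamma}^u=\sum_{i=1}^k1_{\{x_i=u\}}\tau_i^*$. Gaussian field. $\phi$ has density $\frac{\det(M_\lambda-C)}{(2\pi)^{|X|}}e^{-\frac12 e(z)}$ with respect to Lebesgue measure on $\mathbb{C}^X$ (so $\mathbb{E}_\phi(\phi^x\phi^y)=0$). *)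

theory Defs
  imports "HOL-Probability.Probability"
begin

section \<open>Conductances, killing and the energy form\<close>

definition total_rate :: "real^'x^'x \<Rightarrow> real^'x \<Rightarrow> real^'x::finite" where
  "total_rate C \<kappa> = (\<chi> x. \<kappa> $ x + (\<Sum>y\<in>UNIV. C $ x $ y))"

definition rate_matrix :: "real^'x^'x \<Rightarrow> real^'x \<Rightarrow> real^'x^'x::finite" where
  "rate_matrix C \<kappa> = (\<chi> x y. if x = y then total_rate C \<kappa> $ x else 0)"

definition irreducible_conductance :: "real^'x^'x::finite \<Rightarrow> bool" where
  "irreducible_conductance C \<longleftrightarrow> (\<forall>x y. (x, y) \<in> {(u, v). C $ u $ v > 0}\<^sup>*)"

text \<open>For symmetric real \<open>C\<close> the double sum is real, so taking the real part loses nothing.\<close>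

definition energy :: "real^'x^'x \<Rightarrow> real^'x \<Rightarrow> complex^'x::finite \<Rightarrow> real" where
  "energy C \<kappa> z =
     (\<Sum>x\<in>UNIV. total_rate C \<kappa> $ x * (norm (z $ x))\<^sup>2)
     - Re (\<Sum>x\<in>UNIV. \<Sum>y\<in>UNIV. of_real (C $ x $ y) * z $ x * cnj (z $ y))"

text \<open>The density on \<open>complex^'x\<close> of the centred complex Gaussian field whose covariance
  \<open>E(\<phi>\<^sup>x cnj \<phi>\<^sup>y)\<close> is twice the Green function \<open>matrix_inv (rate_matrix C \<kappa> - C)\<close>
  (and with \<open>E(\<phi>\<^sup>x \<phi>\<^sup>y) = 0\<close>).\<close>

definition gaussian_density :: "real^'x^'x \<Rightarrow> real^'x \<Rightarrow> complex^'x::finite \<Rightarrow> real" where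
  "gaussian_density C \<kappa> z =
     det (rate_matrix C \<kappa> - C) / (2 * pi) ^ CARD('x) * exp (- energy C \<kappa> z / 2)"

definition half_square :: "complex^'x \<Rightarrow> real^'x::finite" where
  "half_square z = (\<chi> x. (norm (z $ x))\<^sup>2 / 2)"


section \<open>Paths with holding times\<close>

text \<open>A path \<open>((x\<^sub>1, \<dots>, x\<^sub>k), (\<tau>\<^sub>1, \<dots>, \<tau>\<^sub>k))\<close> is represented as the list
  \<open>[(x\<^sub>1, \<tau>\<^sub>1), \<dots>, (x\<^sub>k, \<tau>\<^sub>k)]\<close>; based loops are represented in the same way.\<close>

definition paths :: "('x \<times> real) list set" where
  "paths = {\<gamma>. \<gamma> \<noteq> [] \<and> (\<forall>(x, t)\<in>set \<gamma>. 0 < t)}"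

definition holding_times :: "nat \<Rightarrow> (nat \<Rightarrow> real) measure" where
  "holding_times k = (\<Pi>\<^sub>M i\<in>{..<k}. restrict_space lborel {0<..})"

definition timed_path :: "'x list \<Rightarrow> (nat \<Rightarrow> real) \<Rightarrow> ('x \<times> real) list" where
  "timed_path \<xi> \<tau> = zip \<xi> (map \<tau> [0..<length \<xi>])"

text \<open>The sigma-algebra on paths is that of the disjoint union, over all discrete paths \<open>\<xi>\<close>, of
  the spaces \<open>(0, \<infinity>)\<^bsup>length \<xi>\<^esup>\<close>.\<close>

definition path_space :: "('x \<times> real) list measure" where
  "path_space = sigma paths
     {A. A \<subseteq> paths \<and>
         (\<forall>\<xi>. \<xi> \<noteq> [] \<longrightarrow>
            timed_path \<xi> -` A \<inter> space (holding_times (length \<xi>)) \<in> sets (holding_times (length \<xi>)))}"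

text \<open>The measure equal to \<open>w \<xi> \<tau> d\<tau>\<close> on the paths with discrete path \<open>\<xi>\<close>, for each
  \<open>\<xi> \<in> \<Xi>\<close>, and giving no mass to the remaining paths; see \<open>emeasure_path_measure\<close>.\<close>

definition path_measure ::
  "'x list set \<Rightarrow> ('x list \<Rightarrow> (nat \<Rightarrow> real) \<Rightarrow> real) \<Rightarrow> ('x \<times> real) list measure" where
  "path_measure \<Xi> w = measure_of (space path_space) (sets path_space)
     (\<lambda>A. \<integral>\<^sup>+\<xi>. (\<integral>\<^sup>+\<tau>. ennreal (w \<xi> \<tau>) * indicator A (timed_path \<xi> \<tau>)
              \<partial>holding_times (length \<xi>)) \<partial>count_space \<Xi>)"

definition occupation :: "('x \<times> real) list \<Rightarrow> real^'x::finite" where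
  "occupation \<gamma> = (\<chi> u. \<Sum>(x, t)\<leftarrow>\<gamma>. if x = u then t else 0)"

definition bridge_weight ::
  "real^'x^'x \<Rightarrow> real^'x \<Rightarrow> 'x::finite list \<Rightarrow> (nat \<Rightarrow> real) \<Rightarrow> real" where
  "bridge_weight C \<kappa> \<xi> \<tau> =
     (\<Prod>i<length \<xi> - 1. C $ (\<xi> ! i) $ (\<xi> ! Suc i)) *
     (\<Prod>i<length \<xi>. exp (- total_rate C \<kappa> $ (\<xi> ! i) * \<tau> i))"

definition bridge_measure ::
  "real^'x^'x \<Rightarrow> real^'x \<Rightarrow> 'x \<Rightarrow> 'x \<Rightarrow> ('x::finite \<times> real) list measure" where
  "bridge_measure C \<kappa> x y =
     path_measure {\<xi>. \<xi> \<noteq> [] \<and> hd \<xi> = x \<and> last \<xi> = y} (bridge_weight C \<kappa>)"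


section \<open>Loops\<close>

definition rotation :: "(('x \<times> real) list \<times> ('x \<times> real) list) set" where
  "rotation = {(\<gamma>, \<gamma>'). \<gamma> \<in> paths \<and> (\<exists>n. \<gamma>' = rotate n \<gamma>)}"

definition loop_of :: "('x \<times> real) list \<Rightarrow> ('x \<times> real) list set" where
  "loop_of \<gamma> = rotation `` {\<gamma>}"

definition loop_space :: "('x \<times> real) list set measure" where
  "loop_space = sigma (paths // rotation)
     {A. A \<subseteq> paths // rotation \<and> loop_of -` A \<inter> paths \<in> sets path_space}"

definition based_loop_weight ::
  "real^'x^'x \<Rightarrow> real^'x \<Rightarrow> 'x::finite list \<Rightarrow> (nat \<Rightarrow> real) \<Rightarrow> real" where
  "based_loop_weight C \<kappa> \<xi> \<tau> =
     (let p = length \<xi> in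
      if p = 1 then exp (- total_rate C \<kappa> $ (\<xi> ! 0) * \<tau> 0) / \<tau> 0
      else 1 / real p *
        (\<Prod>i<p. C $ (\<xi> ! i) $ (\<xi> ! (Suc i mod p)) *
                 exp (- total_rate C \<kappa> $ (\<xi> ! i) * \<tau> i)))"

definition based_loop_measure ::
  "real^'x^'x \<Rightarrow> real^'x \<Rightarrow> ('x::finite \<times> real) list measure" where
  "based_loop_measure C \<kappa> = path_measure {\<xi>. \<xi> \<noteq> []} (based_loop_weight C \<kappa>)"

definition loop_measure ::
  "real^'x^'x \<Rightarrow> real^'x \<Rightarrow> ('x::finite \<times> real) list set measure" where
  "loop_measure C \<kappa> = distr (based_loop_measure C \<kappa>) loop_space loop_of"

text \<open>The occupation field is rotation invariant, hence constant on a loop; see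
  \<open>loop_occupation_loop_of\<close>.\<close>

definition loop_occupation :: "('x \<times> real) list set \<Rightarrow> real^'x::finite" where
  "loop_occupation l = the_elem (occupation ` l)"

text \<open>The sum is over the points of a countable configuration of loops. Its terms are nonnegative;
  where it diverges (a null event for the loop process), \<open>infsum\<close> returns 0.\<close>

definition total_occupation :: "('x \<times> real) list set set \<Rightarrow> real^'x::finite" where
  "total_occupation \<L> = (\<chi> x. \<Sum>\<^sub>\<infinity>l\<in>\<L>. loop_occupation l $ x)"


section \<open>Poisson point processes\<close>

definition count_in :: "('w \<Rightarrow> 'l set) \<Rightarrow> 'l set \<Rightarrow> 'w \<Rightarrow> ennreal" where
  "count_in \<L> A \<omega> = emeasure (count_space UNIV) (\<L> \<omega> \<inter> A)"

text \<open>A Poisson process is a random countable set of points. There are no multiplicities: this is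
  the right notion for atomless intensities such as the loop measure.\<close>

definition poisson_process :: "'w measure \<Rightarrow> 'l measure \<Rightarrow> ('w \<Rightarrow> 'l set) \<Rightarrow> bool" where
  "poisson_process P \<mu> \<L> \<longleftrightarrow>
     prob_space P \<and>
     (\<forall>\<omega>\<in>space P. \<L> \<omega> \<subseteq> space \<mu> \<and> countable (\<L> \<omega>)) \<and>
     (\<forall>A\<in>sets \<mu>. count_in \<L> A \<in> borel_measurable P) \<and>
     (\<forall>A\<in>sets \<mu>. emeasure \<mu> A < \<infinity> \<longrightarrow>
        (\<forall>n::nat. measure P {\<omega>\<in>space P. count_in \<L> A \<omega> = of_nat n} =
                  measure \<mu> A ^ n / fact n * exp (- measure \<mu> A))) \<and>
     (\<forall>(A :: nat \<Rightarrow> 'l set) m. A ` {..<m} \<subseteq> sets \<mu> \<and> disjoint_family_on A {..<m} \<longrightarrow>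
        prob_space.indep_vars P (\<lambda>_. borel) (\<lambda>i. count_in \<L> (A i)) {..<m})"


section \<open>Consistency of the encodings\<close>

lemma space_path_space [simp]: "space path_space = paths"
  unfolding path_space_def by (rule space_measure_of) auto

lemma timed_path_in_paths:
  assumes "\<xi> \<noteq> []" "\<tau> \<in> space (holding_times (length \<xi>))"
  shows "timed_path \<xi> \<tau> \<in> paths"
  using assms
  by (auto simp: timed_path_def paths_def holding_times_def space_PiM space_restrict_space
      set_zip PiE_iff)

lemma sets_path_space:
  "sets (path_space :: ('x \<times> real) list measure) =
     {A. A \<subseteq> paths \<and>
         (\<forall>\<xi>. \<xi> \<noteq> [] \<longrightarrow>
            timed_path \<xi> -` A \<inter> space (holding_times (length \<xi>)) \<in> sets (holding_times (length \<xi>)))}"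
  (is "_ = ?S")
proof -
  have "sigma_algebra (paths :: ('x \<times> real) list set) ?S"
    unfolding sigma_algebra_iff2
  proof (intro conjI ballI allI impI)
    fix A assume A: "A \<in> ?S"
    have "timed_path \<xi> -` (paths - A) \<inter> space (holding_times (length \<xi>)) =
        space (holding_times (length \<xi>)) - (timed_path \<xi> -` A \<inter> space (holding_times (length \<xi>)))"
      if "\<xi> \<noteq> []" for \<xi> :: "'x list"
      using timed_path_in_paths[OF that] by auto
    with A show "paths - A \<in> ?S" by auto
  next
    fix A :: "nat \<Rightarrow> ('x \<times> real) list set" assume "range A \<subseteq> ?S"
    then show "(\<Union>i. A i) \<in> ?S"
      by (auto simp: vimage_UN UN_extend_simps(4) simp del: UN_simps)
  qed auto
  then show ?thesis
    unfolding path_space_def by (simp add: sigma_algebra.sets_measure_of_eq)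
qed

lemma measurable_timed_path:
  assumes "\<xi> \<noteq> []"
  shows "timed_path \<xi> \<in> holding_times (length \<xi>) \<rightarrow>\<^sub>M path_space"
  using assms timed_path_in_paths[OF assms] by (auto simp: measurable_def sets_path_space)

lemma emeasure_path_measure:
  fixes \<Xi> :: "'x list set"
  assumes "\<And>\<xi>. \<xi> \<in> \<Xi> \<Longrightarrow> \<xi> \<noteq> []"
    and w: "\<And>\<xi>. \<xi> \<in> \<Xi> \<Longrightarrow> w \<xi> \<in> borel_measurable (holding_times (length \<xi>))"
    and A: "A \<in> sets path_space"
  shows "emeasure (path_measure \<Xi> w) A =
     (\<integral>\<^sup>+\<xi>. (\<integral>\<^sup>+\<tau>. ennreal (w \<xi> \<tau>) * indicator A (timed_path \<xi> \<tau>)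
        \<partial>holding_times (length \<xi>)) \<partial>count_space \<Xi>)"
  unfolding path_measure_def
proof (rule emeasure_measure_of_sigma)
  show "sigma_algebra (space path_space) (sets path_space)" ..
  show "positive (sets path_space)
     (\<lambda>A. \<integral>\<^sup>+\<xi>. (\<integral>\<^sup>+\<tau>. ennreal (w \<xi> \<tau>) * indicator A (timed_path \<xi> \<tau>)
        \<partial>holding_times (length \<xi>)) \<partial>count_space \<Xi>)"
    by (simp add: positive_def)
  show "countably_additive (sets path_space)
     (\<lambda>A. \<integral>\<^sup>+\<xi>. (\<integral>\<^sup>+\<tau>. ennreal (w \<xi> \<tau>) * indicator A (timed_path \<xi> \<tau>)
        \<partial>holding_times (length \<xi>)) \<partial>count_space \<Xi>)"
  proof (rule countably_additiveI)
    fix B :: "nat \<Rightarrow> ('x \<times> real) list set" assume B: "range B \<subseteq> sets path_space" "disjoint_family B"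
    have meas: "(\<lambda>\<tau>. ennreal (w \<xi> \<tau>) * indicator (B i) (timed_path \<xi> \<tau>))
        \<in> borel_measurable (holding_times (length \<xi>))" if "\<xi> \<in> \<Xi>" for \<xi> i
    proof -
      have [measurable]: "timed_path \<xi> \<in> holding_times (length \<xi>) \<rightarrow>\<^sub>M path_space"
        by (rule measurable_timed_path[OF assms(1)[OF that]])
      have [measurable]: "w \<xi> \<in> borel_measurable (holding_times (length \<xi>))" by (rule w[OF that])
      have [measurable]: "B i \<in> sets path_space" using B(1) by auto
      show ?thesis by measurable
    qed
    have "(\<Sum>i. \<integral>\<^sup>+\<xi>. (\<integral>\<^sup>+\<tau>. ennreal (w \<xi> \<tau>) * indicator (B i) (timed_path \<xi> \<tau>)
        \<partial>holding_times (length \<xi>)) \<partial>count_space \<Xi>) =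
      (\<integral>\<^sup>+\<xi>. (\<Sum>i. \<integral>\<^sup>+\<tau>. ennreal (w \<xi> \<tau>) * indicator (B i) (timed_path \<xi> \<tau>)
        \<partial>holding_times (length \<xi>)) \<partial>count_space \<Xi>)"
      by (subst nn_integral_suminf) auto
    also have "\<dots> = (\<integral>\<^sup>+\<xi>. (\<integral>\<^sup>+\<tau>. ennreal (w \<xi> \<tau>) * indicator (\<Union>i. B i) (timed_path \<xi> \<tau>)
        \<partial>holding_times (length \<xi>)) \<partial>count_space \<Xi>)"
    proof (rule nn_integral_cong)
      fix \<xi> assume "\<xi> \<in> space (count_space \<Xi>)"
      then have \<xi>: "\<xi> \<in> \<Xi>" by simp
      show "(\<Sum>i. \<integral>\<^sup>+\<tau>. ennreal (w \<xi> \<tau>) * indicator (B i) (timed_path \<xi> \<tau>)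
          \<partial>holding_times (length \<xi>)) =
        (\<integral>\<^sup>+\<tau>. ennreal (w \<xi> \<tau>) * indicator (\<Union>i. B i) (timed_path \<xi> \<tau>)
          \<partial>holding_times (length \<xi>))"
        by (subst nn_integral_suminf[symmetric, OF meas[OF \<xi>]])
           (simp add: suminf_indicator[OF B(2)])
    qed
    finally show "(\<Sum>i. \<integral>\<^sup>+\<xi>. (\<integral>\<^sup>+\<tau>. ennreal (w \<xi> \<tau>) * indicator (B i) (timed_path \<xi> \<tau>)
        \<partial>holding_times (length \<xi>)) \<partial>count_space \<Xi>) =
      (\<integral>\<^sup>+\<xi>. (\<integral>\<^sup>+\<tau>. ennreal (w \<xi> \<tau>) * indicator (\<Union>i. B i) (timed_path \<xi> \<tau>)
        \<partial>holding_times (length \<xi>)) \<partial>count_space \<Xi>)" .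
  qed
qed (rule A)

lemma measurable_holding_times_component:
  "i < k \<Longrightarrow> (\<lambda>\<tau>. \<tau> i) \<in> borel_measurable (holding_times k)"
  unfolding holding_times_def
  by (rule measurable_compose[OF measurable_component_singleton[of i]])
     (auto intro!: measurable_restrict_space1)

lemma measurable_bridge_weight:
  "bridge_weight C \<kappa> \<xi> \<in> borel_measurable (holding_times (length \<xi>))"
proof -
  have [measurable]: "(\<lambda>\<tau>. \<tau> i) \<in> borel_measurable (holding_times (length \<xi>))"
    if "i < length \<xi>" for i
    using that by (rule measurable_holding_times_component)
  show ?thesis
    unfolding bridge_weight_def by measurable
qed

lemma measurable_based_loop_weight:
  assumes "\<xi> \<noteq> []"
  shows "based_loop_weight C \<kappa> \<xi> \<in> borel_measurable (holding_times (length \<xi>))"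
proof -
  have [measurable]: "(\<lambda>\<tau>. \<tau> i) \<in> borel_measurable (holding_times (length \<xi>))"
    if "i < length \<xi>" for i
    using that by (rule measurable_holding_times_component)
  have [measurable]: "(\<lambda>\<tau>. \<tau> 0) \<in> borel_measurable (holding_times (length \<xi>))"
    using assms by (intro measurable_holding_times_component) simp
  show ?thesis
    unfolding based_loop_weight_def Let_def by measurable
qed

lemma equiv_rotation: "equiv (paths :: ('x \<times> real) list set) rotation"
proof (rule equivI)
  let ?R = "rotation :: (('x \<times> real) list \<times> ('x \<times> real) list) set"
  show "?R \<subseteq> paths \<times> paths"
    by (auto simp: rotation_def paths_def)
  show "refl_on paths ?R"
    by (auto simp: refl_on_def rotation_def intro: exI[of _ 0])
  show "sym ?R"
  proof (rule symI)
    fix \<gamma> \<gamma>' :: "('x \<times> real) list" assume "(\<gamma>, \<gamma>') \<in> rotation"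
    then obtain n where n: "\<gamma> \<in> paths" "\<gamma>' = rotate n \<gamma>" by (auto simp: rotation_def)
    let ?k = "length \<gamma>"
    have "?k > 0" using n by (simp add: paths_def)
    then have "rotate (?k - n mod ?k) \<gamma>' = \<gamma>"
      using n(2) rotate_conv_mod[of n \<gamma>] by (simp add: rotate_rotate)
    then show "(\<gamma>', \<gamma>) \<in> rotation"
      using n by (auto simp: rotation_def paths_def intro!: exI[of _ "?k - n mod ?k"])
  qed
  show "trans ?R"
    by (auto simp: trans_def rotation_def rotate_rotate)
qed

lemma occupation_rotate: "occupation (rotate n \<gamma>) = occupation \<gamma>"
proof -
  have "mset (rotate1 \<delta>) = mset \<delta>" for \<delta> :: "('a \<times> real) list"
    by (cases \<delta>) simp_all
  then have "mset (rotate n \<gamma>) = mset \<gamma>"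
    by (induction n) simp_all
  then have "mset (map f (rotate n \<gamma>)) = mset (map f \<gamma>)" for f :: "_ \<Rightarrow> real"
    by simp
  then have "sum_list (map f (rotate n \<gamma>)) = sum_list (map f \<gamma>)" for f :: "_ \<Rightarrow> real"
    by (metis sum_mset_sum_list)
  then show ?thesis by (simp add: occupation_def)
qed

lemma loop_occupation_loop_of:
  assumes "\<gamma> \<in> paths"
  shows "loop_occupation (loop_of \<gamma>) = occupation \<gamma>"
proof -
  have "occupation ` loop_of \<gamma> = {occupation \<gamma>}"
    using assms by (auto simp: loop_of_def rotation_def occupation_rotate image_iff
        intro: exI[of _ 0] simp flip: ex_simps)
  then show ?thesis by (simp add: loop_occupation_def)
qed

lemma space_loop_space: "space loop_space = paths // rotation"
  unfolding loop_space_def by (rule space_measure_of) auto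

lemma measurable_loop_of: "loop_of \<in> path_space \<rightarrow>\<^sub>M loop_space"
  unfolding loop_space_def
  by (rule measurable_measure_of) (auto simp: loop_of_def quotientI)

end

theory Submission
  imports Defs "HOL-Real_Asymp.Real_Asymp"
begin

text \<open>Both sides are compared through Laplace transforms. For a vector \<open>\<theta>\<close> with nonnegative
  entries, weighting any of the objects by \<open>exp (- \<langle>\<theta>, occupation\<rangle>)\<close> amounts to replacing the
  killing \<open>\<kappa>\<close> by \<open>\<kappa> + \<theta>\<close>: this holds for the Gaussian weight \<open>exp (- e / 2)\<close> with
  the half square as occupation (\<open>gauss_add\<close>), for the bridge weights (\<open>bridge_weight_add\<close>)
  and for the loop weights (\<open>based_loop_weight_add\<close>). Write \<open>Z \<kappa>\<close> for the integral of
  \<open>exp (- e / 2)\<close> and \<open>G \<kappa>\<close> for the Green function, defined as a sum over discrete walks.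
  Then

  \<^item> \<open>exp (- \<langle>\<theta>, \<phi> cnj \<phi> / 2\<rangle>)\<close> has expectation \<open>Z (\<kappa> + \<theta>) / Z \<kappa>\<close>, and with the additional
    factor \<open>\<phi>\<^sup>x cnj \<phi>\<^sup>y / 2\<close> it has expectation \<open>G (\<kappa> + \<theta>) x y * Z (\<kappa> + \<theta>) / Z \<kappa>\<close>;

  \<^item> the bridge measure integrates \<open>exp (- \<langle>\<theta>, occupation\<rangle>)\<close> to \<open>G (\<kappa> + \<theta>) x y\<close>;

  \<^item> the Poisson process of loops has Laplace functional
    \<open>exp (- \<integral> (1 - exp (- \<langle>\<theta>, occupation\<rangle>)) d\<mu>)\<close>.

  So both claims follow at the level of Laplace transforms from the single identity
  \<open>Z (\<kappa> + \<theta>) = Z \<kappa> * exp (- \<integral> (1 - exp (- \<langle>\<theta>, occupation\<rangle>)) d\<mu>)\<close>, which is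
  \<open>partition_function_ratio\<close>. It is proved by moving along \<open>\<kappa> + s \<theta>\<close>. The logarithmic
  derivative of \<open>Z\<close> is minus the sum of the \<open>\<theta>\<^sub>x G (\<kappa> + s \<theta>) x x\<close>, because the Gaussian
  weight has covariance \<open>2 G\<close> (\<open>gauss_covariance\<close>). The derivative of the exponent on the
  other side is the same sum, because the field of a loop at \<open>x\<close> has \<open>\<mu>\<close>-integral
  \<open>G x x\<close> (\<open>based_loop_occupation\<close>): the factor \<open>1 / p\<close> in the weight of a loop of length
  \<open>p\<close> is compensated by the freedom to root the loop at any of its visits to \<open>x\<close>, and a loop
  rooted at \<open>x\<close> is a bridge from \<open>x\<close> to \<open>x\<close>. No determinant is evaluated: the
  normalisation of the Gaussian density is only used through its total mass being one.

  The covariance comes from translation invariance of Lebesgue measure. Shifting by \<open>G k\<close>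
  completes the square and gives the exponential moments of a linear functional of the field,
  whose second order term is the variance.

  It remains to return from Laplace transforms to arbitrary bounded measurable functions. The
  left-hand side of (b) is the integral against a complex measure, so uniqueness is stated for
  functionals that are linear and continuous under bounded pointwise convergence
  (\<open>laplace_determines_functional\<close>). Integer values of \<open>\<theta>\<close> suffice: in the variables
  \<open>exp (- u\<^sub>x)\<close>, which range over the unit cube, they are the monomials, and Stone-Weierstrass
  applies.\<close>

section \<open>Functionals determined by Laplace transforms\<close>

definition bounded_borel :: "('a::topological_space \<Rightarrow> real) \<Rightarrow> bool" where
  "bounded_borel F \<longleftrightarrow> F \<in> borel_measurable borel \<and> bounded (range F)"

definition orthant :: "(real^'x::finite) set" where
  "orthant = {u. \<forall>x. 0 \<le> u $ x}"

lemma borel_measurable_vec_nth [measurable]: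
  "(\<lambda>v :: 'a::{second_countable_topology}^'x::finite. v $ x) \<in> borel_measurable borel"
  by (intro borel_measurable_continuous_onI continuous_intros)

lemma borel_measurable_vec:
  fixes f :: "'w \<Rightarrow> real^'x::finite"
  assumes "\<And>x. (\<lambda>w. f w $ x) \<in> borel_measurable M"
  shows "f \<in> borel_measurable M"
proof (subst borel_measurable_euclidean_space, intro ballI)
  fix b :: "real^'x" assume "b \<in> Basis"
  then obtain x where "b = axis x 1" by (auto simp: Basis_vec_def)
  then show "(\<lambda>w. f w \<bullet> b) \<in> borel_measurable M"
    using assms[of x] by (simp add: inner_axis)
qed

lemma orthant_borel [measurable]: "(orthant :: (real^'x::finite) set) \<in> sets borel"
proof -
  have "orthant = (\<Inter>x. {u :: real^'x. 0 \<le> u $ x})" by (auto simp: orthant_def)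
  moreover have "closed {u :: real^'x. 0 \<le> u $ x}" for x
    by (intro closed_Collect_le continuous_intros)
  ultimately have "closed (orthant :: (real^'x) set)" by (metis closed_INT)
  then show ?thesis by (rule borel_closed)
qed

text \<open>What integration against a signed, complex or vector-valued measure of finite variation
  satisfies. Using functionals allows the difference of the two sides of an identity to be treated
  as a single object, without forming differences of measures.\<close>

definition bounded_pointwise_continuous ::
  "(('a::topological_space \<Rightarrow> real) \<Rightarrow> 'b::real_normed_vector) \<Rightarrow> bool" where
  "bounded_pointwise_continuous I \<longleftrightarrow>
     (\<forall>F G. bounded_borel F \<longrightarrow> bounded_borel G \<longrightarrow> I (\<lambda>u. F u + G u) = I F + I G) \<and>
     (\<forall>c F. bounded_borel F \<longrightarrow> I (\<lambda>u. c * F u) = c *\<^sub>R I F) \<and>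
     (\<forall>F G B. (\<forall>n. bounded_borel (F n)) \<longrightarrow> (\<forall>n u. \<bar>F n u\<bar> \<le> B) \<longrightarrow>
        (\<forall>u. (\<lambda>n. F n u) \<longlonglongrightarrow> G u) \<longrightarrow> (\<lambda>n. I (F n)) \<longlonglongrightarrow> I G)"

definition exp_neg :: "real^'x \<Rightarrow> real^'x::finite" where
  "exp_neg u = (\<chi> x. exp (- (u $ x)))"

text \<open>The map \<open>exp_neg\<close> sends the orthant into the unit cube, turning exponentials of integer
  linear forms into monomials; \<open>pullback\<close> transports functions on the cube back to the
  orthant.\<close>

definition pullback :: "(real^'x \<Rightarrow> real) \<Rightarrow> real^'x::finite \<Rightarrow> real" where
  "pullback f u = (if u \<in> orthant then f (exp_neg u) else 0)"

lemma exp_neg_measurable [measurable]: "exp_neg \<in> borel_measurable borel"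
proof -
  have "continuous_on UNIV (exp_neg :: real^'x \<Rightarrow> real^'x)"
    unfolding exp_neg_def by (intro continuous_intros)
  then show ?thesis by (rule borel_measurable_continuous_onI)
qed

lemma exp_neg_mem: "u \<in> orthant \<Longrightarrow> exp_neg u \<in> cbox 0 (\<chi> x. 1)"
  by (simp add: exp_neg_def orthant_def mem_box_cart)

lemma bounded_borel_pullback:
  assumes "f \<in> borel_measurable borel" "\<And>v. v \<in> cbox 0 (\<chi> x. 1) \<Longrightarrow> \<bar>f v\<bar> \<le> B" "0 \<le> B"
  shows "bounded_borel (pullback f)"
proof -
  have [measurable]: "f \<in> borel_measurable borel" by fact
  have "pullback f \<in> borel_measurable borel" unfolding pullback_def[abs_def] by measurable
  moreover have "bounded (range (pullback f))"
    unfolding bounded_iff using assms(2,3) exp_neg_mem by (auto simp: pullback_def intro!: exI[of _ B])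
  ultimately show ?thesis by (simp add: bounded_borel_def)
qed

text \<open>The linear span of the monomials, i.e. the polynomials, in a form whose induction principle
  only asks for linearity and for the values on monomials.\<close>

inductive monomial_span :: "(real^'x::finite \<Rightarrow> real) \<Rightarrow> bool" where
  mono: "monomial_span (\<lambda>v. \<Prod>x\<in>UNIV. v $ x ^ k x)" for k :: "'x \<Rightarrow> nat"
| scale: "monomial_span f \<Longrightarrow> monomial_span (\<lambda>v. c * f v)"
| add: "monomial_span f \<Longrightarrow> monomial_span g \<Longrightarrow> monomial_span (\<lambda>v. f v + g v)"

lemma monomial_span_sum:
  "finite S \<Longrightarrow> (\<And>i. i \<in> S \<Longrightarrow> monomial_span (f i)) \<Longrightarrow> monomial_span (\<lambda>v. \<Sum>i\<in>S. f i v)"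
proof (induction S rule: finite_induct)
  case empty
  show ?case using monomial_span.scale[OF monomial_span.mono, of 0] by simp
next
  case (insert i S)
  then show ?case by (auto intro: monomial_span.add)
qed

lemma monomial_span_mult:
  assumes f: "monomial_span f" and g: "monomial_span g"
  shows "monomial_span (\<lambda>v. f v * g v)"
  using f
proof induction
  case (mono k)
  show ?case using g
  proof induction
    case (mono j)
    have "(\<lambda>v::real^'a. (\<Prod>x\<in>UNIV. v $ x ^ k x) * (\<Prod>x\<in>UNIV. v $ x ^ j x)) =
        (\<lambda>v. \<Prod>x\<in>UNIV. v $ x ^ (k x + j x))"
      by (simp add: prod.distrib power_add)
    then show ?case using monomial_span.mono[of "\<lambda>x. k x + j x"] by simp
  next
    case (scale h c)
    from monomial_span.scale[OF this(2), of c] show ?case by (simp add: algebra_simps)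
  next
    case (add h h')
    from monomial_span.add[OF this(3,4)] show ?case by (simp add: algebra_simps)
  qed
next
  case (scale h c)
  from monomial_span.scale[OF this(2), of c] show ?case by (simp add: algebra_simps)
next
  case (add h h')
  from monomial_span.add[OF this(3,4)] show ?case by (simp add: algebra_simps)
qed

lemma monomial_span_polynomial:
  fixes p :: "real^'x::finite \<Rightarrow> real"
  assumes "real_polynomial_function p"
  shows "monomial_span p"
  using assms
proof induction
  case (linear f)
  have "monomial_span (\<lambda>v::real^'x. v $ x)" for x
  proof -
    have "(\<lambda>v::real^'x. \<Prod>y\<in>UNIV. v $ y ^ (if y = x then 1 else 0)) = (\<lambda>v. v $ x)"
      by (simp add: if_distrib[of "power _"] prod.delta cong: if_cong)
    then show ?thesis using monomial_span.mono[of "\<lambda>y. if y = x then 1 else 0"] by simp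
  qed
  moreover have "f v = (\<Sum>x\<in>UNIV. f (axis x 1) * v $ x)" for v
  proof -
    interpret bounded_linear f by fact
    have "f v = f (\<Sum>x\<in>UNIV. v $ x *\<^sub>R axis x 1)"
      by (simp add: basis_expansion flip: scalar_mult_eq_scaleR)
    then show ?thesis by (simp add: sum scale mult.commute)
  qed
  ultimately show ?case
    using monomial_span_sum[of UNIV "\<lambda>x v. f (axis x 1) * v $ x"] monomial_span.scale
    by (metis (no_types, lifting) ext finite)
next
  case (const c)
  show ?case using monomial_span.scale[OF monomial_span.mono[of "\<lambda>_. 0"], of c] by simp
next
  case (add f g)
  then show ?case by (intro monomial_span.add)
next
  case (mult f g)
  then show ?case by (intro monomial_span_mult)
qed

lemma monomial_span_continuous: "monomial_span f \<Longrightarrow> continuous_on UNIV f"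
  by (induction rule: monomial_span.induct) (auto intro!: continuous_intros)

lemma bounded_borel_continuous_pullback:
  fixes f :: "real^'x::finite \<Rightarrow> real"
  assumes "continuous_on UNIV f"
  shows "bounded_borel (pullback f)"
proof -
  have "bounded (f ` cbox 0 (\<chi> x. 1))"
    by (intro compact_imp_bounded compact_continuous_image continuous_on_subset[OF assms]) auto
  then obtain B where "\<And>v. v \<in> cbox 0 (\<chi> x. 1) \<Longrightarrow> \<bar>f v\<bar> \<le> B" "B > 0"
    unfolding bounded_pos by auto
  then show ?thesis
    by (intro bounded_borel_pullback[of f B] borel_measurable_continuous_onI assms) auto
qed

lemma bounded_borel_add: "bounded_borel F \<Longrightarrow> bounded_borel G \<Longrightarrow> bounded_borel (\<lambda>u. F u + G u)"
  unfolding bounded_borel_def by (auto intro: bounded_plus_comp)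

lemma bounded_borel_scale: "bounded_borel F \<Longrightarrow> bounded_borel (\<lambda>u. c * F u)"
  unfolding bounded_borel_def
  by (auto simp: bounded_iff abs_mult) (metis abs_ge_zero mult_left_mono)

lemma bounded_borel_pullback_indicator:
  "A \<in> sets borel \<Longrightarrow> bounded_borel (pullback (indicator A))"
  by (rule bounded_borel_pullback[of _ 1]) (auto simp: indicator_def)

text \<open>The functional vanishes on monomials in \<open>exp (- u\<^sub>x)\<close> by hypothesis, hence by linearity on
  polynomials, by Stone-Weierstrass on continuous functions of \<open>exp_neg u\<close>, by bounded limits on
  indicators of closed sets, by a Dynkin argument on indicators of Borel sets, and finally on
  bounded Borel functions, which are uniform limits of finite combinations of indicators.\<close>

lemma laplace_determines_functional:
  fixes I :: "(real^'x::finite \<Rightarrow> real) \<Rightarrow> 'b::real_normed_vector"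
  assumes I: "bounded_pointwise_continuous I"
    and lap: "\<And>k :: 'x \<Rightarrow> nat. I (\<lambda>u. if u \<in> orthant then exp (- (\<Sum>x\<in>UNIV. k x * u $ x)) else 0) = 0"
    and F: "bounded_borel F" and supp: "\<And>u. u \<notin> orthant \<Longrightarrow> F u = 0"
  shows "I F = 0"
proof -
  let ?K = "cbox 0 (\<chi> x. 1) :: (real^'x) set"
  let ?P = "\<lambda>A. pullback (indicator A)"
  have I_add: "I (\<lambda>u. F u + G u) = I F + I G" if "bounded_borel F" "bounded_borel G" for F G
    using I that unfolding bounded_pointwise_continuous_def by blast
  have I_scale: "I (\<lambda>u. c * F u) = c *\<^sub>R I F" if "bounded_borel F" for c F
    using I that unfolding bounded_pointwise_continuous_def by blast
  have conv: "(\<lambda>n. I (F n)) \<longlonglongrightarrow> I G"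
    if "\<And>n. bounded_borel (F n)" "\<And>n u. \<bar>F n u\<bar> \<le> B" "\<And>u. (\<lambda>n. F n u) \<longlonglongrightarrow> G u" for F G B
    using I that unfolding bounded_pointwise_continuous_def by blast
  have lim0: "I G = 0"
    if "\<And>n. bounded_borel (F n)" "\<And>n u. \<bar>F n u\<bar> \<le> B" "\<And>u. (\<lambda>n. F n u) \<longlonglongrightarrow> G u"
       "\<And>n. I (F n) = 0" for F G B
    using conv[OF that(1-3)] by (simp add: that(4) LIMSEQ_const_iff)
  have mono: "I (pullback p) = 0" if "monomial_span p" for p
    using that
  proof induction
    case (mono k)
    have "pullback (\<lambda>v. \<Prod>x\<in>UNIV. v $ x ^ k x) =
        (\<lambda>u. if u \<in> orthant then exp (- (\<Sum>x\<in>UNIV. k x * u $ x)) else 0)"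
      by (auto simp: pullback_def exp_neg_def fun_eq_iff exp_of_nat_mult[symmetric] exp_sum[symmetric]
          sum_negf[symmetric])
    then show ?case using lap by simp
  next
    case (scale f c)
    have "pullback (\<lambda>v. c * f v) = (\<lambda>u. c * pullback f u)" by (auto simp: pullback_def)
    then show ?case
      using scale by (simp add: I_scale
          bounded_borel_continuous_pullback monomial_span_continuous)
  next
    case (add f g)
    have "pullback (\<lambda>v. f v + g v) = (\<lambda>u. pullback f u + pullback g u)" by (auto simp: pullback_def)
    then show ?case
      using add by (simp add: I_add
          bounded_borel_continuous_pullback monomial_span_continuous)
  qed
  have cont: "I (pullback f) = 0" if f: "continuous_on UNIV f" for f
  proof -
    have "\<exists>g. real_polynomial_function g \<and> (\<forall>v\<in>?K. \<bar>f v - g v\<bar> < inverse (real (Suc n)))" for n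
      by (rule Stone_Weierstrass_real_polynomial_function[OF compact_cbox continuous_on_subset[OF f]])
         auto
    then obtain g where g: "\<And>n. real_polynomial_function (g n)"
      "\<And>n v. v \<in> ?K \<Longrightarrow> \<bar>f v - g n v\<bar> < inverse (real (Suc n))" by metis
    obtain B where B: "\<And>u. \<bar>pullback f u\<bar> \<le> B"
      using bounded_borel_continuous_pullback[OF f] unfolding bounded_borel_def bounded_iff by auto
    have close: "\<bar>pullback f u - pullback (g n) u\<bar> \<le> inverse (real (Suc n))" for n u
      using g(2)[OF exp_neg_mem, of u n] by (auto simp: pullback_def)
    show ?thesis
    proof (rule lim0[of "\<lambda>n. pullback (g n)" "B + 1"])
      show "bounded_borel (pullback (g n))" for n
        by (intro bounded_borel_continuous_pullback monomial_span_continuous monomial_span_polynomial g)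
      show "\<bar>pullback (g n) u\<bar> \<le> B + 1" for n u
      proof -
        have "inverse (real (Suc n)) \<le> 1" by (simp add: field_simps)
        then show ?thesis using close[of u n] B[of u] by linarith
      qed
      show "(\<lambda>n. pullback (g n) u) \<longlonglongrightarrow> pullback f u" for u
      proof -
        have "(\<lambda>n. pullback f u - pullback (g n) u) \<longlonglongrightarrow> 0"
          by (rule tendsto_rabs_zero_cancel, rule tendsto_sandwich[OF _ _ tendsto_const LIMSEQ_inverse_real_of_nat])
             (auto intro!: always_eventually close simp del: of_nat_Suc)
        from tendsto_diff[OF tendsto_const[of "pullback f u"] this] show ?thesis by simp
      qed
      show "I (pullback (g n)) = 0" for n by (intro mono monomial_span_polynomial g)
    qed
  qed
  have zero: "I (pullback (\<lambda>_. 0)) = 0" using cont[of "\<lambda>_. 0"] by simp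
  have ind_closed: "I (?P A) = 0" if A: "closed A" for A
  proof (cases "A = {}")
    case True
    then have "?P A = pullback (\<lambda>_. 0)" by (auto simp: pullback_def)
    then show ?thesis using cont[of "\<lambda>_. 0"] by simp
  next
    case False
    \<comment> \<open>Continuous functions decreasing to the indicator of the closed set.\<close>
    define f where "f n v = max 0 (1 - real n * infdist v A)" for n and v :: "real^'x"
    have fc: "continuous_on UNIV (f n)" for n
      unfolding f_def[abs_def] by (intro continuous_intros)
    have flim: "(\<lambda>n. f n v) \<longlonglongrightarrow> indicator A v" for v
    proof (cases "v \<in> A")
      case True
      then show ?thesis by (simp add: f_def)
    next
      case notin: False
      then have pos: "infdist v A > 0"
        using infdist_pos_not_in_closed[OF A False] by simp
      obtain N :: nat where N: "1 / infdist v A < real N" using reals_Archimedean2 by blast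
      have "f n v = 0" if "n \<ge> N" for n
      proof -
        have "1 / infdist v A \<le> real n" using N that by simp
        then have "1 \<le> real n * infdist v A" using pos by (simp add: field_simps)
        then show ?thesis by (simp add: f_def)
      qed
      then have "eventually (\<lambda>n. f n v = indicator A v) sequentially"
        using notin by (auto simp: eventually_sequentially)
      then show ?thesis by (rule tendsto_eventually)
    qed
    show ?thesis
    proof (rule lim0[of "\<lambda>n. pullback (f n)" 1])
      show "bounded_borel (pullback (f n))" for n by (rule bounded_borel_continuous_pullback[OF fc])
      show "\<bar>pullback (f n) u\<bar> \<le> 1" for n u
        by (auto simp: pullback_def f_def max_def intro!: mult_nonneg_nonneg infdist_nonneg)
      show "(\<lambda>n. pullback (f n) u) \<longlonglongrightarrow> ?P A u" for u
        using flim by (simp add: pullback_def)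
      show "I (pullback (f n)) = 0" for n by (rule cont[OF fc])
    qed
  qed
  have ind: "I (?P A) = 0" if A: "A \<in> sets borel" for A
  proof -
    have sb: "sets borel = sigma_sets UNIV {A :: (real^'x) set. closed A}"
      by (simp add: borel_eq_closed)
    have A': "A \<in> sigma_sets UNIV {A :: (real^'x) set. closed A}" using A sb by simp
    have Int: "Int_stable {A :: (real^'x) set. closed A}" by (auto simp: Int_stable_def)
    show ?thesis
    proof (induction rule: sigma_sets_induct_disjoint[OF Int _ A'])
      case 1
      show ?case by simp
    next
      case (2 A)
      then show ?case by (simp add: ind_closed)
    next
      case 3
      show ?case by (simp add: zero)
    next
      case (4 A)
      have bA: "bounded_borel (?P A)" "bounded_borel (?P UNIV)"
        by (rule bounded_borel_pullback_indicator; use 4 sb in simp)+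
      have "?P (UNIV - A) =
          (\<lambda>u. ?P UNIV u + (-1) * ?P A u)"
        by (auto simp: pullback_def indicator_def fun_eq_iff)
      then show ?case
        using 4 ind_closed[of UNIV]
        by (simp only: I_add[OF bA(2) bounded_borel_scale[OF bA(1)]] I_scale[OF bA(1)]) simp
    next
      case (5 A)
      have sA: "A i \<in> sets borel" for i using 5(2) sb by auto
      have bS: "bounded_borel (?P (\<Union>i<n. A i))" for n
        by (intro bounded_borel_pullback_indicator sets.finite_UN) (auto simp: sA)
      have z: "I (?P (\<Union>i<n. A i)) = 0" for n
      proof (induction n)
        case 0
        show ?case by (simp add: zero)
      next
        case (Suc n)
        have "?P (\<Union>i<Suc n. A i) =
            (\<lambda>u. ?P (\<Union>i<n. A i) u + ?P (A n) u)"
        proof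
          fix u
          have "A i \<inter> A n = {}" if "i < n" for i
            using 5(1) that by (auto simp: disjoint_family_on_def)
          then show "?P (\<Union>i<Suc n. A i) u =
            ?P (\<Union>i<n. A i) u + ?P (A n) u"
            by (auto simp: pullback_def indicator_def less_Suc_eq)
        qed
        then show ?case
          using Suc 5(3) by (simp add: I_add[OF bS bounded_borel_pullback_indicator[OF sA]])
      qed
      show ?case
      proof (rule lim0[of "\<lambda>n. ?P (\<Union>i<n. A i)" 1, OF bS _ _ z])
        show "\<bar>?P (\<Union>i<n. A i) u\<bar> \<le> 1" for n u
          by (auto simp: pullback_def indicator_def)
        show "(\<lambda>n. ?P (\<Union>i<n. A i) u) \<longlonglongrightarrow> ?P (\<Union> (range A)) u" for u
        proof (cases "u \<in> orthant")
          case True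
          have "(\<lambda>n. indicator (\<Union>i<n. A i) (exp_neg u) :: real) \<longlonglongrightarrow> indicator (\<Union>i. A i) (exp_neg u)"
            by (rule LIMSEQ_indicator_UN)
          then show ?thesis using True by (simp add: pullback_def)
        qed (simp add: pullback_def)
      qed
    qed
  qed
  \<comment> \<open>On the orthant every function factors through the injective map \<open>exp_neg\<close>.\<close>
  define f :: "real^'x \<Rightarrow> real" where "f v = F (\<chi> x. - ln (v $ x))" for v
  have Fm [measurable]: "F \<in> borel_measurable borel" using F by (simp add: bounded_borel_def)
  have lnm [measurable]: "(\<lambda>v::real^'x. \<chi> x. - ln (v $ x)) \<in> borel_measurable borel"
    by (rule borel_measurable_vec) (simp, measurable)
  have fm [measurable]: "f \<in> borel_measurable borel" unfolding f_def by measurable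
  obtain B where B: "\<And>v. \<bar>f v\<bar> \<le> B"
    using F unfolding bounded_borel_def bounded_iff f_def by auto
  have "B \<ge> 0" using B[of 0] by linarith
  have Ff: "pullback f = F"
    by (auto simp: pullback_def f_def exp_neg_def supp fun_eq_iff)
  \<comment> \<open>Rounding down to multiples of \<open>1 / (n + 1)\<close> gives finitely many values.\<close>
  define g :: "nat \<Rightarrow> real^'x \<Rightarrow> real" where "g n v = of_int \<lfloor>real (Suc n) * f v\<rfloor> / real (Suc n)" for n v
  have gc: "f v - inverse (real (Suc n)) \<le> g n v \<and> g n v \<le> f v" for n v
  proof -
    define N where "N = real (Suc n)"
    have "N > 0" by (simp add: N_def)
    have "N * f v - 1 \<le> of_int \<lfloor>N * f v\<rfloor>" "of_int \<lfloor>N * f v\<rfloor> \<le> N * f v" by linarith+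
    then have "(N * f v - 1) / N \<le> of_int \<lfloor>N * f v\<rfloor> / N" "of_int \<lfloor>N * f v\<rfloor> / N \<le> f v"
      using \<open>N > 0\<close> by (auto simp add: pos_divide_le_eq mult.commute intro: divide_right_mono)
    moreover have "(N * f v - 1) / N = f v - inverse N"
      using \<open>N > 0\<close> by (simp add: field_simps)
    ultimately show ?thesis by (simp add: g_def N_def)
  qed
  define J where "J n = {-\<lceil>real (Suc n) * B\<rceil> .. \<lceil>real (Suc n) * B\<rceil>}" for n
  have Jf: "\<lfloor>real (Suc n) * f v\<rfloor> \<in> J n" for n v
  proof -
    have "\<bar>real (Suc n) * f v\<bar> \<le> real (Suc n) * B" using B[of v] by (simp add: abs_mult mult_left_mono)
    then show ?thesis unfolding J_def by (simp add: le_floor_iff) linarith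
  qed
  have gsum: "g n v = (\<Sum>j\<in>J n. (of_int j / real (Suc n)) * indicator {v. \<lfloor>real (Suc n) * f v\<rfloor> = j} v)" for n v
  proof -
    have "finite (J n)" by (simp add: J_def)
    have "(\<Sum>j\<in>J n. (of_int j / real (Suc n)) * indicator {v. \<lfloor>real (Suc n) * f v\<rfloor> = j} v) =
        (\<Sum>j\<in>J n. if \<lfloor>real (Suc n) * f v\<rfloor> = j then of_int j / real (Suc n) else 0)"
      by (intro sum.cong) (auto simp: indicator_def)
    also have "\<dots> = g n v"
      unfolding g_def by (simp only: sum.delta'[OF \<open>finite (J n)\<close>] Jf if_True)
    finally show ?thesis by simp
  qed
  have sm: "{v. \<lfloor>real (Suc n) * f v\<rfloor> = j} \<in> sets borel" for n j by measurable
  have sums: "bounded_borel (pullback (\<lambda>v. \<Sum>j\<in>S. c j * indicator (A j) v)) \<and>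
      I (pullback (\<lambda>v. \<Sum>j\<in>S. c j * indicator (A j) v)) = 0"
    if "finite S" "\<And>j. A j \<in> sets borel" for S :: "int set" and c A
    using that(1)
  proof induction
    case empty
    then show ?case using cont[of "\<lambda>_. 0"] bounded_borel_continuous_pullback[of "\<lambda>_. 0"] by simp
  next
    case (insert j S)
    have e: "pullback (\<lambda>v. \<Sum>j\<in>insert j S. c j * indicator (A j) v) =
      (\<lambda>u. c j * ?P (A j) u + pullback (\<lambda>v. \<Sum>j\<in>S. c j * indicator (A j) v) u)"
    proof
      fix u
      show "pullback (\<lambda>v. \<Sum>j\<in>insert j S. c j * indicator (A j) v) u =
        c j * ?P (A j) u + pullback (\<lambda>v. \<Sum>j\<in>S. c j * indicator (A j) v) u"
        by (cases "u \<in> orthant")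
          (simp_all only: pullback_def sum.insert[OF insert(1,2)] if_True if_False mult_zero_right add_0_right)
    qed
    have b: "bounded_borel (?P (A j))" by (rule bounded_borel_pullback_indicator[OF that(2)])
    show ?case unfolding e using insert.IH
      by (simp add: I_add[OF bounded_borel_scale[OF b]] bounded_borel_add bounded_borel_scale b I_scale
          ind[OF that(2)])
  qed
  have "I (pullback f) = 0"
  proof (rule lim0[of "\<lambda>n. pullback (g n)" "B + 1"])
    have gg: "g n = (\<lambda>v. \<Sum>j\<in>J n. (of_int j / real (Suc n)) * indicator {v. \<lfloor>real (Suc n) * f v\<rfloor> = j} v)" for n
      using gsum by blast
    show "bounded_borel (pullback (g n))" "I (pullback (g n)) = 0" for n
      unfolding gg by (rule conjunct1[OF sums] conjunct2[OF sums]; simp add: J_def)+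
    show "\<bar>pullback (g n) u\<bar> \<le> B + 1" for n u
    proof -
      have "inverse (real (Suc n)) \<le> 1" by (simp add: field_simps)
      then show ?thesis using gc[of "exp_neg u" n] B[of "exp_neg u"] \<open>B \<ge> 0\<close>
        by (auto simp: pullback_def)
    qed
    show "(\<lambda>n. pullback (g n) u) \<longlonglongrightarrow> pullback f u" for u
    proof -
      have "(\<lambda>n. g n v) \<longlonglongrightarrow> f v" for v
      proof (rule tendsto_sandwich[OF _ _ _ tendsto_const])
        show "(\<lambda>n. f v - inverse (real (Suc n))) \<longlonglongrightarrow> f v"
          using tendsto_diff[OF tendsto_const LIMSEQ_inverse_real_of_nat, of "f v"] by simp
      qed (use gc in auto)
      then show ?thesis by (simp add: pullback_def)
    qed
  qed
  then show ?thesis using Ff by simp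
qed

section \<open>Integration over path spaces\<close>

lemma sets_path_measure [simp]: "sets (path_measure \<Xi> w) = sets path_space"
  unfolding path_measure_def
  by (rule trans[OF sets_measure_of[OF sets.space_closed] sets.sigma_sets_eq])

lemma space_path_measure [simp]: "space (path_measure \<Xi> w) = paths"
  using sets_eq_imp_space_eq[OF sets_path_measure] by simp

lemma nn_integral_path_measure:
  fixes \<Xi> :: "'x list set"
  assumes ne: "\<And>\<xi>. \<xi> \<in> \<Xi> \<Longrightarrow> \<xi> \<noteq> []"
    and w: "\<And>\<xi>. \<xi> \<in> \<Xi> \<Longrightarrow> w \<xi> \<in> borel_measurable (holding_times (length \<xi>))"
    and f: "f \<in> borel_measurable path_space"
  shows "(\<integral>\<^sup>+\<gamma>. f \<gamma> \<partial>path_measure \<Xi> w) =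
     (\<integral>\<^sup>+\<xi>. (\<integral>\<^sup>+\<tau>. ennreal (w \<xi> \<tau>) * f (timed_path \<xi> \<tau>) \<partial>holding_times (length \<xi>)) \<partial>count_space \<Xi>)"
  using f
proof (induction rule: borel_measurable_induct)
  case (cong f g)
  let ?J = "\<lambda>\<xi> f. \<integral>\<^sup>+\<tau>. ennreal (w \<xi> \<tau>) * f (timed_path \<xi> \<tau>) \<partial>holding_times (length \<xi>)"
  have "(\<integral>\<^sup>+\<gamma>. f \<gamma> \<partial>path_measure \<Xi> w) = (\<integral>\<^sup>+\<gamma>. g \<gamma> \<partial>path_measure \<Xi> w)"
    using cong(3) by (intro nn_integral_cong) simp
  moreover have "(\<integral>\<^sup>+\<xi>. ?J \<xi> f \<partial>count_space \<Xi>)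
     = (\<integral>\<^sup>+\<xi>. ?J \<xi> g \<partial>count_space \<Xi>)"
  proof (intro nn_integral_cong)
    fix \<xi> \<tau> assume "\<xi> \<in> space (count_space \<Xi>)" "\<tau> \<in> space (holding_times (length \<xi>))"
    then have "timed_path \<xi> \<tau> \<in> paths" using timed_path_in_paths[OF ne] by simp
    then show "ennreal (w \<xi> \<tau>) * f (timed_path \<xi> \<tau>) = ennreal (w \<xi> \<tau>) * g (timed_path \<xi> \<tau>)"
      using cong(3) by simp
  qed
  ultimately show ?case using cong by simp
next
  case (set A)
  then show ?case by (simp add: emeasure_path_measure[OF ne w])
next
  case (mult u c)
  let ?J = "\<lambda>\<xi> f. \<integral>\<^sup>+\<tau>. ennreal (w \<xi> \<tau>) * f (timed_path \<xi> \<tau>) \<partial>holding_times (length \<xi>)"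
  have m: "(\<lambda>\<tau>. ennreal (w \<xi> \<tau>) * u (timed_path \<xi> \<tau>)) \<in> borel_measurable (holding_times (length \<xi>))"
    if "\<xi> \<in> \<Xi>" for \<xi>
    using w[OF that] measurable_compose[OF measurable_timed_path[OF ne[OF that]] mult(2)] by measurable
  have "(\<integral>\<^sup>+\<gamma>. c * u \<gamma> \<partial>path_measure \<Xi> w) = c * (\<integral>\<^sup>+\<gamma>. u \<gamma> \<partial>path_measure \<Xi> w)"
    using mult(2) by (intro nn_integral_cmult) (simp cong: measurable_cong_sets)
  also have "\<dots> = (\<integral>\<^sup>+\<xi>. c * ?J \<xi> u \<partial>count_space \<Xi>)"
    by (simp add: mult(4) nn_integral_cmult)
  also have "\<dots> = (\<integral>\<^sup>+\<xi>. ?J \<xi> (\<lambda>\<gamma>. c * u \<gamma>) \<partial>count_space \<Xi>)"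
    by (intro nn_integral_cong) (simp add: nn_integral_cmult[OF m, symmetric] mult_ac)
  finally show ?case .
next
  case (add u v)
  let ?J = "\<lambda>\<xi> f. \<integral>\<^sup>+\<tau>. ennreal (w \<xi> \<tau>) * f (timed_path \<xi> \<tau>) \<partial>holding_times (length \<xi>)"
  have m: "(\<lambda>\<tau>. ennreal (w \<xi> \<tau>) * f (timed_path \<xi> \<tau>)) \<in> borel_measurable (holding_times (length \<xi>))"
    if "\<xi> \<in> \<Xi>" "f \<in> borel_measurable path_space" for \<xi> and f :: "_ \<Rightarrow> ennreal"
    using w[OF that(1)] measurable_compose[OF measurable_timed_path[OF ne[OF that(1)]] that(2)] by measurable
  have "(\<integral>\<^sup>+\<gamma>. v \<gamma> + u \<gamma> \<partial>path_measure \<Xi> w) = (\<integral>\<^sup>+\<gamma>. v \<gamma> \<partial>path_measure \<Xi> w) + (\<integral>\<^sup>+\<gamma>. u \<gamma> \<partial>path_measure \<Xi> w)"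
    using add(1,3) by (intro nn_integral_add) (simp_all cong: measurable_cong_sets)
  also have "\<dots> = (\<integral>\<^sup>+\<xi>. ?J \<xi> v
      + ?J \<xi> u \<partial>count_space \<Xi>)"
    by (simp add: add nn_integral_add)
  also have "\<dots> = (\<integral>\<^sup>+\<xi>. ?J \<xi> (\<lambda>\<gamma>. v \<gamma> + u \<gamma>) \<partial>count_space \<Xi>)"
    using add(1,3) by (intro nn_integral_cong) (simp add: nn_integral_add[OF m m, symmetric] distrib_left)
  finally show ?case .
next
  case (seq U)
  let ?J = "\<lambda>\<xi> f. \<integral>\<^sup>+\<tau>. ennreal (w \<xi> \<tau>) * f (timed_path \<xi> \<tau>) \<partial>holding_times (length \<xi>)"
  have m: "(\<lambda>\<tau>. ennreal (w \<xi> \<tau>) * U i (timed_path \<xi> \<tau>)) \<in> borel_measurable (holding_times (length \<xi>))"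
    if "\<xi> \<in> \<Xi>" for \<xi> i
    using w[OF that(1)] measurable_compose[OF measurable_timed_path[OF ne[OF that(1)]] seq(1)] by measurable
  have inc: "U i \<gamma> \<le> U j \<gamma>" if "i \<le> j" for i j \<gamma>
    using seq(3) that by (auto simp: incseq_def le_fun_def)
  have "(\<integral>\<^sup>+\<gamma>. (SUP i. U i \<gamma>) \<partial>path_measure \<Xi> w) = (SUP i. \<integral>\<^sup>+\<gamma>. U i \<gamma> \<partial>path_measure \<Xi> w)"
    using seq(1,3) by (intro nn_integral_monotone_convergence_SUP) (simp_all cong: measurable_cong_sets)
  also have "\<dots> = (SUP i. \<integral>\<^sup>+\<xi>. ?J \<xi> (U i) \<partial>count_space \<Xi>)"
    by (simp add: seq)
  also have "\<dots> = (\<integral>\<^sup>+\<xi>. (SUP i. ?J \<xi> (U i)) \<partial>count_space \<Xi>)"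
    by (intro nn_integral_monotone_convergence_SUP[symmetric])
       (auto simp: incseq_def le_fun_def intro!: nn_integral_mono mult_left_mono inc)
  also have "\<dots> = (\<integral>\<^sup>+\<xi>. ?J \<xi> (\<lambda>\<gamma>. SUP i. U i \<gamma>) \<partial>count_space \<Xi>)"
  proof (intro nn_integral_cong)
    fix \<xi> assume "\<xi> \<in> space (count_space \<Xi>)"
    then have "\<xi> \<in> \<Xi>" by simp
    then show "(SUP i. ?J \<xi> (U i)) =
      ?J \<xi> (\<lambda>\<gamma>. SUP i. U i \<gamma>)"
      unfolding SUP_mult_left_ennreal
      by (intro nn_integral_monotone_convergence_SUP[symmetric] m)
         (auto simp: incseq_def le_fun_def intro!: mult_left_mono inc)
  qed
  finally show ?case by (simp add: image_comp SUP_apply)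
qed

text \<open>The sigma-algebra on paths is final for the parametrisations \<open>timed_path \<xi>\<close>, so
  measurability can be tested on each discrete path separately.\<close>

lemma measurable_path_spaceI:
  assumes sp: "\<And>\<gamma>. \<gamma> \<in> paths \<Longrightarrow> f \<gamma> \<in> space N"
    and m: "\<And>\<xi>. \<xi> \<noteq> [] \<Longrightarrow> (\<lambda>\<tau>. f (timed_path \<xi> \<tau>)) \<in> holding_times (length \<xi>) \<rightarrow>\<^sub>M N"
  shows "f \<in> path_space \<rightarrow>\<^sub>M N"
proof (rule measurableI)
  show "f \<gamma> \<in> space N" if "\<gamma> \<in> space path_space" for \<gamma> using sp that by simp
  fix A assume A: "A \<in> sets N"
  show "f -` A \<inter> space path_space \<in> sets path_space"
    unfolding sets_path_space
  proof (intro CollectI conjI allI impI)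
    fix \<xi> :: "'a list" assume \<xi>: "\<xi> \<noteq> []"
    have "timed_path \<xi> -` (f -` A \<inter> space path_space) \<inter> space (holding_times (length \<xi>)) =
        (\<lambda>\<tau>. f (timed_path \<xi> \<tau>)) -` A \<inter> space (holding_times (length \<xi>))"
      using timed_path_in_paths[OF \<xi>] by auto
    then show "timed_path \<xi> -` (f -` A \<inter> space path_space) \<inter> space (holding_times (length \<xi>))
        \<in> sets (holding_times (length \<xi>))"
      using measurable_sets[OF m[OF \<xi>] A] by simp
  qed simp
qed

lemma occupation_timed_path:
  "occupation (timed_path \<xi> \<tau>) $ u = (\<Sum>i<length \<xi>. if \<xi> ! i = u then \<tau> i else 0)"
  by (simp add: occupation_def timed_path_def sum_list_sum_nth atLeast0LessThan)

lemma inner_occupation_timed_path: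
  "\<theta> \<bullet> occupation (timed_path \<xi> \<tau>) = (\<Sum>i<length \<xi>. \<theta> $ (\<xi> ! i) * \<tau> i)"
proof -
  have "\<theta> \<bullet> occupation (timed_path \<xi> \<tau>) = (\<Sum>u\<in>UNIV. \<Sum>i<length \<xi>. if \<xi> ! i = u then \<theta> $ u * \<tau> i else 0)"
    by (simp add: inner_vec_def occupation_timed_path sum_distrib_left if_distrib[of "\<lambda>x. _ * x"] cong: if_cong)
  also have "\<dots> = (\<Sum>i<length \<xi>. \<Sum>u\<in>UNIV. if \<xi> ! i = u then \<theta> $ u * \<tau> i else 0)"
    by (rule sum.swap)
  also have "\<dots> = (\<Sum>i<length \<xi>. \<theta> $ (\<xi> ! i) * \<tau> i)" by simp
  finally show ?thesis .
qed

lemma measurable_occupation [measurable]: "occupation \<in> path_space \<rightarrow>\<^sub>M borel"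
proof (rule measurable_path_spaceI)
  fix \<xi> :: "'a list"
  have [measurable]: "(\<lambda>\<tau>. \<tau> i) \<in> borel_measurable (holding_times (length \<xi>))"
    if "i < length \<xi>" for i
    using that by (rule measurable_holding_times_component)
  show "(\<lambda>\<tau>. occupation (timed_path \<xi> \<tau>)) \<in> borel_measurable (holding_times (length \<xi>))"
    by (rule borel_measurable_vec) (unfold occupation_timed_path, measurable)
qed simp

lemma occupation_nonneg: "\<gamma> \<in> paths \<Longrightarrow> 0 \<le> occupation \<gamma> $ x"
  by (auto simp: occupation_def paths_def intro!: sum_list_nonneg split: if_splits) fastforce

lemma total_rate_add [simp]: "total_rate C (\<kappa> + \<theta>) $ x = total_rate C \<kappa> $ x + \<theta> $ x"
  by (simp add: total_rate_def)

text \<open>A path spends the time \<open>\<tau> i\<close> at \<open>\<xi> ! i\<close>, so the exponential of its occupation field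
  merges with the factors \<open>exp (- \<lambda> \<tau> i)\<close> of the weight.\<close>

lemma bridge_weight_add:
  "bridge_weight C \<kappa> \<xi> \<tau> * exp (- (\<theta> \<bullet> occupation (timed_path \<xi> \<tau>))) = bridge_weight C (\<kappa> + \<theta>) \<xi> \<tau>"
proof -
  have "exp (- (\<theta> \<bullet> occupation (timed_path \<xi> \<tau>))) = (\<Prod>i<length \<xi>. exp (- (\<theta> $ (\<xi> ! i) * \<tau> i)))"
    by (simp add: inner_occupation_timed_path exp_sum flip: sum_negf)
  then show ?thesis
    by (simp add: bridge_weight_def mult.assoc flip: prod.distrib exp_add)
       (simp add: algebra_simps)
qed

text \<open>The same computation; it also covers trivial loops, whose density \<open>1 / \<tau>\<close> is unaffected by
  the change of killing.\<close>

lemma based_loop_weight_add: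
  assumes "\<xi> \<noteq> []"
  shows "based_loop_weight C \<kappa> \<xi> \<tau> * exp (- (\<theta> \<bullet> occupation (timed_path \<xi> \<tau>))) = based_loop_weight C (\<kappa> + \<theta>) \<xi> \<tau>"
proof -
  have e: "exp (- (\<theta> \<bullet> occupation (timed_path \<xi> \<tau>))) = (\<Prod>i<length \<xi>. exp (- (\<theta> $ (\<xi> ! i) * \<tau> i)))"
    by (simp add: inner_occupation_timed_path exp_sum flip: sum_negf)
  show ?thesis
  proof (cases "length \<xi> = 1")
    case True
    then show ?thesis unfolding e by (simp add: based_loop_weight_def algebra_simps flip: exp_add)
  next
    case False
    then show ?thesis unfolding e
      by (simp add: based_loop_weight_def Let_def mult.assoc flip: prod.distrib exp_add)
         (simp add: algebra_simps)
  qed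
qed

lemma nn_integral_exp_holding:
  assumes l: "0 < l"
  shows "(\<integral>\<^sup>+t. ennreal (t ^ n * exp (- l * t)) \<partial>restrict_space lborel {0<..}) = ennreal (fact n / l ^ Suc n)"
proof -
  have "(\<integral>\<^sup>+t. ennreal (t ^ n * exp (- l * t)) \<partial>restrict_space lborel {0<..}) =
      (\<integral>\<^sup>+t. ennreal (t ^ n * exp (- l * t)) * indicator {0<..} t \<partial>lborel)"
    by (subst nn_integral_restrict_space) simp_all
  also have "\<dots> = (\<integral>\<^sup>+t. ennreal (1 / l) * ennreal (erlang_density 0 l t * t ^ n) \<partial>lborel)"
  proof (rule nn_integral_cong_AE, use AE_lborel_singleton[of "0::real"] in eventually_elim)
    fix t :: real assume "t \<noteq> 0"
    then show "ennreal (t ^ n * exp (- l * t)) * indicator {0<..} t =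
        ennreal (1 / l) * ennreal (erlang_density 0 l t * t ^ n)"
      using l by (auto simp: erlang_density_def indicator_def ennreal_mult[symmetric] mult_ac)
  qed
  also have "\<dots> = ennreal (1 / l) * ennreal (fact n / l ^ n)"
    using nn_integral_erlang_ith_moment[OF l, of 0 n] by (simp add: nn_integral_cmult)
  also have "\<dots> = ennreal (fact n / l ^ Suc n)"
    using l by (simp add: ennreal_mult[symmetric])
  finally show ?thesis .
qed

lemma nn_integral_holding_times_prod:
  assumes "\<And>i. i < n \<Longrightarrow> f i \<in> borel_measurable (restrict_space lborel {0<..})"
  shows "(\<integral>\<^sup>+\<tau>. (\<Prod>i<n. f i (\<tau> i)) \<partial>holding_times n) = (\<Prod>i<n. \<integral>\<^sup>+t. f i t \<partial>restrict_space lborel {0<..})"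
proof -
  interpret s: sigma_finite_measure "restrict_space lborel {0::real<..}"
    by (rule sigma_finite_measure_restrict_space) (auto intro: sigma_finite_lborel)
  interpret product_sigma_finite "\<lambda>_::nat. restrict_space lborel {0::real<..}"
    by unfold_locales
  show ?thesis unfolding holding_times_def
    by (rule product_nn_integral_prod) (use assms in auto)
qed

lemma nn_integral_holding_times_exp:
  fixes l :: "nat \<Rightarrow> real" and e :: "nat \<Rightarrow> nat"
  assumes "\<And>i. i < n \<Longrightarrow> 0 < l i"
  shows "(\<integral>\<^sup>+\<tau>. ennreal (\<Prod>i<n. \<tau> i ^ e i * exp (- l i * \<tau> i)) \<partial>holding_times n) =
    ennreal (\<Prod>i<n. fact (e i) / l i ^ Suc (e i))"
proof -
  have "(\<integral>\<^sup>+\<tau>. ennreal (\<Prod>i<n. \<tau> i ^ e i * exp (- l i * \<tau> i)) \<partial>holding_times n) =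
      (\<integral>\<^sup>+\<tau>. (\<Prod>i<n. ennreal (\<tau> i ^ e i * exp (- l i * \<tau> i))) \<partial>holding_times n)"
    by (intro nn_integral_cong prod_ennreal[symmetric])
       (auto simp: holding_times_def space_PiM space_restrict_space PiE_iff intro!: mult_nonneg_nonneg zero_le_power less_imp_le)
  also have "\<dots> = (\<Prod>i<n. \<integral>\<^sup>+t. ennreal (t ^ e i * exp (- l i * t)) \<partial>restrict_space lborel {0<..})"
    by (rule nn_integral_holding_times_prod) (intro measurable_restrict_space1, measurable)
  also have "\<dots> = (\<Prod>i<n. ennreal (fact (e i) / l i ^ Suc (e i)))"
    using assms by (intro prod.cong refl nn_integral_exp_holding) auto
  also have "\<dots> = ennreal (\<Prod>i<n. fact (e i) / l i ^ Suc (e i))"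
    using assms by (intro prod_ennreal) (auto intro!: divide_nonneg_pos zero_less_power simp del: power_Suc)
  finally show ?thesis .
qed

section \<open>Networks and the Green function\<close>

text \<open>Conditions that are stable under an increase of the killing (\<open>network_add\<close>), so that each
  lemma about them applies at every \<open>\<kappa> + \<theta>\<close>.\<close>

definition network :: "real^'x^'x \<Rightarrow> real^'x::finite \<Rightarrow> bool" where
  "network C \<kappa> \<longleftrightarrow>
     (\<forall>x y. C $ x $ y = C $ y $ x) \<and> (\<forall>x y. 0 \<le> C $ x $ y) \<and> (\<forall>x. C $ x $ x = 0) \<and>
     (\<forall>x. 0 < total_rate C \<kappa> $ x) \<and> (\<forall>z. z \<noteq> 0 \<longrightarrow> 0 < energy C \<kappa> z)"

lemma networkD:
  assumes "network C \<kappa>"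
  shows "C $ x $ y = C $ y $ x" "0 \<le> C $ x $ y" "C $ x $ x = 0" "0 < total_rate C \<kappa> $ x"
    "z \<noteq> 0 \<Longrightarrow> 0 < energy C \<kappa> z"
  using assms by (auto simp: network_def)

lemma energy_add: "energy C (\<kappa> + \<theta>) z = energy C \<kappa> z + (\<Sum>x\<in>UNIV. \<theta> $ x * (norm (z $ x))\<^sup>2)"
  by (simp add: energy_def algebra_simps sum.distrib)

lemma network_add:
  assumes "network C \<kappa>" "\<theta> \<in> orthant"
  shows "network C (\<kappa> + \<theta>)"
  using assms unfolding network_def orthant_def
  by (auto simp: energy_add intro!: add_pos_nonneg sum_nonneg)

definition walks :: "nat \<Rightarrow> 'x \<Rightarrow> 'x \<Rightarrow> 'x list set" where
  "walks n x y = {\<xi>. length \<xi> = Suc n \<and> hd \<xi> = x \<and> last \<xi> = y}"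

text \<open>The bridge weight with the holding times integrated out.\<close>

definition walk_weight :: "real^'x^'x \<Rightarrow> real^'x \<Rightarrow> 'x::finite list \<Rightarrow> real" where
  "walk_weight C \<kappa> \<xi> = (\<Prod>i<length \<xi> - 1. C $ (\<xi> ! i) $ (\<xi> ! Suc i)) * (\<Prod>i<length \<xi>. 1 / total_rate C \<kappa> $ (\<xi> ! i))"

definition walk_sum :: "real^'x^'x \<Rightarrow> real^'x \<Rightarrow> nat \<Rightarrow> 'x \<Rightarrow> 'x::finite \<Rightarrow> real" where
  "walk_sum C \<kappa> n x y = (\<Sum>\<xi>\<in>walks n x y. walk_weight C \<kappa> \<xi>)"

text \<open>The expansion of the inverse of \<open>rate_matrix C \<kappa> - C\<close> over walks; convergence is
  \<open>summable_walk_sum\<close> and the inverse property is \<open>green_equation\<close>.\<close>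

definition green :: "real^'x^'x \<Rightarrow> real^'x \<Rightarrow> 'x \<Rightarrow> 'x::finite \<Rightarrow> real" where
  "green C \<kappa> x y = (\<Sum>n. walk_sum C \<kappa> n x y)"

lemma finite_lists_of_length: "finite {\<xi> :: 'x::finite list. length \<xi> = n \<and> P \<xi>}"
  by (rule finite_subset[OF _ finite_lists_length_eq[of UNIV n]]) auto

lemma finite_walks [simp]: "finite (walks n x (y :: 'x::finite))"
  unfolding walks_def by (rule finite_lists_of_length)

lemma walk_weight_nonneg: "network C \<kappa> \<Longrightarrow> 0 \<le> walk_weight C \<kappa> \<xi>"
  unfolding walk_weight_def
  by (intro mult_nonneg_nonneg prod_nonneg ballI divide_nonneg_pos networkD) (auto simp: networkD less_imp_le)

lemma walk_sum_nonneg: "network C \<kappa> \<Longrightarrow> 0 \<le> walk_sum C \<kappa> n x y"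
  unfolding walk_sum_def by (intro sum_nonneg walk_weight_nonneg)

lemma walk_sum_0: "walk_sum C \<kappa> 0 x y = (if x = y then 1 / total_rate C \<kappa> $ x else 0)"
proof -
  have "walks 0 x y = (if x = y then {[x]} else {})"
    by (auto simp: walks_def length_Suc_conv)
  then show ?thesis by (simp add: walk_sum_def walk_weight_def)
qed

lemma walk_weight_Cons:
  assumes "\<xi> \<noteq> []"
  shows "walk_weight C \<kappa> (x # \<xi>) = C $ x $ hd \<xi> / total_rate C \<kappa> $ x * walk_weight C \<kappa> \<xi>"
proof -
  obtain n where n: "length \<xi> = Suc n" using assms by (cases \<xi>) auto
  show ?thesis using assms
    by (simp add: walk_weight_def n prod.lessThan_Suc_shift hd_conv_nth del: prod.lessThan_Suc)
qed

lemma walk_sum_Suc: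
  "walk_sum C \<kappa> (Suc n) x y = (\<Sum>z\<in>UNIV. C $ x $ z * walk_sum C \<kappa> n z y) / total_rate C \<kappa> $ x"
proof -
  have W: "walks (Suc n) x y = (\<Union>z. (#) x ` walks n z y)"
  proof (intro equalityI subsetI)
    fix \<xi> assume "\<xi> \<in> walks (Suc n) x y"
    then obtain \<eta> where "\<xi> = x # \<eta>" "length \<eta> = Suc n" "last \<eta> = y"
      by (cases \<xi>) (auto simp: walks_def split: if_splits)
    then show "\<xi> \<in> (\<Union>z. (#) x ` walks n z y)" by (auto simp: walks_def)
  qed (auto simp: walks_def)
  have "walk_sum C \<kappa> (Suc n) x y = (\<Sum>z\<in>UNIV. \<Sum>\<xi>\<in>(#) x ` walks n z y. walk_weight C \<kappa> \<xi>)"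
    unfolding walk_sum_def W
  proof (rule sum.UNION_disjoint)
    show "\<forall>z\<in>UNIV. \<forall>z'\<in>UNIV. z \<noteq> z' \<longrightarrow> (#) x ` walks n z y \<inter> (#) x ` walks n z' y = {}"
      by (auto simp: walks_def)
  qed auto
  also have "\<dots> = (\<Sum>z\<in>UNIV. \<Sum>\<xi>\<in>walks n z y. walk_weight C \<kappa> (x # \<xi>))"
    by (simp add: sum.reindex)
  also have "\<dots> = (\<Sum>z\<in>UNIV. \<Sum>\<xi>\<in>walks n z y. C $ x $ z / total_rate C \<kappa> $ x * walk_weight C \<kappa> \<xi>)"
    by (intro sum.cong refl, subst walk_weight_Cons) (auto simp: walks_def)
  also have "\<dots> = (\<Sum>z\<in>UNIV. C $ x $ z * walk_sum C \<kappa> n z y) / total_rate C \<kappa> $ x"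
    by (simp add: walk_sum_def sum_distrib_left sum_divide_distrib)
  finally show ?thesis .
qed

lemma energy_scaleR: "energy C \<kappa> (r *\<^sub>R z) = r\<^sup>2 * energy C \<kappa> z"
proof -
  have a: "(norm ((r *\<^sub>R z) $ x))\<^sup>2 = r\<^sup>2 * (norm (z $ x))\<^sup>2" for x
    by (simp add: power_mult_distrib)
  have b: "of_real (C $ x $ y) * (r *\<^sub>R z) $ x * cnj ((r *\<^sub>R z) $ y) =
      of_real (r\<^sup>2) * (of_real (C $ x $ y) * z $ x * cnj (z $ y))" for x y
    unfolding vector_scaleR_component by (simp add: scaleR_conv_of_real power2_eq_square mult_ac)
  have "Re (\<Sum>x\<in>UNIV. \<Sum>y\<in>UNIV. of_real (r\<^sup>2) * (of_real (C $ x $ y) * z $ x * cnj (z $ y))) =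
      r\<^sup>2 * Re (\<Sum>x\<in>UNIV. \<Sum>y\<in>UNIV. of_real (C $ x $ y) * z $ x * cnj (z $ y))"
    unfolding sum_distrib_left[symmetric] by (simp only: Re_complex_of_real times_complex.sel Im_complex_of_real mult_zero_left diff_zero)
  moreover have "(\<Sum>x\<in>UNIV. total_rate C \<kappa> $ x * (r\<^sup>2 * (norm (z $ x))\<^sup>2)) = r\<^sup>2 * (\<Sum>x\<in>UNIV. total_rate C \<kappa> $ x * (norm (z $ x))\<^sup>2)"
    by (simp add: sum_distrib_left mult_ac)
  ultimately show ?thesis unfolding energy_def a b by (simp only: right_diff_distrib)
qed

lemma energy_coercive:
  assumes "network C \<kappa>"
  obtains c where "c > 0" "\<And>z. c * (norm z)\<^sup>2 \<le> energy C \<kappa> z"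
proof -
  have "continuous_on (sphere 0 1) (energy C \<kappa>)"
    unfolding energy_def[abs_def] by (intro continuous_intros)
  moreover have "sphere 0 1 \<noteq> ({} :: (complex^'a) set)" by simp
  ultimately obtain z0 :: "complex^'a" where z0: "norm z0 = 1"
      "\<And>z. norm z = 1 \<Longrightarrow> energy C \<kappa> z0 \<le> energy C \<kappa> z"
    using continuous_attains_inf[OF compact_sphere, of 0 1 "energy C \<kappa>"] by auto
  have p: "0 < energy C \<kappa> z0" using z0(1) by (intro networkD(5)[OF assms]) auto
  have "energy C \<kappa> z0 * (norm z)\<^sup>2 \<le> energy C \<kappa> z" for z :: "complex^'a"
  proof (cases "z = 0")
    case True
    then show ?thesis using energy_scaleR[of C \<kappa> 0 0] by simp
  next
    case False
    have "energy C \<kappa> z = energy C \<kappa> (norm z *\<^sub>R ((1 / norm z) *\<^sub>R z))" using False by simp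
    also have "\<dots> = (norm z)\<^sup>2 * energy C \<kappa> ((1 / norm z) *\<^sub>R z)" by (rule energy_scaleR)
    also have "\<dots> \<ge> (norm z)\<^sup>2 * energy C \<kappa> z0"
      using False by (intro mult_left_mono z0(2)) auto
    finally show ?thesis by (simp add: mult.commute)
  qed
  with p show ?thesis by (rule that)
qed

lemma energy_of_real:
  "energy C \<kappa> (\<chi> x. complex_of_real (u x)) =
    (\<Sum>x\<in>UNIV. u x * (total_rate C \<kappa> $ x * u x - (\<Sum>z\<in>UNIV. C $ x $ z * u z)))"
  by (simp add: energy_def right_diff_distrib sum_subtractf sum_distrib_left power2_eq_square mult_ac
      flip: of_real_mult)

text \<open>The partial sums \<open>u N\<close>, as functions of the starting point, satisfy
  \<open>\<lambda> * u (Suc N) = \<delta> + C u N\<close> and increase with \<open>N\<close>, so \<open>\<lambda> * u N - C u N \<le> \<delta>\<close>. Pairing with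
  \<open>u N\<close> bounds the energy of \<open>u N\<close> by its value at the end point \<open>y\<close>, while by coercivity the
  energy dominates a multiple of the squared norm. This bounds \<open>u N\<close> uniformly in \<open>N\<close>.\<close>

lemma summable_walk_sum:
  assumes net: "network C \<kappa>"
  shows "summable (\<lambda>n. walk_sum C \<kappa> n x y)"
proof -
  define u where "u N x = (\<Sum>n<N. walk_sum C \<kappa> n x y)" for N x
  let ?u = "\<lambda>N. \<chi> x. complex_of_real (u N x)"
  have u0: "0 \<le> u N x" for N x unfolding u_def by (intro sum_nonneg walk_sum_nonneg net)
  have step: "total_rate C \<kappa> $ x * u (Suc N) x = (if x = y then 1 else 0) + (\<Sum>z\<in>UNIV. C $ x $ z * u N z)" for N x
  proof -
    have "u (Suc N) x = walk_sum C \<kappa> 0 x y + (\<Sum>n<N. walk_sum C \<kappa> (Suc n) x y)"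
      by (simp add: u_def sum.lessThan_Suc_shift del: sum.lessThan_Suc)
    also have "\<dots> = ((if x = y then 1 else 0) + (\<Sum>n<N. \<Sum>z\<in>UNIV. C $ x $ z * walk_sum C \<kappa> n z y)) / total_rate C \<kappa> $ x"
      by (simp add: walk_sum_0 walk_sum_Suc add_divide_distrib sum_divide_distrib)
    also have "(\<Sum>n<N. \<Sum>z\<in>UNIV. C $ x $ z * walk_sum C \<kappa> n z y) = (\<Sum>z\<in>UNIV. C $ x $ z * u N z)"
      unfolding u_def sum_distrib_left by (rule sum.swap)
    finally show ?thesis using networkD(4)[OF net, of x] by (simp add: field_simps)
  qed
  obtain c where c: "c > 0" "\<And>z. c * (norm z)\<^sup>2 \<le> energy C \<kappa> z"
    using energy_coercive[OF net] by blast
  have e: "energy C \<kappa> (?u N) \<le> u N y" for N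
  proof -
    have "u N x * (total_rate C \<kappa> $ x * u N x - (\<Sum>z\<in>UNIV. C $ x $ z * u N z)) \<le> (if x = y then u N y else 0)" for x
    proof -
      have "u N x \<le> u (Suc N) x" by (simp add: u_def walk_sum_nonneg net)
      then have "total_rate C \<kappa> $ x * u N x \<le> total_rate C \<kappa> $ x * u (Suc N) x"
        using networkD(4)[OF net, of x] by simp
      then have "total_rate C \<kappa> $ x * u N x - (\<Sum>z\<in>UNIV. C $ x $ z * u N z) \<le> (if x = y then 1 else 0)"
        unfolding step by simp
      from mult_left_mono[OF this u0[of N x]] show ?thesis by (simp split: if_splits)
    qed
    then have "energy C \<kappa> (?u N) \<le> (\<Sum>x\<in>UNIV. if x = y then u N y else 0)"
      unfolding energy_of_real by (intro sum_mono)
    then show ?thesis by simp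
  qed
  have b: "c * (u N x)\<^sup>2 \<le> u N y" for N x
  proof -
    have "u N x = norm ((?u N) $ x)" using u0[of N x] by simp
    also have "\<dots> \<le> norm (?u N)" by (rule Finite_Cartesian_Product.norm_nth_le)
    finally have "c * (u N x)\<^sup>2 \<le> c * (norm (?u N))\<^sup>2"
      using c(1) u0[of N x] by (intro mult_left_mono power_mono) auto
    then show ?thesis using c(2)[of "?u N"] e[of N] by linarith
  qed
  have diag_bound: "u N y \<le> 1 / c" for N
  proof (cases "u N y = 0")
    case False
    then have "u N y > 0" using u0[of N y] by simp
    then show ?thesis using b[of N y] c(1) by (simp add: power2_eq_square field_simps)
  qed (use c in simp)
  have bx: "u N x \<le> 1 / c" for N x
  proof -
    have "c * (u N x)\<^sup>2 \<le> c * (1 / c)\<^sup>2" using b[of N x] diag_bound[of N] c(1)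
      by (simp add: power2_eq_square)
    then have "(u N x)\<^sup>2 \<le> (1 / c)\<^sup>2" using c(1) by simp
    from power2_le_imp_le[OF this] show ?thesis using c(1) by simp
  qed
  show ?thesis
    using bx[of _ x] unfolding u_def
    by (intro summableI_nonneg_bounded[where x = "1 / c"] walk_sum_nonneg net)
qed

lemma green_nonneg: "network C \<kappa> \<Longrightarrow> 0 \<le> green C \<kappa> x y"
  unfolding green_def by (intro suminf_nonneg summable_walk_sum walk_sum_nonneg)

lemma suminf_walk_sum:
  assumes "network C \<kappa>"
  shows "(\<Sum>n. ennreal (walk_sum C \<kappa> n x y)) = ennreal (green C \<kappa> x y)"
  unfolding green_def
  by (rule suminf_ennreal2) (auto intro: walk_sum_nonneg summable_walk_sum assms)

lemma green_equation:
  assumes net: "network C \<kappa>"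
  shows "total_rate C \<kappa> $ x * green C \<kappa> x y - (\<Sum>z\<in>UNIV. C $ x $ z * green C \<kappa> z y) = (if x = y then 1 else 0)"
proof -
  have "green C \<kappa> x y = walk_sum C \<kappa> 0 x y + (\<Sum>n. walk_sum C \<kappa> (Suc n) x y)"
    unfolding green_def using suminf_split_head[OF summable_walk_sum[OF net]] by simp
  also have "(\<Sum>n. walk_sum C \<kappa> (Suc n) x y) = (\<Sum>n. \<Sum>z\<in>UNIV. C $ x $ z * walk_sum C \<kappa> n z y) / total_rate C \<kappa> $ x"
    unfolding walk_sum_Suc
    by (intro suminf_divide summable_sum summable_mult summable_walk_sum net)
  also have "(\<Sum>n. \<Sum>z\<in>UNIV. C $ x $ z * walk_sum C \<kappa> n z y) = (\<Sum>z\<in>UNIV. C $ x $ z * green C \<kappa> z y)"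
    unfolding green_def
    by (simp add: suminf_sum summable_mult summable_walk_sum net suminf_mult)
  finally show ?thesis
    using networkD(4)[OF net, of x] by (cases "x = y") (auto simp: walk_sum_0 field_simps)
qed

text \<open>A right inverse of a symmetric matrix is symmetric.\<close>

lemma green_sym:
  assumes net: "network C \<kappa>"
  shows "green C \<kappa> x y = green C \<kappa> y x"
proof -
  define A where "A = rate_matrix C \<kappa> - C"
  define G where "G = (\<chi> x y. green C \<kappa> x y)"
  have AG: "A ** G = mat 1"
  proof -
    have "(\<Sum>z\<in>UNIV. A $ x $ z * G $ z $ y) = (if x = y then 1 else 0)" for x y
    proof -
    have "(\<Sum>z\<in>UNIV. A $ x $ z * G $ z $ y) =
        (\<Sum>z\<in>UNIV. (if x = z then total_rate C \<kappa> $ x * green C \<kappa> x y else 0) - C $ x $ z * green C \<kappa> z y)"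
      by (intro sum.cong) (auto simp: A_def G_def rate_matrix_def algebra_simps)
    also have "\<dots> = (if x = y then 1 else 0)"
      using green_equation[OF net, of x y] by (simp add: sum_subtractf)
    finally show ?thesis .
    qed
    then show ?thesis by (simp add: vec_eq_iff matrix_matrix_mult_def mat_def)
  qed
  have At: "transpose A = A"
    using networkD(1)[OF net] by (auto simp: A_def transpose_def rate_matrix_def vec_eq_iff)
  have "transpose G = transpose G ** (A ** G)" by (simp add: AG)
  also have "\<dots> = transpose (A ** G) ** G" by (simp add: matrix_mul_assoc matrix_transpose_mul At)
  also have "\<dots> = G" by (simp add: AG)
  finally have "transpose G $ y $ x = G $ y $ x" by simp
  then show ?thesis by (simp add: transpose_def G_def)
qed

text \<open>Over a finite alphabet there are finitely many words of each length, which reduces sums over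
  all walks or cycles to series of finite sums.\<close>

lemma nn_integral_lists_by_length:
  fixes f :: "'x::finite list \<Rightarrow> ennreal"
  assumes "\<And>\<xi>. \<xi> \<in> S \<Longrightarrow> \<xi> \<noteq> []"
  shows "(\<integral>\<^sup>+\<xi>. f \<xi> \<partial>count_space S) = (\<Sum>n. \<Sum>\<xi>\<in>{\<xi>. length \<xi> = Suc n \<and> \<xi> \<in> S}. f \<xi>)"
proof -
  let ?Sn = "\<lambda>n. {\<xi>. length \<xi> = Suc n \<and> \<xi> \<in> S}"
  have "(\<integral>\<^sup>+\<xi>. f \<xi> \<partial>count_space S) = (\<integral>\<^sup>+\<xi>. (\<Sum>n. f \<xi> * indicator (?Sn n) \<xi>) \<partial>count_space S)"
  proof (rule nn_integral_cong)
    fix \<xi> assume "\<xi> \<in> space (count_space S)"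
    then obtain m where m: "\<xi> \<in> S" "length \<xi> = Suc m" using assms by (cases \<xi>) auto
    have "(\<Sum>n. f \<xi> * indicator (?Sn n) \<xi>) = (\<Sum>n. if n = m then f \<xi> else 0)"
      using m by (intro suminf_cong) (auto simp: indicator_def)
    also have "\<dots> = f \<xi>" using suminf_finite[of "{m}" "\<lambda>n. if n = m then f \<xi> else 0"] by simp
    finally show "f \<xi> = (\<Sum>n. f \<xi> * indicator (?Sn n) \<xi>)" by simp
  qed
  also have "\<dots> = (\<Sum>n. \<integral>\<^sup>+\<xi>. f \<xi> * indicator (?Sn n) \<xi> \<partial>count_space S)"
    by (rule nn_integral_suminf) simp
  also have "\<dots> = (\<Sum>n. \<Sum>\<xi>\<in>(?Sn n). f \<xi>)"
  proof (rule suminf_cong)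
    fix n
    have "(\<integral>\<^sup>+\<xi>. f \<xi> * indicator (?Sn n) \<xi> \<partial>count_space S) =
       (\<Sum>\<xi>\<in>(?Sn n). f \<xi> * indicator (?Sn n) \<xi>)"
      by (rule nn_integral_count_space'[OF finite_lists_of_length]) auto
    also have "\<dots> = (\<Sum>\<xi>\<in>(?Sn n). f \<xi>)"
      by (intro sum.cong) auto
    finally show "(\<integral>\<^sup>+\<xi>. f \<xi> * indicator (?Sn n) \<xi> \<partial>count_space S) = \<dots>" .
  qed
  finally show ?thesis .
qed

lemma sets_bridge_measure [simp]: "sets (bridge_measure C \<kappa> x y) = sets path_space"
  and space_bridge_measure [simp]: "space (bridge_measure C \<kappa> x y) = paths"
  by (simp_all add: bridge_measure_def)

text \<open>By \<open>bridge_weight_add\<close> the integral is the total mass of the bridge measure for the killing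
  \<open>\<kappa> + \<theta>\<close>. Integrating out the holding times leaves the sum over walks that defines the
  Green function.\<close>

lemma bridge_measure_exp:
  assumes net: "network C \<kappa>" and \<theta>: "\<theta> \<in> orthant"
  shows "(\<integral>\<^sup>+\<gamma>. ennreal (exp (- (\<theta> \<bullet> occupation \<gamma>))) \<partial>bridge_measure C \<kappa> x y) = ennreal (green C (\<kappa> + \<theta>) x y)"
proof -
  let ?S = "{\<xi>. \<xi> \<noteq> [] \<and> hd \<xi> = x \<and> last \<xi> = y}"
  let ?W = "\<lambda>\<xi>. \<integral>\<^sup>+\<tau>. ennreal (bridge_weight C \<kappa> \<xi> \<tau>) * ennreal (exp (- (\<theta> \<bullet> occupation (timed_path \<xi> \<tau>)))) \<partial>holding_times (length \<xi>)"
  let ?Sn = "\<lambda>n. {\<xi>. length \<xi> = Suc n \<and> \<xi> \<in> ?S}"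
  have net': "network C (\<kappa> + \<theta>)" by (rule network_add[OF net \<theta>])
  have "(\<integral>\<^sup>+\<gamma>. ennreal (exp (- (\<theta> \<bullet> occupation \<gamma>))) \<partial>bridge_measure C \<kappa> x y) =
     (\<integral>\<^sup>+\<xi>. ?W \<xi> \<partial>count_space ?S)"
    unfolding bridge_measure_def
    by (rule nn_integral_path_measure) (auto simp: measurable_bridge_weight)
  also have "\<dots> = (\<integral>\<^sup>+\<xi>. ennreal (walk_weight C (\<kappa> + \<theta>) \<xi>) \<partial>count_space ?S)"
  proof (rule nn_integral_cong)
    fix \<xi> assume "\<xi> \<in> space (count_space ?S)"
    let ?c = "\<Prod>i<length \<xi> - 1. C $ (\<xi> ! i) $ (\<xi> ! Suc i)"
    let ?l = "\<lambda>i. total_rate C (\<kappa> + \<theta>) $ (\<xi> ! i)"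
    have c: "?c \<ge> 0" by (intro prod_nonneg ballI networkD[OF net])
    have [measurable]: "(\<lambda>\<tau>. \<tau> i) \<in> borel_measurable (holding_times (length \<xi>))"
      if "i < length \<xi>" for i
      using that by (rule measurable_holding_times_component)
    have "?W \<xi> =
       (\<integral>\<^sup>+\<tau>. ennreal (bridge_weight C (\<kappa> + \<theta>) \<xi> \<tau>) \<partial>holding_times (length \<xi>))"
      by (simp add: ennreal_mult''[symmetric] bridge_weight_add)
    also have "\<dots> = (\<integral>\<^sup>+\<tau>. ennreal ?c * ennreal (\<Prod>i<length \<xi>. \<tau> i ^ 0 * exp (- ?l i * \<tau> i)) \<partial>holding_times (length \<xi>))"
      by (simp add: bridge_weight_def ennreal_mult''[symmetric] prod_nonneg)
    also have "\<dots> = ennreal ?c * (\<integral>\<^sup>+\<tau>. ennreal (\<Prod>i<length \<xi>. \<tau> i ^ 0 * exp (- ?l i * \<tau> i)) \<partial>holding_times (length \<xi>))"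
      by (rule nn_integral_cmult) measurable
    also have "(\<integral>\<^sup>+\<tau>. ennreal (\<Prod>i<length \<xi>. \<tau> i ^ 0 * exp (- ?l i * \<tau> i)) \<partial>holding_times (length \<xi>)) =
        ennreal (\<Prod>i<length \<xi>. fact 0 / ?l i ^ Suc 0)"
      by (rule nn_integral_holding_times_exp) (rule networkD(4)[OF net'])
    also have "ennreal ?c * \<dots> = ennreal (walk_weight C (\<kappa> + \<theta>) \<xi>)"
      using c by (simp add: walk_weight_def ennreal_mult'[symmetric])
    finally show "?W \<xi> = \<dots>" .
  qed
  also have "\<dots> = (\<Sum>n. \<Sum>\<xi>\<in>(?Sn n). ennreal (walk_weight C (\<kappa> + \<theta>) \<xi>))"
    by (rule nn_integral_lists_by_length) simp
  also have "\<dots> = (\<Sum>n. ennreal (walk_sum C (\<kappa> + \<theta>) n x y))"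
  proof (rule suminf_cong)
    fix n
    have "(?Sn n) = walks n x y" by (auto simp: walks_def)
    then show "(\<Sum>\<xi>\<in>(?Sn n). ennreal (walk_weight C (\<kappa> + \<theta>) \<xi>)) = ennreal (walk_sum C (\<kappa> + \<theta>) n x y)"
      by (simp add: walk_sum_def sum_ennreal walk_weight_nonneg net')
  qed
  also have "\<dots> = ennreal (green C (\<kappa> + \<theta>) x y)" by (rule suminf_walk_sum[OF net'])
  finally show ?thesis .
qed

lemma zero_in_orthant [simp]: "0 \<in> orthant" by (simp add: orthant_def)

lemma emeasure_bridge_measure:
  assumes net: "network C \<kappa>"
  shows "emeasure (bridge_measure C \<kappa> x y) paths = ennreal (green C \<kappa> x y)"
  using bridge_measure_exp[OF net zero_in_orthant, of x y] by simp

lemma finite_bridge_measure: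
  assumes net: "network C \<kappa>"
  shows "finite_measure (bridge_measure C \<kappa> x y)"
  by (rule finite_measureI) (simp add: emeasure_bridge_measure[OF net])

section \<open>The loop measure\<close>

text \<open>The weight of a based loop with the holding times integrated out and without the factor
  \<open>1 / p\<close>; indices are cyclic.\<close>

definition cycle_weight :: "real^'x^'x \<Rightarrow> real^'x \<Rightarrow> 'x::finite list \<Rightarrow> real" where
  "cycle_weight C \<kappa> \<xi> = (\<Prod>i<length \<xi>. C $ (\<xi> ! i) $ (\<xi> ! (Suc i mod length \<xi>)) / total_rate C \<kappa> $ (\<xi> ! i))"

lemma bij_betw_add_mod:
  fixes j p :: nat
  assumes "j < p"
  shows "bij_betw (\<lambda>i. (i + j) mod p) {..<p} {..<p}"
proof (rule bij_betw_byWitness[where f' = "\<lambda>i. (i + (p - j)) mod p"])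
  have "((i + a) mod p + b) mod p = i" if "i < p" "a + b = p" for i a b
  proof -
    have "((i + a) mod p + b) mod p = (i + (a + b)) mod p" by (simp only: mod_add_left_eq add.assoc)
    then show ?thesis using that by simp
  qed
  note inv = this
  show "\<forall>i\<in>{..<p}. ((i + j) mod p + (p - j)) mod p = i"
    "\<forall>i\<in>{..<p}. ((i + (p - j)) mod p + j) mod p = i"
    by (intro ballI inv; use assms in simp)+
qed (use assms in auto)

lemma cycle_weight_rotate:
  assumes "j < length \<xi>"
  shows "cycle_weight C \<kappa> (rotate j \<xi>) = cycle_weight C \<kappa> \<xi>"
proof -
  define p where "p = length \<xi>"
  define h where "h i = C $ (\<xi> ! i) $ (\<xi> ! (Suc i mod p)) / total_rate C \<kappa> $ (\<xi> ! i)" for i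
  have p: "0 < p" "j < p" using assms by (auto simp: p_def)
  have "cycle_weight C \<kappa> (rotate j \<xi>) = (\<Prod>i<p. h ((i + j) mod p))"
    unfolding cycle_weight_def length_rotate p_def[symmetric]
  proof (intro prod.cong refl)
    fix i assume "i \<in> {..<p}"
    then have i: "i < p" by simp
    have "rotate j \<xi> ! i = \<xi> ! ((i + j) mod p)" "rotate j \<xi> ! (Suc i mod p) = \<xi> ! (Suc ((i + j) mod p) mod p)"
      using i p by (simp_all add: nth_rotate p_def add.commute mod_simps)
    then show "C $ (rotate j \<xi> ! i) $ (rotate j \<xi> ! (Suc i mod p)) / total_rate C \<kappa> $ (rotate j \<xi> ! i) = h ((i + j) mod p)"
      by (simp add: h_def)
  qed
  also have "\<dots> = (\<Prod>i<p. h i)" by (rule prod.reindex_bij_betw[OF bij_betw_add_mod[OF p(2)]])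
  finally show ?thesis by (simp add: cycle_weight_def h_def p_def)
qed

text \<open>Rotation permutes the words of length \<open>p\<close> and preserves the cyclic weight, so each position
  \<open>j\<close> contributes the same amount.\<close>

lemma sum_cycle_weight_shift:
  fixes x :: "'x::finite"
  assumes "j < p"
  shows "(\<Sum>\<xi>\<in>{\<xi>. length \<xi> = p}. if \<xi> ! j = x then cycle_weight C \<kappa> \<xi> else 0) =
    (\<Sum>\<xi>\<in>{\<xi>. length \<xi> = p}. if \<xi> ! 0 = x then cycle_weight C \<kappa> \<xi> else 0)"
proof -
  let ?S = "{\<xi> :: 'x list. length \<xi> = p}"
  have b: "bij_betw (rotate j) ?S ?S"
    by (rule bij_betw_byWitness[where f' = "rotate (p - j)"]) (use assms in \<open>auto simp: rotate_rotate\<close>)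
  have "(\<Sum>\<xi>\<in>?S. if \<xi> ! 0 = x then cycle_weight C \<kappa> \<xi> else 0) =
      (\<Sum>\<xi>\<in>?S. if rotate j \<xi> ! 0 = x then cycle_weight C \<kappa> (rotate j \<xi>) else 0)"
    by (rule sum.reindex_bij_betw[OF b, symmetric])
  also have "\<dots> = (\<Sum>\<xi>\<in>?S. if \<xi> ! j = x then cycle_weight C \<kappa> \<xi> else 0)"
    using assms by (intro sum.cong refl) (auto simp: nth_rotate cycle_weight_rotate)
  finally show ?thesis by simp
qed

text \<open>Closing a cycle based at \<open>x\<close> by repeating its base point gives a walk from \<open>x\<close> to \<open>x\<close> of
  \<open>p\<close> steps.\<close>

lemma sum_cycle_weight:
  fixes x :: "'x::finite"
  assumes "0 < p"
  shows "(\<Sum>\<xi>\<in>{\<xi>. length \<xi> = p}. if \<xi> ! 0 = x then cycle_weight C \<kappa> \<xi> / total_rate C \<kappa> $ x else 0) =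
    walk_sum C \<kappa> p x x"
proof -
  let ?S = "{\<xi> :: 'x list. length \<xi> = p \<and> \<xi> ! 0 = x}"
  have W: "walks p x x = (\<lambda>\<xi>. \<xi> @ [x]) ` ?S"
  proof (intro equalityI subsetI)
    fix \<xi> assume \<xi>: "\<xi> \<in> walks p x x"
    then have "\<xi> \<noteq> []" by (auto simp: walks_def)
    then have e: "\<xi> = butlast \<xi> @ [x]" using \<xi> append_butlast_last_id[of \<xi>] by (auto simp: walks_def)
    have "butlast \<xi> ! 0 = \<xi> ! 0" using \<xi> assms by (intro nth_butlast) (auto simp: walks_def)
    then have "butlast \<xi> \<in> ?S" using \<xi> \<open>\<xi> \<noteq> []\<close> by (auto simp: walks_def hd_conv_nth)
    then show "\<xi> \<in> (\<lambda>\<xi>. \<xi> @ [x]) ` ?S" using e by blast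
  next
    fix \<xi> assume "\<xi> \<in> (\<lambda>\<xi>. \<xi> @ [x]) ` ?S"
    then obtain \<eta> where e: "length \<eta> = p" "\<eta> ! 0 = x" "\<xi> = \<eta> @ [x]" by auto
    then have "\<eta> \<noteq> []" using assms by auto
    then show "\<xi> \<in> walks p x x" using e by (auto simp: walks_def hd_append hd_conv_nth)
  qed
  have "walk_sum C \<kappa> p x x = (\<Sum>\<xi>\<in>?S. walk_weight C \<kappa> (\<xi> @ [x]))"
    unfolding walk_sum_def W by (subst sum.reindex) (auto simp: inj_on_def)
  also have "\<dots> = (\<Sum>\<xi>\<in>?S. cycle_weight C \<kappa> \<xi> / total_rate C \<kappa> $ x)"
  proof (intro sum.cong refl)
    fix \<xi> :: "'x list" assume "\<xi> \<in> ?S"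
    then have \<xi>: "length \<xi> = p" "\<xi> ! 0 = x" by auto
    have "(\<Prod>i<p. C $ ((\<xi> @ [x]) ! i) $ ((\<xi> @ [x]) ! Suc i)) = (\<Prod>i<p. C $ (\<xi> ! i) $ (\<xi> ! (Suc i mod p)))"
    proof (intro prod.cong refl)
      fix i assume "i \<in> {..<p}"
      then have i: "i < p" by simp
      have "(\<xi> @ [x]) ! Suc i = \<xi> ! (Suc i mod p)"
        using i \<xi> by (cases "Suc i = p") (auto simp: nth_append)
      then show "C $ ((\<xi> @ [x]) ! i) $ ((\<xi> @ [x]) ! Suc i) = C $ (\<xi> ! i) $ (\<xi> ! (Suc i mod p))"
        using i \<xi> by (simp add: nth_append)
    qed
    moreover have "(\<Prod>i<p. 1 / total_rate C \<kappa> $ ((\<xi> @ [x]) ! i)) = (\<Prod>i<p. 1 / total_rate C \<kappa> $ (\<xi> ! i))"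
      using \<xi> by (intro prod.cong) (auto simp: nth_append)
    moreover have "(\<xi> @ [x]) ! p = x" using \<xi> by (simp add: nth_append)
    ultimately show "walk_weight C \<kappa> (\<xi> @ [x]) = cycle_weight C \<kappa> \<xi> / total_rate C \<kappa> $ x"
      using \<xi> by (simp add: walk_weight_def cycle_weight_def prod_dividef)
  qed
  also have "\<dots> = (\<Sum>\<xi>\<in>{\<xi>. length \<xi> = p}. if \<xi> ! 0 = x then cycle_weight C \<kappa> \<xi> / total_rate C \<kappa> $ x else 0)"
    by (rule sum.mono_neutral_cong_left) (auto intro: finite_lists_of_length[where P = "\<lambda>_. True", simplified])
  finally show ?thesis by simp
qed

text \<open>Integrating one of the holding times against its exponential density produces the extra factor
  \<open>1 / \<lambda>\<close> of the vertex where it is spent. The case of trivial loops differs, as their weight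
  has the density \<open>1 / \<tau>\<close>.\<close>

lemma based_loop_term:
  assumes net: "network C \<kappa>" and \<xi>: "2 \<le> length \<xi>"
  shows "(\<integral>\<^sup>+\<tau>. ennreal (based_loop_weight C \<kappa> \<xi> \<tau>) * ennreal (occupation (timed_path \<xi> \<tau>) $ x) \<partial>holding_times (length \<xi>)) =
    ennreal (1 / real (length \<xi>) * (\<Sum>j<length \<xi>. if \<xi> ! j = x then cycle_weight C \<kappa> \<xi> / total_rate C \<kappa> $ x else 0))"
proof -
  define p where "p = length \<xi>"
  define c where "c = 1 / real p * (\<Prod>i<p. C $ (\<xi> ! i) $ (\<xi> ! (Suc i mod p)))"
  let ?l = "\<lambda>i. total_rate C \<kappa> $ (\<xi> ! i)"
  let ?g = "\<lambda>j \<tau>. \<Prod>i<p. \<tau> i ^ (if i = j then 1 else 0) * exp (- ?l i * \<tau> i)"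
  let ?d = "\<lambda>j. if \<xi> ! j = x then c else 0"
  let ?w = "\<lambda>j. if \<xi> ! j = x then cycle_weight C \<kappa> \<xi> / total_rate C \<kappa> $ x else 0"
  have c0: "0 \<le> c" unfolding c_def by (intro mult_nonneg_nonneg prod_nonneg ballI networkD[OF net]) auto
  have [measurable]: "(\<lambda>\<tau>. \<tau> i) \<in> borel_measurable (holding_times p)" if "i < p" for i
    using that by (rule measurable_holding_times_component)
  have pos: "0 \<le> \<tau> i" if "\<tau> \<in> space (holding_times p)" "i < p" for \<tau> i
    using that by (auto simp: holding_times_def space_PiM space_restrict_space PiE_iff intro: less_imp_le)
  have g: "?g j \<tau> = \<tau> j * (\<Prod>i<p. exp (- ?l i * \<tau> i))" if "j < p" for j and \<tau> :: "nat \<Rightarrow> real"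
  proof -
    have "(\<Prod>i<p. \<tau> i ^ (if i = j then 1 else 0)) = (\<Prod>i<p. if i = j then \<tau> i else 1)"
      by (intro prod.cong) auto
    then show ?thesis using that by (simp add: prod.distrib)
  qed
  have g0: "0 \<le> ?g j \<tau>" if "\<tau> \<in> space (holding_times p)" for j \<tau>
    by (intro prod_nonneg ballI mult_nonneg_nonneg zero_le_power pos[OF that]) auto
  have "(\<integral>\<^sup>+\<tau>. ennreal (based_loop_weight C \<kappa> \<xi> \<tau>) * ennreal (occupation (timed_path \<xi> \<tau>) $ x) \<partial>holding_times p) =
    (\<integral>\<^sup>+\<tau>. (\<Sum>j<p. ennreal (?d j) * ennreal (?g j \<tau>)) \<partial>holding_times p)"
  proof (rule nn_integral_cong)
    fix \<tau> assume \<tau>: "\<tau> \<in> space (holding_times p)"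
    have w: "based_loop_weight C \<kappa> \<xi> \<tau> = c * (\<Prod>i<p. exp (- ?l i * \<tau> i))"
      using \<xi> by (simp add: based_loop_weight_def Let_def c_def prod.distrib p_def)
    have o: "0 \<le> occupation (timed_path \<xi> \<tau>) $ x"
      unfolding occupation_timed_path p_def[symmetric] using pos[OF \<tau>] by (intro sum_nonneg) auto
    have "ennreal (based_loop_weight C \<kappa> \<xi> \<tau>) * ennreal (occupation (timed_path \<xi> \<tau>) $ x) =
        ennreal (c * (\<Prod>i<p. exp (- ?l i * \<tau> i)) * (\<Sum>j<p. if \<xi> ! j = x then \<tau> j else 0))"
      using o by (simp add: ennreal_mult''[symmetric] w occupation_timed_path p_def)
    also have "c * (\<Prod>i<p. exp (- ?l i * \<tau> i)) * (\<Sum>j<p. if \<xi> ! j = x then \<tau> j else 0) =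
        (\<Sum>j<p. (?d j) * ?g j \<tau>)"
      unfolding sum_distrib_left by (intro sum.cong refl) (simp only: g lessThan_iff, simp)
    also have "ennreal \<dots> = (\<Sum>j<p. ennreal ((?d j) * ?g j \<tau>))"
      using c0 g0[OF \<tau>] by (intro sum_ennreal[symmetric] mult_nonneg_nonneg) auto
    also have "\<dots> = (\<Sum>j<p. ennreal (?d j) * ennreal (?g j \<tau>))"
      using c0 by (intro sum.cong refl ennreal_mult' ) auto
    finally show "ennreal (based_loop_weight C \<kappa> \<xi> \<tau>) * ennreal (occupation (timed_path \<xi> \<tau>) $ x) = \<dots>" .
  qed
  also have "\<dots> = (\<Sum>j<p. \<integral>\<^sup>+\<tau>. ennreal (?d j) * ennreal (?g j \<tau>) \<partial>holding_times p)"
    by (intro nn_integral_sum) measurable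
  also have "\<dots> = (\<Sum>j<p. ennreal (?d j) * (\<integral>\<^sup>+\<tau>. ennreal (?g j \<tau>) \<partial>holding_times p))"
    by (intro sum.cong refl nn_integral_cmult) measurable
  also have "\<dots> = (\<Sum>j<p. ennreal (1 / real p * ?w j))"
  proof (intro sum.cong refl)
    fix j assume "j \<in> {..<p}"
    then have j: "j < p" by simp
    have "(\<integral>\<^sup>+\<tau>. ennreal (?g j \<tau>) \<partial>holding_times p) = ennreal (\<Prod>i<p. fact (if i = j then 1 else 0) / ?l i ^ Suc (if i = j then 1 else 0))"
      by (rule nn_integral_holding_times_exp) (rule networkD(4)[OF net])
    also have "(\<Prod>i<p. fact (if i = j then 1 else 0) / ?l i ^ Suc (if i = j then 1 else 0)) = (\<Prod>i<p. 1 / ?l i * (if i = j then 1 / ?l i else 1))"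
      by (intro prod.cong) auto
    also have "\<dots> = (\<Prod>i<p. 1 / ?l i) / ?l j"
      unfolding prod.distrib using j by simp
    finally show "ennreal (?d j) * (\<integral>\<^sup>+\<tau>. ennreal (?g j \<tau>) \<partial>holding_times p) =
      ennreal (1 / real p * ?w j)"
      using c0 by (auto simp: ennreal_mult'[symmetric] c_def cycle_weight_def prod_dividef p_def mult_ac)
  qed
  also have "\<dots> = ennreal (\<Sum>j<p. 1 / real p * ?w j)"
    by (rule sum_ennreal)
       (auto simp: cycle_weight_def intro!: divide_nonneg_nonneg mult_nonneg_nonneg prod_nonneg networkD less_imp_le[OF networkD(4)] net)
  finally show ?thesis by (simp add: p_def sum_distrib_left)
qed

text \<open>A loop of length \<open>p\<close> carries the weight \<open>1 / p\<close> and contributes one term for each of its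
  \<open>p\<close> positions, and by rotation all positions contribute equally. What remains is the sum over
  closed walks from \<open>x\<close> to \<open>x\<close>. The trivial loops supply the walk without steps; for them the
  density \<open>1 / \<tau>\<close> cancels against the occupation time.\<close>

lemma based_loop_occupation:
  fixes x :: "'x::finite"
  assumes net: "network C \<kappa>"
  shows "(\<integral>\<^sup>+\<gamma>. ennreal (occupation \<gamma> $ x) \<partial>based_loop_measure C \<kappa>) = ennreal (green C \<kappa> x x)"
proof -
  let ?c = "\<lambda>\<xi>. cycle_weight C \<kappa> \<xi> / total_rate C \<kappa> $ x"
  define f where "f \<xi> = (\<integral>\<^sup>+\<tau>. ennreal (based_loop_weight C \<kappa> \<xi> \<tau>) * ennreal (occupation (timed_path \<xi> \<tau>) $ x) \<partial>holding_times (length \<xi>))" for \<xi>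
  have "(\<integral>\<^sup>+\<gamma>. ennreal (occupation \<gamma> $ x) \<partial>based_loop_measure C \<kappa>) = (\<integral>\<^sup>+\<xi>. f \<xi> \<partial>count_space {\<xi>. \<xi> \<noteq> []})"
    unfolding based_loop_measure_def f_def
    by (rule nn_integral_path_measure) (auto simp: measurable_based_loop_weight)
  also have "\<dots> = (\<Sum>n. \<Sum>\<xi>\<in>{\<xi>. length \<xi> = Suc n \<and> \<xi> \<in> {\<xi>. \<xi> \<noteq> []}}. f \<xi>)"
    by (rule nn_integral_lists_by_length) simp
  also have "\<dots> = (\<Sum>n. \<Sum>\<xi>\<in>{\<xi>. length \<xi> = Suc n}. f \<xi>)"
    by (intro suminf_cong sum.cong) auto
  also have "\<dots> = (\<Sum>\<xi>\<in>{\<xi>. length \<xi> = Suc 0}. f \<xi>) + (\<Sum>n. \<Sum>\<xi>\<in>{\<xi>. length \<xi> = Suc (Suc n)}. f \<xi>)"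
    by (subst suminf_offset[of _ 1]) auto
  also have "(\<Sum>\<xi>\<in>{\<xi>. length \<xi> = Suc 0}. f \<xi>) = ennreal (walk_sum C \<kappa> 0 x x)"
  proof -
    have fx: "f [a] = (if a = x then ennreal (1 / total_rate C \<kappa> $ x) else 0)" for a
    proof (cases "a = x")
      case True
      have length_1: "length [x] = 1" by simp
      have "f [x] = (\<integral>\<^sup>+\<tau>. ennreal (\<Prod>i<1. \<tau> i ^ 0 * exp (- total_rate C \<kappa> $ x * \<tau> i)) \<partial>holding_times 1)"
        unfolding f_def length_1
      proof (rule nn_integral_cong)
        fix \<tau> assume "\<tau> \<in> space (holding_times 1)"
        then have "0 < \<tau> 0" by (auto simp: holding_times_def space_PiM space_restrict_space PiE_iff)
        then show "ennreal (based_loop_weight C \<kappa> [x] \<tau>) * ennreal (occupation (timed_path [x] \<tau>) $ x) =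
          ennreal (\<Prod>i<1. \<tau> i ^ 0 * exp (- total_rate C \<kappa> $ x * \<tau> i))"
          by (simp add: based_loop_weight_def occupation_timed_path ennreal_mult''[symmetric])
      qed
      also have "\<dots> = ennreal (\<Prod>i<1::nat. fact 0 / total_rate C \<kappa> $ x ^ Suc 0)"
        by (rule nn_integral_holding_times_exp) (rule networkD(4)[OF net])
      finally show ?thesis using True by simp
    next
      case False
      then show ?thesis by (simp add: f_def occupation_timed_path)
    qed
    have "{\<xi> :: 'x list. length \<xi> = Suc 0} = range (\<lambda>a. [a])" by (auto simp: length_Suc_conv)
    then have "(\<Sum>\<xi>\<in>{\<xi>. length \<xi> = Suc 0}. f \<xi>) = (\<Sum>a\<in>UNIV. f [a])"
      by (simp add: sum.reindex inj_on_def)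
    then show ?thesis by (simp add: fx walk_sum_0)
  qed
  also have "(\<Sum>n. \<Sum>\<xi>\<in>{\<xi>. length \<xi> = Suc (Suc n)}. f \<xi>) = (\<Sum>n. ennreal (walk_sum C \<kappa> (Suc (Suc n)) x x))"
  proof (rule suminf_cong)
    fix n
    define p where "p = Suc (Suc n)"
    have cw: "0 \<le> ?c \<xi>" for \<xi>
      by (auto simp: cycle_weight_def intro!: divide_nonneg_nonneg prod_nonneg networkD less_imp_le[OF networkD(4)] net)
    have "(\<Sum>\<xi>\<in>{\<xi>. length \<xi> = p}. f \<xi>) = (\<Sum>\<xi>\<in>{\<xi>. length \<xi> = p}.
        ennreal (1 / real p * (\<Sum>j<p. if \<xi> ! j = x then ?c \<xi> else 0)))"
    proof (intro sum.cong refl)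
      fix \<xi> :: "'x list" assume "\<xi> \<in> {\<xi>. length \<xi> = p}"
      then have "2 \<le> length \<xi>" "length \<xi> = p" by (auto simp: p_def)
      with based_loop_term[OF net this(1), of x]
      show "f \<xi> = ennreal (1 / real p * (\<Sum>j<p. if \<xi> ! j = x then ?c \<xi> else 0))"
        by (simp only: f_def)
    qed
    also have "\<dots> = ennreal (\<Sum>\<xi>\<in>{\<xi>. length \<xi> = p}.
        1 / real p * (\<Sum>j<p. if \<xi> ! j = x then ?c \<xi> else 0))"
      by (rule sum_ennreal) (intro mult_nonneg_nonneg sum_nonneg, auto simp: cw)
    also have "(\<Sum>\<xi>\<in>{\<xi>. length \<xi> = p}. 1 / real p * (\<Sum>j<p. if \<xi> ! j = x then ?c \<xi> else 0)) =
        1 / real p * (\<Sum>j<p. \<Sum>\<xi>\<in>{\<xi>. length \<xi> = p}. if \<xi> ! j = x then ?c \<xi> else 0)"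
      by (subst sum.swap) (rule sum_distrib_left[symmetric])
    also have "(\<Sum>j<p. \<Sum>\<xi>\<in>{\<xi>. length \<xi> = p}. if \<xi> ! j = x then ?c \<xi> else 0) =
        (\<Sum>j<p. walk_sum C \<kappa> p x x)"
    proof (intro sum.cong refl)
      fix j assume j: "j \<in> {..<p}"
      have d: "(\<Sum>\<xi>\<in>{\<xi>. length \<xi> = p}. if \<xi> ! i = x then ?c \<xi> else 0) =
         (\<Sum>\<xi>\<in>{\<xi>. length \<xi> = p}. if \<xi> ! i = x then cycle_weight C \<kappa> \<xi> else 0) / total_rate C \<kappa> $ x" for i
        unfolding sum_divide_distrib by (intro sum.cong) auto
      show "(\<Sum>\<xi>\<in>{\<xi>. length \<xi> = p}. if \<xi> ! j = x then ?c \<xi> else 0) = walk_sum C \<kappa> p x x"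
        using j trans[OF d[of 0, symmetric] sum_cycle_weight[where p = p and C = C and \<kappa> = \<kappa> and x = x]]
        unfolding d using sum_cycle_weight_shift[of j p x C \<kappa>] by (simp add: p_def)
    qed
    also have "1 / real p * (\<Sum>j<p. walk_sum C \<kappa> p x x) = walk_sum C \<kappa> p x x" by (simp add: p_def)
    finally show "(\<Sum>\<xi>\<in>{\<xi>. length \<xi> = Suc (Suc n)}. f \<xi>) = ennreal (walk_sum C \<kappa> (Suc (Suc n)) x x)"
      by (simp add: p_def)
  qed
  also have "ennreal (walk_sum C \<kappa> 0 x x) + (\<Sum>n. ennreal (walk_sum C \<kappa> (Suc (Suc n)) x x)) = (\<Sum>n. ennreal (walk_sum C \<kappa> n x x))"
  proof -
    \<comment> \<open>Loops of length \<open>p \<ge> 2\<close> match closed walks of \<open>p\<close> steps, and trivial loops the walk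
      without steps. The walk of one step has no counterpart, but its weight vanishes with the
      diagonal of \<open>C\<close>.\<close>
    have "walk_sum C \<kappa> (Suc 0) x x = 0"
      by (simp add: walk_sum_Suc walk_sum_0 networkD(3)[OF net] if_distrib[of "\<lambda>u. _ * u"] cong: if_cong)
    then show ?thesis
      by (subst suminf_offset[of "\<lambda>n. ennreal (walk_sum C \<kappa> n x x)" 2]) (auto simp: numeral_2_eq_2)
  qed
  also have "\<dots> = ennreal (green C \<kappa> x x)" by (rule suminf_walk_sum[OF net])
  finally show ?thesis .
qed

lemma sets_based_loop_measure [simp]: "sets (based_loop_measure C \<kappa>) = sets path_space"
  and space_based_loop_measure [simp]: "space (based_loop_measure C \<kappa>) = paths"
  by (simp_all add: based_loop_measure_def)

lemma based_loop_measure_add: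
  assumes f: "f \<in> borel_measurable path_space"
  shows "(\<integral>\<^sup>+\<gamma>. ennreal (exp (- (\<theta> \<bullet> occupation \<gamma>))) * f \<gamma> \<partial>based_loop_measure C \<kappa>) = (\<integral>\<^sup>+\<gamma>. f \<gamma> \<partial>based_loop_measure C (\<kappa> + \<theta>))"
proof -
  have [measurable]: "f \<in> borel_measurable path_space" by fact
  have "(\<integral>\<^sup>+\<gamma>. ennreal (exp (- (\<theta> \<bullet> occupation \<gamma>))) * f \<gamma> \<partial>based_loop_measure C \<kappa>) =
    (\<integral>\<^sup>+\<xi>. (\<integral>\<^sup>+\<tau>. ennreal (based_loop_weight C \<kappa> \<xi> \<tau>) * (ennreal (exp (- (\<theta> \<bullet> occupation (timed_path \<xi> \<tau>)))) * f (timed_path \<xi> \<tau>))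
      \<partial>holding_times (length \<xi>)) \<partial>count_space {\<xi>. \<xi> \<noteq> []})"
    unfolding based_loop_measure_def
    by (rule nn_integral_path_measure) (auto simp: measurable_based_loop_weight)
  also have "\<dots> = (\<integral>\<^sup>+\<xi>. (\<integral>\<^sup>+\<tau>. ennreal (based_loop_weight C (\<kappa> + \<theta>) \<xi> \<tau>) * f (timed_path \<xi> \<tau>)
      \<partial>holding_times (length \<xi>)) \<partial>count_space {\<xi>. \<xi> \<noteq> []})"
    by (intro nn_integral_cong)
       (auto simp: ennreal_mult''[symmetric] based_loop_weight_add mult.assoc[symmetric])
  also have "\<dots> = (\<integral>\<^sup>+\<gamma>. f \<gamma> \<partial>based_loop_measure C (\<kappa> + \<theta>))"
    unfolding based_loop_measure_def
    by (rule nn_integral_path_measure[symmetric]) (auto simp: measurable_based_loop_weight)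
  finally show ?thesis .
qed

section \<open>The Gaussian integral\<close>

definition gauss :: "real^'x^'x \<Rightarrow> real^'x \<Rightarrow> complex^'x::finite \<Rightarrow> real" where
  "gauss C \<kappa> z = exp (- energy C \<kappa> z / 2)"

definition partition_function :: "real^'x^'x \<Rightarrow> real^'x::finite \<Rightarrow> real" where
  "partition_function C \<kappa> = (\<integral>z. gauss C \<kappa> z \<partial>lborel)"

lemma continuous_on_energy: "continuous_on S (energy C \<kappa>)"
  unfolding energy_def[abs_def] by (intro continuous_intros)

lemma measurable_gauss [measurable]: "gauss C \<kappa> \<in> borel_measurable borel"
  unfolding gauss_def[abs_def]
  by (intro borel_measurable_continuous_onI continuous_intros continuous_on_energy) simp

lemma measurable_half_square [measurable]: "half_square \<in> borel_measurable borel"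
  unfolding half_square_def[abs_def]
  by (intro borel_measurable_continuous_onI continuous_intros) simp

lemma gauss_pos: "0 < gauss C \<kappa> z" by (simp add: gauss_def)

lemma gauss_add: "gauss C (\<kappa> + \<theta>) z = exp (- (\<theta> \<bullet> half_square z)) * gauss C \<kappa> z"
proof -
  have "(\<Sum>x\<in>UNIV. \<theta> $ x * (norm (z $ x))\<^sup>2) = 2 * (\<theta> \<bullet> half_square z)"
    by (simp add: inner_vec_def half_square_def sum_distrib_left)
  then show ?thesis by (simp add: gauss_def energy_add add_divide_distrib flip: exp_add)
qed

lemma inner_orthant_nonneg: "\<theta> \<in> orthant \<Longrightarrow> u \<in> orthant \<Longrightarrow> 0 \<le> \<theta> \<bullet> u"
  by (auto simp: orthant_def inner_vec_def intro!: sum_nonneg)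

lemma half_square_orthant: "half_square z \<in> orthant"
  by (simp add: half_square_def orthant_def)

lemma integrable_gauss_add:
  assumes "integrable lborel (gauss C \<kappa>)" "\<theta> \<in> orthant"
  shows "integrable lborel (gauss C (\<kappa> + \<theta>))"
proof (rule Bochner_Integration.integrable_bound[OF assms(1)])
  show "AE z in lborel. norm (gauss C (\<kappa> + \<theta>) z) \<le> norm (gauss C \<kappa> z)"
    using inner_orthant_nonneg[OF assms(2) half_square_orthant] gauss_pos[of C \<kappa>]
    by (auto simp: gauss_add mult_le_cancel_right1 abs_mult less_imp_le)
qed simp

text \<open>The operator \<open>rate_matrix C \<kappa> - C\<close> acting on complex vectors; the energy is its quadratic
  form (\<open>energy_eq_cdot\<close>).\<close>

definition generator :: "real^'x^'x \<Rightarrow> real^'x \<Rightarrow> complex^'x \<Rightarrow> complex^'x::finite" where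
  "generator C \<kappa> z = (\<chi> x. of_real (total_rate C \<kappa> $ x) * z $ x - (\<Sum>y\<in>UNIV. of_real (C $ x $ y) * z $ y))"

definition cdot :: "complex^'x \<Rightarrow> complex^'x::finite \<Rightarrow> complex" where
  "cdot u v = (\<Sum>x\<in>UNIV. u $ x * cnj (v $ x))"

lemma cdot_add: "cdot (u + u') v = cdot u v + cdot u' v" "cdot v (u + u') = cdot v u + cdot v u'"
  by (simp_all add: cdot_def algebra_simps sum.distrib)

lemma cdot_scale: "cdot (r *\<^sub>R u) v = of_real r * cdot u v" "cdot u (r *\<^sub>R v) = of_real r * cdot u v"
  unfolding cdot_def vector_scaleR_component
  by (simp_all add: scaleR_conv_of_real sum_distrib_left mult_ac)

lemma cdot_cnj: "cnj (cdot u v) = cdot v u"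
  by (simp add: cdot_def mult.commute)

lemma generator_add: "generator C \<kappa> (u + v) = generator C \<kappa> u + generator C \<kappa> v"
  by (simp add: generator_def vec_eq_iff algebra_simps sum.distrib)

lemma generator_scale: "generator C \<kappa> (r *\<^sub>R u) = r *\<^sub>R generator C \<kappa> u"
  unfolding generator_def vec_eq_iff vector_scaleR_component
  by (simp add: vector_scaleR_component scaleR_conv_of_real algebra_simps sum_distrib_left)

lemma generator_hermitian:
  assumes "network C \<kappa>"
  shows "cdot (generator C \<kappa> u) v = cdot u (generator C \<kappa> v)"
proof -
  have "(\<Sum>x\<in>UNIV. (\<Sum>y\<in>UNIV. of_real (C $ x $ y) * u $ y) * cnj (v $ x)) =
      (\<Sum>x\<in>UNIV. \<Sum>y\<in>UNIV. of_real (C $ x $ y) * u $ y * cnj (v $ x))"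
    by (simp add: sum_distrib_right)
  also have "\<dots> = (\<Sum>y\<in>UNIV. \<Sum>x\<in>UNIV. of_real (C $ x $ y) * u $ y * cnj (v $ x))"
    by (rule sum.swap)
  also have "\<dots> = (\<Sum>y\<in>UNIV. u $ y * cnj (\<Sum>x\<in>UNIV. of_real (C $ y $ x) * v $ x))"
  proof (intro sum.cong refl)
    fix y
    show "(\<Sum>x\<in>UNIV. of_real (C $ x $ y) * u $ y * cnj (v $ x)) = u $ y * cnj (\<Sum>x\<in>UNIV. of_real (C $ y $ x) * v $ x)"
      by (simp add: sum_distrib_left mult_ac networkD(1)[OF assms, of _ y])
  qed
  finally show ?thesis
    by (simp add: cdot_def generator_def left_diff_distrib right_diff_distrib sum_subtractf mult_ac)
qed

lemma energy_eq_cdot: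
  assumes "network C \<kappa>"
  shows "energy C \<kappa> z = Re (cdot z (generator C \<kappa> z))"
proof -
  have "cdot z (generator C \<kappa> z) = (\<Sum>x\<in>UNIV. of_real (total_rate C \<kappa> $ x * (norm (z $ x))\<^sup>2))
     - (\<Sum>x\<in>UNIV. \<Sum>y\<in>UNIV. of_real (C $ x $ y) * z $ x * cnj (z $ y))"
    by (simp add: cdot_def generator_def right_diff_distrib sum_subtractf sum_distrib_left mult_ac
        complex_norm_square del: of_real_power)
  then show ?thesis by (simp add: energy_def)
qed

definition potential :: "real^'x^'x \<Rightarrow> real^'x \<Rightarrow> complex^'x \<Rightarrow> complex^'x::finite" where
  "potential C \<kappa> k = (\<chi> x. \<Sum>y\<in>UNIV. of_real (green C \<kappa> x y) * k $ y)"

lemma generator_potential: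
  assumes net: "network C \<kappa>"
  shows "generator C \<kappa> (potential C \<kappa> k) = k"
proof -
  have "generator C \<kappa> (potential C \<kappa> k) $ x = k $ x" for x
  proof -
    have "(\<Sum>y\<in>UNIV. of_real (C $ x $ y) * (\<Sum>z\<in>UNIV. of_real (green C \<kappa> y z) * k $ z)) =
       (\<Sum>z\<in>UNIV. \<Sum>y\<in>UNIV. of_real (C $ x $ y) * (of_real (green C \<kappa> y z) * k $ z))"
      unfolding sum_distrib_left by (rule sum.swap)
    then have "generator C \<kappa> (potential C \<kappa> k) $ x =
       (\<Sum>z\<in>UNIV. of_real (total_rate C \<kappa> $ x) * (of_real (green C \<kappa> x z) * k $ z) - (\<Sum>y\<in>UNIV. of_real (C $ x $ y) * (of_real (green C \<kappa> y z) * k $ z)))"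
      by (simp add: generator_def potential_def sum_distrib_left sum_subtractf)
    also have "\<dots> = (\<Sum>z\<in>UNIV. of_real (total_rate C \<kappa> $ x * green C \<kappa> x z - (\<Sum>y\<in>UNIV. C $ x $ y * green C \<kappa> y z)) * k $ z)"
      by (intro sum.cong refl) (simp add: left_diff_distrib sum_distrib_right mult.assoc)
    also have "\<dots> = (\<Sum>z\<in>UNIV. if x = z then k $ z else 0)"
      unfolding green_equation[OF net] by (intro sum.cong) auto
    finally show ?thesis by simp
  qed
  then show ?thesis by (simp add: vec_eq_iff)
qed

text \<open>The quadratic form of the Green function, which is the variance of the real part of
  \<open>cdot \<phi> k\<close>.\<close>

definition green_form :: "real^'x^'x \<Rightarrow> real^'x \<Rightarrow> complex^'x::finite \<Rightarrow> real" where
  "green_form C \<kappa> k = Re (cdot (potential C \<kappa> k) k)"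

text \<open>Because \<open>potential C \<kappa> k\<close> solves the equation of \<open>generator_potential\<close>, the cross term of
  the translated energy is the linear functional given by \<open>k\<close>: this is the completion of the
  square.\<close>

lemma energy_translate:
  assumes net: "network C \<kappa>"
  shows "energy C \<kappa> (z + t *\<^sub>R potential C \<kappa> k) = energy C \<kappa> z + 2 * t * Re (cdot z k) + t\<^sup>2 * green_form C \<kappa> k"
proof -
  let ?h = "potential C \<kappa> k"
  have gh: "generator C \<kappa> ?h = k" by (rule generator_potential[OF net])
  have hz: "Re (cdot ?h (generator C \<kappa> z)) = Re (cdot z k)"
    unfolding generator_hermitian[OF net, symmetric] gh by (metis cdot_cnj cnj.sel(1))
  show ?thesis
    unfolding energy_eq_cdot[OF net] generator_add generator_scale cdot_add cdot_scale gh
    by (simp add: hz green_form_def power2_eq_square algebra_simps)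
qed

text \<open>Lebesgue measure is invariant under the translation by \<open>- t *\<^sub>R potential C \<kappa> k\<close>, which
  turns \<open>gauss\<close>, up to a constant, into its product with the exponential of a linear functional.\<close>

lemma gauss_exp_linear:
  assumes net: "network C \<kappa>" and int: "integrable lborel (gauss C \<kappa>)"
  shows "has_bochner_integral lborel (\<lambda>z. exp (t * Re (cdot z k)) * gauss C \<kappa> z)
     (exp (t\<^sup>2 * green_form C \<kappa> k / 2) * partition_function C \<kappa>)"
proof -
  let ?c = "(- t) *\<^sub>R potential C \<kappa> k"
  have hb: "has_bochner_integral lborel (gauss C \<kappa>) (partition_function C \<kappa>)"
    unfolding partition_function_def by (rule has_bochner_integral_integrable[OF int])
  have "has_bochner_integral (distr lborel borel ((+) ?c)) (gauss C \<kappa>) (partition_function C \<kappa>)"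
    using hb by (simp only: lborel_distr_plus)
  then have "has_bochner_integral lborel (\<lambda>z. gauss C \<kappa> (?c + z)) (partition_function C \<kappa>)"
    unfolding has_bochner_integral_iff
    by (subst (asm) integrable_distr_eq, simp, simp, subst (asm) integral_distr) simp_all
  then have "has_bochner_integral lborel (\<lambda>z. exp (t\<^sup>2 * green_form C \<kappa> k / 2) * gauss C \<kappa> (?c + z)) (exp (t\<^sup>2 * green_form C \<kappa> k / 2) * partition_function C \<kappa>)"
    by (rule has_bochner_integral_mult_right)
  moreover have "exp (t\<^sup>2 * green_form C \<kappa> k / 2) * gauss C \<kappa> (?c + z) = exp (t * Re (cdot z k)) * gauss C \<kappa> z" for z
  proof -
    have "energy C \<kappa> (?c + z) = energy C \<kappa> z + 2 * (- t) * Re (cdot z k) + (- t)\<^sup>2 * green_form C \<kappa> k"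
      using energy_translate[OF net, of z "- t" k] by (simp only: add.commute)
    then show ?thesis unfolding gauss_def exp_add[symmetric] by (simp add: field_simps)
  qed
  ultimately show ?thesis by simp
qed

text \<open>The second difference quotients of \<open>t \<mapsto> exp (t * y)\<close> at the origin, with steps \<open>1 / n\<close>,
  are dominated by exponentials of \<open>2 * y\<close> and \<open>- 2 * y\<close>: they are multiples of squares of
  hyperbolic sines, and \<open>1 - exp (- 2 * b) \<le> 2 * b\<close> bounds these linearly.\<close>

lemma cosh_quotient_le:
  fixes y :: real
  assumes n: "0 < n"
  shows "0 \<le> (real n)\<^sup>2 * (exp (y / n) + exp (- y / n) - 2)"
    "(real n)\<^sup>2 * (exp (y / n) + exp (- y / n) - 2) \<le> 2 * (exp (2 * y) + exp (- 2 * y))"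
proof -
  define b where "b = \<bar>y\<bar> / (2 * n)"
  have b: "0 \<le> b" "2 * real n * b = \<bar>y\<bar>" "2 * b \<le> \<bar>y\<bar>"
    using n by (auto simp: b_def field_simps mult_le_cancel_left1)
  have sq: "exp (2 * u) + exp (- 2 * u) - 2 = (exp u - exp (- u))\<^sup>2" for u :: real
    by (simp add: power2_eq_square algebra_simps flip: exp_add)
  have e: "exp (y / n) + exp (- y / n) - 2 = (exp b - exp (- b))\<^sup>2"
    using sq[of b] n by (auto simp: b_def abs_if)
  show "0 \<le> (real n)\<^sup>2 * (exp (y / n) + exp (- y / n) - 2)" unfolding e by simp
  have "exp b - exp (- b) = exp b * (1 - exp (- (2 * b)))" by (simp add: algebra_simps flip: exp_add)
  also have "\<dots> \<le> exp b * (2 * b)" using exp_ge_add_one_self[of "- (2 * b)"] by (intro mult_left_mono) auto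
  finally have "(real n * (exp b - exp (- b)))\<^sup>2 \<le> (real n * (exp b * (2 * b)))\<^sup>2"
    using b(1) by (intro power_mono mult_left_mono mult_nonneg_nonneg) auto
  also have "\<dots> = (2 * real n * b)\<^sup>2 * exp (2 * b)"
    by (simp add: power_mult_distrib mult_ac flip: exp_double)
  also have "\<dots> \<le> (2 * exp \<bar>y\<bar>) * exp \<bar>y\<bar>"
    unfolding b(2) using exp_lower_Taylor_quadratic[of "\<bar>y\<bar>"] b(3) by (intro mult_mono) auto
  also have "\<dots> = 2 * exp (2 * \<bar>y\<bar>)" by (simp flip: exp_add)
  also have "\<dots> \<le> 2 * (exp (2 * y) + exp (- 2 * y))" by (cases "0 \<le> y") auto
  finally show "(real n)\<^sup>2 * (exp (y / n) + exp (- y / n) - 2) \<le> 2 * (exp (2 * y) + exp (- 2 * y))"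
    unfolding e by (simp add: power_mult_distrib)
qed

lemma measurable_cdot [measurable]: "(\<lambda>z. cdot z k) \<in> borel_measurable borel"
  unfolding cdot_def by (intro borel_measurable_continuous_onI continuous_intros)

text \<open>The variance is read off from the exponential moments of \<open>gauss_exp_linear\<close> as the limit of
  second difference quotients. Exponential moments of both signs dominate the quotients
  (\<open>cosh_quotient_le\<close>).\<close>

lemma gauss_second_moment_Re:
  assumes net: "network C \<kappa>" and int: "integrable lborel (gauss C \<kappa>)"
  shows "has_bochner_integral lborel (\<lambda>z. (Re (cdot z k))\<^sup>2 * gauss C \<kappa> z)
     (green_form C \<kappa> k * partition_function C \<kappa>)"
proof -
  define Y where "Y z = Re (cdot z k)" for z
  define q where "q = green_form C \<kappa> k"
  define Z where "Z = partition_function C \<kappa>"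
  have Ym [measurable]: "Y \<in> borel_measurable borel" unfolding Y_def[abs_def] by measurable
  have E: "has_bochner_integral lborel (\<lambda>z. exp (t * Y z) * gauss C \<kappa> z) (exp (t\<^sup>2 * q / 2) * Z)" for t
    unfolding Y_def q_def Z_def by (rule gauss_exp_linear[OF net int])
  define f where "f n z = (real (Suc n))\<^sup>2 * (exp (Y z / real (Suc n)) + exp (- Y z / real (Suc n)) - 2) * gauss C \<kappa> z" for n z
  have f: "has_bochner_integral lborel (f n) ((real (Suc n))\<^sup>2 * (exp ((1 / real (Suc n))\<^sup>2 * q / 2) + exp ((- 1 / real (Suc n))\<^sup>2 * q / 2) - 2) * Z)" for n
  proof -
    have "has_bochner_integral lborel (\<lambda>z. (real (Suc n))\<^sup>2 * (exp (1 / real (Suc n) * Y z) * gauss C \<kappa> z + exp (- 1 / real (Suc n) * Y z) * gauss C \<kappa> z - 2 * (exp (0 * Y z) * gauss C \<kappa> z)))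
        ((real (Suc n))\<^sup>2 * (exp ((1 / real (Suc n))\<^sup>2 * q / 2) * Z + exp ((- 1 / real (Suc n))\<^sup>2 * q / 2) * Z - 2 * (exp (0\<^sup>2 * q / 2) * Z)))"
      by (intro has_bochner_integral_mult_right has_bochner_integral_diff has_bochner_integral_add E)
    then show ?thesis by (simp add: f_def[abs_def] algebra_simps)
  qed
  define W where "W z = 2 * (exp (2 * Y z) * gauss C \<kappa> z + exp (- 2 * Y z) * gauss C \<kappa> z)" for z
  have lim: "(\<lambda>n. (real (Suc n))\<^sup>2 * (exp (y / real (Suc n)) + exp (- y / real (Suc n)) - 2)) \<longlonglongrightarrow> y\<^sup>2" for y :: real
    unfolding power2_eq_square[of y] by real_asymp
  have lim2: "(\<lambda>n. (real (Suc n))\<^sup>2 * (exp ((1 / real (Suc n))\<^sup>2 * q / 2) + exp ((- 1 / real (Suc n))\<^sup>2 * q / 2) - 2) * Z) \<longlonglongrightarrow> q * Z"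
    by real_asymp
  have DC: "integrable lborel (\<lambda>z. (Y z)\<^sup>2 * gauss C \<kappa> z)"
    "(\<lambda>n. integral\<^sup>L lborel (f n)) \<longlonglongrightarrow> (\<integral>z. (Y z)\<^sup>2 * gauss C \<kappa> z \<partial>lborel)"
  proof -
    have i: "integrable lborel W"
      unfolding W_def by (intro integrable_mult_right Bochner_Integration.integrable_add integrable.intros[OF E])
    have l: "AE z in lborel. (\<lambda>n. f n z) \<longlonglongrightarrow> (Y z)\<^sup>2 * gauss C \<kappa> z"
      unfolding f_def by (intro AE_I2 tendsto_mult_right lim)
    have b: "AE z in lborel. norm (f n z) \<le> W z" for n
    proof (rule AE_I2)
      fix z
      have "f n z \<le> (2 * (exp (2 * Y z) + exp (- 2 * Y z))) * gauss C \<kappa> z" "0 \<le> f n z"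
        unfolding f_def using cosh_quotient_le[of "Suc n" "Y z"] gauss_pos[of C \<kappa> z]
        by (auto intro!: mult_right_mono mult_nonneg_nonneg simp del: of_nat_Suc)
      then show "norm (f n z) \<le> W z" by (simp add: W_def algebra_simps)
    qed
    have m: "(\<lambda>z. (Y z)\<^sup>2 * gauss C \<kappa> z) \<in> borel_measurable lborel" "f n \<in> borel_measurable lborel" for n
      unfolding f_def[abs_def] by measurable
    show "integrable lborel (\<lambda>z. (Y z)\<^sup>2 * gauss C \<kappa> z)"
      by (rule integrable_dominated_convergence[OF m i l b])
    show "(\<lambda>n. integral\<^sup>L lborel (f n)) \<longlonglongrightarrow> (\<integral>z. (Y z)\<^sup>2 * gauss C \<kappa> z \<partial>lborel)"
      by (rule integral_dominated_convergence[OF m i l b])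
  qed
  have "(\<lambda>n. integral\<^sup>L lborel (f n)) \<longlonglongrightarrow> q * Z"
    using lim2 by (simp only: has_bochner_integral_integral_eq[OF f])
  with DC(2) have "(\<integral>z. (Y z)\<^sup>2 * gauss C \<kappa> z \<partial>lborel) = q * Z" by (rule LIMSEQ_unique)
  with DC(1) show ?thesis unfolding Y_def q_def Z_def by (simp add: has_bochner_integral_iff)
qed

text \<open>The imaginary part of \<open>cdot z k\<close> is the real part of \<open>cdot z (\<i> * k)\<close>, and
  multiplication by \<open>\<i>\<close> leaves \<open>green_form\<close> unchanged.\<close>

lemma gauss_second_moment:
  assumes net: "network C \<kappa>" and int: "integrable lborel (gauss C \<kappa>)"
  shows "has_bochner_integral lborel (\<lambda>z. (norm (cdot z k))\<^sup>2 * gauss C \<kappa> z)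
     (2 * green_form C \<kappa> k * partition_function C \<kappa>)"
proof -
  let ?k = "\<chi> x. \<i> * k $ x"
  have i: "cdot z ?k = - \<i> * cdot z k" for z
    by (simp add: cdot_def sum_distrib_left mult_ac sum_negf)
  have p: "potential C \<kappa> ?k = (\<chi> x. \<i> * potential C \<kappa> k $ x)"
    by (simp add: potential_def vec_eq_iff sum_distrib_left mult_ac)
  have "cdot (potential C \<kappa> ?k) ?k = cdot (potential C \<kappa> k) k"
    unfolding p i by (simp add: cdot_def sum_distrib_left mult_ac)
  then have q: "green_form C \<kappa> ?k = green_form C \<kappa> k" by (simp add: green_form_def)
  have "has_bochner_integral lborel (\<lambda>z. (Re (cdot z k))\<^sup>2 * gauss C \<kappa> z + (Re (cdot z ?k))\<^sup>2 * gauss C \<kappa> z)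
     (green_form C \<kappa> k * partition_function C \<kappa> + green_form C \<kappa> ?k * partition_function C \<kappa>)"
    by (intro has_bochner_integral_add gauss_second_moment_Re net int)
  moreover have "(Re (cdot z k))\<^sup>2 * gauss C \<kappa> z + (Re (cdot z ?k))\<^sup>2 * gauss C \<kappa> z = (norm (cdot z k))\<^sup>2 * gauss C \<kappa> z" for z
    by (simp add: i cmod_power2 algebra_simps)
  ultimately show ?thesis unfolding q by (simp add: algebra_simps)
qed

lemma cdot_two_point:
  "cdot z (\<chi> u. (if u = x then 1 else 0) + (if u = y then c else 0)) = z $ x + cnj c * z $ y"
  by (simp add: cdot_def distrib_left sum.distrib if_distrib[of cnj] if_distrib[of "\<lambda>u. _ * u"] mult.commute cong: if_cong)

lemma green_form_two_point:
  assumes net: "network C \<kappa>"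
  shows "green_form C \<kappa> (\<chi> u. (if u = x then 1 else 0) + (if u = y then c else 0)) =
    green C \<kappa> x x + (norm c)\<^sup>2 * green C \<kappa> y y + 2 * Re c * green C \<kappa> x y"
proof -
  have p: "potential C \<kappa> (\<chi> u. (if u = x then 1 else 0) + (if u = y then c else 0)) $ v = of_real (green C \<kappa> v x) + of_real (green C \<kappa> v y) * c" for v
    by (simp add: potential_def distrib_left sum.distrib if_distrib[of "\<lambda>u. _ * u"] cong: if_cong)
  show ?thesis unfolding green_form_def cdot_two_point p cmod_power2
    by (simp add: green_sym[OF net, of y x] power2_eq_square algebra_simps)
qed

text \<open>Polarisation of \<open>gauss_second_moment\<close> over the vectors \<open>e\<^sub>x + c e\<^sub>y\<close> with \<open>c\<close> a
  fourth root of unity. By symmetry of the Green function the imaginary part cancels.\<close>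

lemma gauss_covariance:
  assumes net: "network C \<kappa>" and int: "integrable lborel (gauss C \<kappa>)"
  shows "has_bochner_integral lborel (\<lambda>z. 1 / 2 * z $ x * cnj (z $ y) * of_real (gauss C \<kappa> z))
     (of_real (green C \<kappa> x y * partition_function C \<kappa>))"
proof -
  let ?Z = "partition_function C \<kappa>"
  let ?k = "\<lambda>c. (\<chi> u. (if u = x then 1 else 0) + (if u = y then c else 0)) :: complex^'a"
  let ?I = "\<lambda>c z. (norm (cdot z (?k c)))\<^sup>2 * gauss C \<kappa> z"
  have I: "has_bochner_integral lborel (?I c) (2 * (green C \<kappa> x x + (norm c)\<^sup>2 * green C \<kappa> y y + 2 * Re c * green C \<kappa> x y) * ?Z)" for c
    using gauss_second_moment[OF net int, of "?k c"] unfolding green_form_two_point[OF net] .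
  have R: "has_bochner_integral lborel (\<lambda>z. of_real (1 / 8 * (?I 1 z - ?I (-1) z)) + \<i> * of_real (1 / 8 * (?I (- \<i>) z - ?I \<i> z)))
    (of_real (1 / 8 * (2 * (green C \<kappa> x x + (norm (1::complex))\<^sup>2 * green C \<kappa> y y + 2 * Re 1 * green C \<kappa> x y) * ?Z -
        2 * (green C \<kappa> x x + (norm (-1::complex))\<^sup>2 * green C \<kappa> y y + 2 * Re (-1) * green C \<kappa> x y) * ?Z)) +
     \<i> * of_real (1 / 8 * (2 * (green C \<kappa> x x + (norm (-\<i>))\<^sup>2 * green C \<kappa> y y + 2 * Re (-\<i>) * green C \<kappa> x y) * ?Z -
        2 * (green C \<kappa> x x + (norm \<i>)\<^sup>2 * green C \<kappa> y y + 2 * Re \<i> * green C \<kappa> x y) * ?Z)))"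
    by (intro has_bochner_integral_add has_bochner_integral_mult_right has_bochner_integral_of_real has_bochner_integral_diff I)
  have e: "of_real (1 / 8 * (?I 1 z - ?I (-1) z)) + \<i> * of_real (1 / 8 * (?I (- \<i>) z - ?I \<i> z)) =
      1 / 2 * z $ x * cnj (z $ y) * of_real (gauss C \<kappa> z)" for z
    unfolding cdot_two_point cmod_power2
    by (simp add: complex_eq_iff power2_eq_square algebra_simps)
  show ?thesis using R unfolding e by (simp add: algebra_simps)
qed

lemma partition_function_pos:
  assumes "integrable lborel (gauss C \<kappa>)"
  shows "0 < partition_function C \<kappa>"
proof -
  have "partition_function C \<kappa> \<noteq> 0"
  proof
    assume "partition_function C \<kappa> = 0"
    then have "AE z in lborel. gauss C \<kappa> z = 0"
      unfolding partition_function_def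
      by (subst (asm) integral_nonneg_eq_0_iff_AE[OF assms]) (auto intro: less_imp_le gauss_pos)
    then have "AE z :: complex^'a in lborel. False"
      by eventually_elim (use gauss_pos[of C \<kappa>] in \<open>simp add: less_le\<close>)
    then have "emeasure lborel (UNIV :: (complex^'a) set) = 0"
      by (auto simp: AE_iff_measurable[OF _ refl] )
    then show False by (simp add: emeasure_lborel_UNIV)
  qed
  moreover have "0 \<le> partition_function C \<kappa>"
    unfolding partition_function_def by (intro integral_nonneg_AE) (simp add: gauss_pos less_imp_le)
  ultimately show ?thesis by simp
qed

section \<open>The partition function and the loop measure\<close>

lemma exp_neg_quotient_bound:
  fixes a s u :: real
  assumes "0 \<le> a" "0 \<le> s" "0 \<le> u" "u \<noteq> s"
  shows "\<bar>(exp (- (s * a)) - exp (- (u * a))) / (u - s)\<bar> \<le> a"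
proof -
  have k: "\<bar>exp (- p) - exp (- q)\<bar> \<le> q - p" if "0 \<le> p" "p \<le> q" for p q :: real
  proof -
    have "exp (- p) - exp (- q) = exp (- p) * (1 - exp (- (q - p)))" by (simp add: algebra_simps flip: exp_add)
    also have "\<dots> \<le> 1 * (1 - exp (- (q - p)))" using that by (intro mult_right_mono) auto
    also have "\<dots> \<le> q - p" using exp_ge_add_one_self[of "- (q - p)"] unfolding mult_1 by linarith
    finally show ?thesis using that by simp
  qed
  have "\<bar>exp (- (s * a)) - exp (- (u * a))\<bar> \<le> \<bar>u - s\<bar> * a"
  proof (cases "s \<le> u")
    case True
    then have "s * a \<le> u * a" using assms by (intro mult_right_mono)
    from k[OF _ this] show ?thesis using assms True by (simp add: left_diff_distrib)
  next
    case False
    then have "u * a \<le> s * a" using assms by (intro mult_right_mono) auto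
    from k[OF _ this] show ?thesis using assms False by (simp add: left_diff_distrib abs_minus_commute)
  qed
  then show ?thesis using assms by (simp add: abs_divide pos_divide_le_eq mult.commute)
qed

text \<open>Differentiation under the integral sign. The one-sided difference quotients are dominated
  by \<open>a * w\<close> down to \<open>s = 0\<close>. The integrand is \<open>1 - exp (- s * a)\<close> rather than
  \<open>exp (- s * a)\<close> because the loop measure has infinite total mass near short trivial loops.\<close>

lemma laplace_integral_derivative:
  fixes a w :: "'a \<Rightarrow> real"
  assumes [measurable]: "a \<in> borel_measurable M" "w \<in> borel_measurable M"
    and a: "\<And>x. x \<in> space M \<Longrightarrow> 0 \<le> a x" and w: "\<And>x. x \<in> space M \<Longrightarrow> 0 \<le> w x"
    and int: "integrable M (\<lambda>x. a x * w x)" and s: "0 \<le> s"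
  shows "((\<lambda>s. \<integral>x. (1 - exp (- (s * a x))) * w x \<partial>M) has_real_derivative
      (\<integral>x. a x * exp (- (s * a x)) * w x \<partial>M)) (at s within {0..})"
    and "integrable M (\<lambda>x. (1 - exp (- (s * a x))) * w x)"
proof -
  let ?J = "\<lambda>s. \<integral>x. (1 - exp (- (s * a x))) * w x \<partial>M"
  let ?q = "\<lambda>u x. (exp (- (s * a x)) - exp (- (u * a x))) / (u - s) * w x"
  have I: "integrable M (\<lambda>x. (1 - exp (- (s * a x))) * w x)" if "0 \<le> s" for s
  proof (rule Bochner_Integration.integrable_bound[OF integrable_mult_right[OF int, of s]])
    show "AE x in M. norm ((1 - exp (- (s * a x))) * w x) \<le> norm (s * (a x * w x))"
    proof (rule AE_I2)
      fix x assume x: "x \<in> space M"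
      have sa: "0 \<le> s * a x" using that a[OF x] by simp
      then have "1 - exp (- (s * a x)) \<le> s * a x" "0 \<le> 1 - exp (- (s * a x))"
        using exp_ge_add_one_self[of "- (s * a x)"] by simp_all
      then have "\<bar>1 - exp (- (s * a x))\<bar> * w x \<le> \<bar>s * a x\<bar> * w x"
        using w[OF x] sa by (intro mult_right_mono) auto
      then show "norm ((1 - exp (- (s * a x))) * w x) \<le> norm (s * (a x * w x))"
        using w[OF x] by (simp add: abs_mult mult.assoc)
    qed
  qed simp
  then show "integrable M (\<lambda>x. (1 - exp (- (s * a x))) * w x)" using s by blast
  show "((\<lambda>s. \<integral>x. (1 - exp (- (s * a x))) * w x \<partial>M) has_real_derivative
      (\<integral>x. a x * exp (- (s * a x)) * w x \<partial>M)) (at s within {0..})"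
    unfolding has_field_derivative_iff tendsto_at_iff_sequentially comp_def
  proof (intro allI impI)
    fix u assume "\<forall>i. u i \<in> {0..} - {s}" and lim: "u \<longlonglongrightarrow> s"
    then have u: "0 \<le> u i" "u i \<noteq> s" for i by auto
    have e: "(?J (u i) - ?J s) / (u i - s) =
       (\<integral>x. ?q (u i) x \<partial>M)" for i
    proof -
      have "(\<integral>x. ?q (u i) x \<partial>M) =
        (\<integral>x. ((1 - exp (- (u i * a x))) * w x - (1 - exp (- (s * a x))) * w x) / (u i - s) \<partial>M)"
        by (intro Bochner_Integration.integral_cong refl) (simp add: algebra_simps)
      then show ?thesis
        by (simp only: integral_divide_zero Bochner_Integration.integral_diff[OF I[OF u(1)] I[OF s]])
    qed
    show "(\<lambda>i. (?J (u i) - ?J s) / (u i - s))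
        \<longlonglongrightarrow> (\<integral>x. a x * exp (- (s * a x)) * w x \<partial>M)"
      unfolding e
    proof (rule integral_dominated_convergence[where w = "\<lambda>x. a x * w x"])
      show "AE x in M. norm (?q (u i) x) \<le> a x * w x" for i
      proof (rule AE_I2)
        fix x assume x: "x \<in> space M"
        have "norm (q * w x) = \<bar>q\<bar> * w x" for q using w[OF x] by (simp add: abs_mult)
        then show "norm (?q (u i) x) \<le> a x * w x"
          using mult_right_mono[OF exp_neg_quotient_bound[OF a[OF x] s u(1) u(2)] w[OF x]] by simp
      qed
      show "AE x in M. (\<lambda>i. ?q (u i) x) \<longlonglongrightarrow> a x * exp (- (s * a x)) * w x"
      proof (rule AE_I2)
        fix x
        have "((\<lambda>t. 1 - exp (- (t * a x))) has_real_derivative a x * exp (- (s * a x))) (at s)"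
          by (auto intro!: derivative_eq_intros)
        then have "(\<lambda>i. ((1 - exp (- (u i * a x))) - (1 - exp (- (s * a x)))) / (u i - s)) \<longlonglongrightarrow> a x * exp (- (s * a x))"
          unfolding has_field_derivative_iff tendsto_at_iff_sequentially comp_def using u lim by auto
        then show "(\<lambda>i. ?q (u i) x) \<longlonglongrightarrow> a x * exp (- (s * a x)) * w x"
          by (intro tendsto_mult_right) simp
      qed
    qed (use int in simp_all)
  qed
qed

lemma occupation_orthant: "\<gamma> \<in> paths \<Longrightarrow> occupation \<gamma> \<in> orthant"
  by (simp add: orthant_def occupation_nonneg)

lemma based_loop_linear:
  assumes net: "network C \<kappa>" and \<theta>: "\<theta> \<in> orthant" and \<eta>: "\<eta> \<in> orthant"
  shows "has_bochner_integral (based_loop_measure C \<kappa>)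
    (\<lambda>\<gamma>. (\<theta> \<bullet> occupation \<gamma>) * exp (- (\<eta> \<bullet> occupation \<gamma>))) (\<Sum>x\<in>UNIV. \<theta> $ x * green C (\<kappa> + \<eta>) x x)"
proof (rule has_bochner_integral_nn_integral)
  let ?\<mu> = "based_loop_measure C \<kappa>"
  let ?t = "\<lambda>\<gamma>. \<theta> \<bullet> occupation \<gamma>"
  let ?e = "\<lambda>\<gamma>. exp (- (\<eta> \<bullet> occupation \<gamma>))"
  have th: "0 \<le> \<theta> $ x" for x using \<theta> by (simp add: orthant_def)
  have net': "network C (\<kappa> + \<eta>)" by (rule network_add[OF net \<eta>])
  have nn: "0 \<le> \<theta> \<bullet> occupation \<gamma>" if "\<gamma> \<in> paths" for \<gamma>
    using that by (intro inner_orthant_nonneg \<theta> occupation_orthant)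
  show "(\<lambda>\<gamma>. (?t \<gamma>) * ?e \<gamma>) \<in> borel_measurable ?\<mu>"
    by (subst measurable_cong_sets[OF sets_based_loop_measure refl]) measurable
  show "AE \<gamma> in ?\<mu>. 0 \<le> (?t \<gamma>) * ?e \<gamma>"
    by (intro AE_I2) (simp add: nn)
  show "0 \<le> (\<Sum>x\<in>UNIV. \<theta> $ x * green C (\<kappa> + \<eta>) x x)"
    by (intro sum_nonneg mult_nonneg_nonneg th green_nonneg net')
  have "(\<integral>\<^sup>+\<gamma>. ennreal ((?t \<gamma>) * ?e \<gamma>) \<partial>?\<mu>) =
     (\<integral>\<^sup>+\<gamma>. ennreal (?e \<gamma>) * ennreal (?t \<gamma>) \<partial>?\<mu>)"
    by (intro nn_integral_cong, subst ennreal_mult[OF nn]) (auto simp: mult.commute)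
  also have "\<dots> = (\<integral>\<^sup>+\<gamma>. ennreal (?t \<gamma>) \<partial>based_loop_measure C (\<kappa> + \<eta>))"
    by (rule based_loop_measure_add) measurable
  also have "\<dots> = (\<integral>\<^sup>+\<gamma>. (\<Sum>x\<in>UNIV. ennreal (\<theta> $ x) * ennreal (occupation \<gamma> $ x)) \<partial>based_loop_measure C (\<kappa> + \<eta>))"
    using th by (intro nn_integral_cong) (simp add: inner_vec_def ennreal_mult'[symmetric] sum_ennreal occupation_nonneg)
  also have "\<dots> = (\<Sum>x\<in>UNIV. ennreal (\<theta> $ x) * (\<integral>\<^sup>+\<gamma>. ennreal (occupation \<gamma> $ x) \<partial>based_loop_measure C (\<kappa> + \<eta>)))"
  proof -
    have m: "(\<lambda>\<gamma>. ennreal (occupation \<gamma> $ x)) \<in> borel_measurable (based_loop_measure C (\<kappa> + \<eta>))" for x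
      by (subst measurable_cong_sets[OF sets_based_loop_measure refl]) measurable
    show ?thesis using m by (simp add: nn_integral_sum nn_integral_cmult)
  qed
  also have "\<dots> = ennreal (\<Sum>x\<in>UNIV. \<theta> $ x * green C (\<kappa> + \<eta>) x x)"
    by (simp add: based_loop_occupation[OF net'] ennreal_mult'[symmetric] th sum_ennreal green_nonneg[OF net'])
  finally show "(\<integral>\<^sup>+\<gamma>. ennreal ((?t \<gamma>) * ?e \<gamma>) \<partial>?\<mu>) = \<dots>" .
qed

text \<open>Along \<open>\<kappa> + s *\<^sub>R \<theta>\<close> the logarithm of the partition function has the derivative \<open>- g s\<close>
  by \<open>gauss_covariance\<close> on the diagonal, and the loop integral \<open>L s\<close> has the derivative \<open>g s\<close>
  by \<open>based_loop_linear\<close>. Hence \<open>Z s * exp (L s)\<close> is constant on \<open>[0, \<infinity>)\<close>; it is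
  compared at \<open>s = 0\<close> and \<open>s = 1\<close>.\<close>

lemma partition_function_ratio:
  assumes net: "network C \<kappa>" and int: "integrable lborel (gauss C \<kappa>)" and \<theta>: "\<theta> \<in> orthant"
  shows "partition_function C (\<kappa> + \<theta>) =
     partition_function C \<kappa> * exp (- (\<integral>\<gamma>. 1 - exp (- (\<theta> \<bullet> occupation \<gamma>)) \<partial>based_loop_measure C \<kappa>))"
proof -
  let ?\<mu> = "based_loop_measure C \<kappa>"
  let ?h = "\<lambda>z. \<theta> \<bullet> half_square z"
  let ?l = "\<lambda>\<gamma>. \<theta> \<bullet> occupation \<gamma>"
  let ?\<kappa> = "\<lambda>s. \<kappa> + s *\<^sub>R \<theta>"
  have sth: "s *\<^sub>R \<theta> \<in> orthant" if "0 \<le> s" for s using \<theta> that by (simp add: orthant_def)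
  define g where "g s = (\<Sum>x\<in>UNIV. \<theta> $ x * green C (?\<kappa> s) x x)" for s
  define Z where "Z s = partition_function C (?\<kappa> s)" for s
  define L where "L s = (\<integral>\<gamma>. (1 - exp (- (s * (?l \<gamma>)))) * 1 \<partial>?\<mu>)" for s
  have L': "(L has_real_derivative g s) (at s within {0..})" if s: "0 \<le> s" for s
  proof -
    have "(\<integral>\<gamma>. (?l \<gamma>) * exp (- (s * (?l \<gamma>))) * 1 \<partial>?\<mu>) = g s"
      using has_bochner_integral_integral_eq[OF based_loop_linear[OF net \<theta> sth[OF s]]] by (simp add: g_def)
    moreover have "integrable ?\<mu> (\<lambda>\<gamma>. (?l \<gamma>) * 1)"
      using integrable.intros[OF based_loop_linear[OF net \<theta> zero_in_orthant]] by simp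
    moreover have "(\<lambda>\<gamma>. \<theta> \<bullet> occupation \<gamma>) \<in> borel_measurable ?\<mu>"
      by (subst measurable_cong_sets[OF sets_based_loop_measure refl]) measurable
    moreover have "0 \<le> \<theta> \<bullet> occupation \<gamma>" if "\<gamma> \<in> space ?\<mu>" for \<gamma>
      using that by (intro inner_orthant_nonneg \<theta> occupation_orthant) simp
    ultimately show ?thesis
      using laplace_integral_derivative(1)[of "\<lambda>\<gamma>. \<theta> \<bullet> occupation \<gamma>" "?\<mu>" "\<lambda>_. 1" s] s
      unfolding L_def[abs_def] by simp
  qed
  have half: "has_bochner_integral lborel (\<lambda>z. (?h z) * gauss C (?\<kappa> s) z) (g s * Z s)" if s: "0 \<le> s" for s
  proof -
    have net': "network C (?\<kappa> s)" by (rule network_add[OF net sth[OF s]])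
    have int': "integrable lborel (gauss C (?\<kappa> s))" by (rule integrable_gauss_add[OF int sth[OF s]])
    have "has_bochner_integral lborel (\<lambda>z. Re (\<Sum>x\<in>UNIV. of_real (\<theta> $ x) * (1 / 2 * z $ x * cnj (z $ x) * of_real (gauss C (?\<kappa> s) z))))
       (Re (\<Sum>x\<in>UNIV. of_real (\<theta> $ x) * of_real (green C (?\<kappa> s) x x * Z s)))"
      unfolding Z_def
      by (intro has_bochner_integral_Re has_bochner_integral_sum has_bochner_integral_mult_right gauss_covariance net' int')
    moreover have "Re (\<Sum>x\<in>UNIV. of_real (\<theta> $ x) * (1 / 2 * z $ x * cnj (z $ x) * of_real (gauss C (?\<kappa> s) z))) =
       (?h z) * gauss C (?\<kappa> s) z" for z
    proof -
      have "of_real (\<theta> $ x) * (1 / 2 * z $ x * cnj (z $ x) * of_real (gauss C (?\<kappa> s) z)) =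
          complex_of_real (\<theta> $ x * half_square z $ x * gauss C (?\<kappa> s) z)" for x
        by (simp add: half_square_def complex_norm_square[symmetric] mult.assoc flip: of_real_power)
      then have "(\<Sum>x\<in>UNIV. of_real (\<theta> $ x) * (1 / 2 * z $ x * cnj (z $ x) * of_real (gauss C (?\<kappa> s) z))) =
          complex_of_real (\<Sum>x\<in>UNIV. \<theta> $ x * half_square z $ x * gauss C (?\<kappa> s) z)"
        unfolding of_real_sum by (intro sum.cong refl)
      then show ?thesis
        by (simp only: Re_complex_of_real inner_vec_def inner_real_def sum_distrib_right)
    qed
    moreover have "Re (\<Sum>x\<in>UNIV. of_real (\<theta> $ x) * of_real (green C (?\<kappa> s) x x * Z s)) = g s * Z s"
      by (simp add: g_def sum_distrib_right mult.assoc)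
    ultimately show ?thesis by simp
  qed
  have Z': "(Z has_real_derivative - (g s * Z s)) (at s within {0..})" if s: "0 \<le> s" for s
  proof -
    define D where "D s = (\<integral>z. (1 - exp (- (s * (?h z)))) * gauss C \<kappa> z \<partial>lborel)" for s
    have i0: "integrable lborel (\<lambda>z. (?h z) * gauss C \<kappa> z)"
      using integrable.intros[OF half[of 0]] by simp
    have nn: "0 \<le> \<theta> \<bullet> half_square z" "0 \<le> gauss C \<kappa> z" for z
      using inner_orthant_nonneg[OF \<theta> half_square_orthant] gauss_pos[of C \<kappa> z] by auto
    have "(\<integral>z. (?h z) * exp (- (s * (?h z))) * gauss C \<kappa> z \<partial>lborel) = g s * Z s"
      using has_bochner_integral_integral_eq[OF half[OF s]] by (simp add: gauss_add mult.assoc)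
    moreover have "(D has_real_derivative (\<integral>z. (?h z) * exp (- (s * (?h z))) * gauss C \<kappa> z \<partial>lborel)) (at s within {0..})"
      unfolding D_def[abs_def] by (rule laplace_integral_derivative(1)[OF _ _ nn i0 s]) auto
    ultimately have D': "(D has_real_derivative g s * Z s) (at s within {0..})" by simp
    have ZD: "Z 0 - D t = Z t" if t: "0 \<le> t" for t
    proof -
      have "integrable lborel (\<lambda>z. (1 - exp (- (t * (?h z)))) * gauss C \<kappa> z)"
        by (rule laplace_integral_derivative(2)[OF _ _ nn i0 t]) auto
      from Bochner_Integration.integral_diff[OF int this]
      have "Z 0 - D t = (\<integral>z. gauss C \<kappa> z - (1 - exp (- (t * (?h z)))) * gauss C \<kappa> z \<partial>lborel)"
        by (simp add: Z_def D_def partition_function_def)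
      also have "\<dots> = Z t"
        unfolding Z_def partition_function_def by (intro Bochner_Integration.integral_cong refl) (simp add: gauss_add algebra_simps)
      finally show ?thesis .
    qed
    have "((\<lambda>t. Z 0 - D t) has_real_derivative - (g s * Z s)) (at s within {0..})"
      by (auto intro!: derivative_eq_intros D')
    then show ?thesis
      by (rule has_field_derivative_transform_within[OF _ zero_less_one]) (use s ZD in simp_all)
  qed
  have "\<exists>c. \<forall>s\<in>{0..}. Z s * exp (L s) = c"
  proof (rule has_field_derivative_zero_constant)
    show "convex {0::real..}" by simp
    fix s :: real assume "s \<in> {0..}"
    then have s: "0 \<le> s" by simp
    have "((\<lambda>s. Z s * exp (L s)) has_real_derivative (- (g s * Z s) * exp (L s) + (exp (L s) * g s) * Z s)) (at s within {0..})"
      by (intro DERIV_mult Z'[OF s] DERIV_chain2[OF DERIV_exp L'[OF s]])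
    then show "((\<lambda>s. Z s * exp (L s)) has_real_derivative 0) (at s within {0..})" by (simp add: algebra_simps)
  qed
  then have "Z 1 * exp (L 1) = Z 0 * exp (L 0)" by force
  moreover have "L 0 = 0" "L 1 = (\<integral>\<gamma>. 1 - exp (- (?l \<gamma>)) \<partial>?\<mu>)"
    by (simp_all add: L_def)
  ultimately show ?thesis by (simp add: Z_def exp_minus field_simps)
qed

section \<open>Poisson processes\<close>

text \<open>When the sum diverges both sides are 0: \<open>infsum\<close> by convention, and \<open>enn2real\<close> because it
  maps infinity to 0.\<close>

lemma infsum_eq_nn_integral:
  fixes f :: "'a \<Rightarrow> real"
  assumes nn: "\<And>x. x \<in> A \<Longrightarrow> 0 \<le> f x"
  shows "infsum f A = enn2real (\<integral>\<^sup>+x. ennreal (f x) \<partial>count_space A)"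
proof (cases "integrable (count_space A) f")
  case True
  then have "Infinite_Set_Sum.abs_summable_on f A" by (simp add: Infinite_Set_Sum.abs_summable_on_def)
  then have "infsum f A = infsetsum f A" by (rule infsetsum_infsum[symmetric])
  also have "\<dots> = (\<integral>x. f x \<partial>count_space A)" by (simp add: infsetsum_def)
  also have "\<dots> = enn2real (\<integral>\<^sup>+x. ennreal (f x) \<partial>count_space A)"
    by (rule integral_eq_nn_integral) (auto simp: AE_count_space nn)
  finally show ?thesis .
next
  case False
  then have "\<not> Infinite_Set_Sum.abs_summable_on f A" by (simp add: Infinite_Set_Sum.abs_summable_on_def)
  then have "\<not> f summable_on A"
    using summable_on_iff_abs_summable_on_real abs_summable_equivalent by blast
  then have "infsum f A = 0" by (rule infsum_not_exists)
  moreover have "(\<integral>\<^sup>+x. ennreal (f x) \<partial>count_space A) = \<infinity>"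
  proof (rule ccontr)
    assume "(\<integral>\<^sup>+x. ennreal (f x) \<partial>count_space A) \<noteq> \<infinity>"
    then have "integrable (count_space A) f"
      by (intro integrableI_nonneg) (auto simp: AE_count_space nn less_top)
    then show False using False by simp
  qed
  ultimately show ?thesis by simp
qed

definition point_sum :: "('w \<Rightarrow> 'l set) \<Rightarrow> ('l \<Rightarrow> ennreal) \<Rightarrow> 'w \<Rightarrow> ennreal" where
  "point_sum \<L> f \<omega> = (\<integral>\<^sup>+l. f l \<partial>count_space (\<L> \<omega>))"

lemma point_sum_indicator: "point_sum \<L> (indicator A) \<omega> = count_in \<L> A \<omega>"
proof -
  have "point_sum \<L> (indicator A) \<omega> = (\<integral>\<^sup>+l. indicator A l * indicator (\<L> \<omega>) l \<partial>count_space UNIV)"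
    unfolding point_sum_def by (rule nn_integral_count_space_indicator) simp
  also have "\<dots> = (\<integral>\<^sup>+l. indicator (\<L> \<omega> \<inter> A) l \<partial>count_space UNIV)"
    by (intro nn_integral_cong) (auto simp: indicator_def)
  also have "\<dots> = count_in \<L> A \<omega>" by (simp add: count_in_def)
  finally show ?thesis .
qed

lemma poisson_processD:
  assumes "poisson_process P M \<L>"
  shows "prob_space P" "\<omega> \<in> space P \<Longrightarrow> \<L> \<omega> \<subseteq> space M"
    "A \<in> sets M \<Longrightarrow> count_in \<L> A \<in> borel_measurable P"
    "A \<in> sets M \<Longrightarrow> emeasure M A < \<infinity> \<Longrightarrow> measure P {\<omega>\<in>space P. count_in \<L> A \<omega> = of_nat n} =
       measure M A ^ n / fact n * exp (- measure M A)"
    "B ` {..<m} \<subseteq> sets M \<Longrightarrow> disjoint_family_on B {..<m} \<Longrightarrow>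
        prob_space.indep_vars P (\<lambda>_. borel) (\<lambda>i. count_in \<L> (B i)) {..<m::nat}"
  using assms unfolding poisson_process_def by blast+

text \<open>Counting functions are measurable by definition of a Poisson process; sums over the points of
  other functions are limits of combinations of these.\<close>

lemma measurable_point_sum:
  assumes PP: "poisson_process P M \<L>" and f: "f \<in> borel_measurable M"
  shows "point_sum \<L> f \<in> borel_measurable P"
  using f
proof (induction rule: borel_measurable_induct)
  case (cong f g)
  have "point_sum \<L> f \<omega> = point_sum \<L> g \<omega>" if "\<omega> \<in> space P" for \<omega>
    unfolding point_sum_def using poisson_processD(2)[OF PP that] cong(3) by (intro nn_integral_cong) auto
  then show ?case using cong(4) by (simp cong: measurable_cong)
next
  case (set A)
  then show ?case
    unfolding point_sum_indicator[abs_def] using poisson_processD(3)[OF PP, of A]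
    by (simp add: point_sum_indicator cong: measurable_cong)
next
  case (mult u c)
  have "point_sum \<L> (\<lambda>x. c * u x) = (\<lambda>\<omega>. c * point_sum \<L> u \<omega>)"
    by (auto simp: point_sum_def nn_integral_cmult)
  then show ?case using mult by simp
next
  case (add u v)
  have "point_sum \<L> (\<lambda>x. v x + u x) = (\<lambda>\<omega>. point_sum \<L> v \<omega> + point_sum \<L> u \<omega>)"
    by (auto simp: point_sum_def nn_integral_add)
  then show ?case using add by simp
next
  case (seq U)
  have "point_sum \<L> (\<lambda>x. SUP i. U i x) = (\<lambda>\<omega>. SUP i. point_sum \<L> (U i) \<omega>)"
    unfolding point_sum_def using seq(3) by (intro ext nn_integral_monotone_convergence_SUP) auto
  moreover have "(SUP i. U i) = (\<lambda>x. SUP i. U i x)" by (auto simp: image_comp)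
  ultimately show ?case using seq by simp
qed

text \<open>The Poisson probabilities add up to 1, so the count is almost surely a natural number.\<close>

lemma nn_integral_count_in:
  assumes PP: "poisson_process P M \<L>" and A: "A \<in> sets M" "emeasure M A < \<infinity>"
  shows "(\<integral>\<^sup>+\<omega>. h (count_in \<L> A \<omega>) \<partial>P) =
     (\<Sum>n. h (of_nat n) * ennreal (measure M A ^ n / fact n * exp (- measure M A)))"
    and "AE \<omega> in P. count_in \<L> A \<omega> < \<infinity>"
proof -
  interpret prob_space P by (rule poisson_processD(1)[OF PP])
  define r where "r = measure M A"
  have [measurable]: "count_in \<L> A \<in> borel_measurable P" by (rule poisson_processD(3)[OF PP A(1)])
  define E where "E n = {\<omega>\<in>space P. count_in \<L> A \<omega> = of_nat n}" for n :: nat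
  have Em [measurable]: "E n \<in> sets P" for n unfolding E_def by measurable
  have PE: "measure P (E n) = r ^ n / fact n * exp (- r)" for n
    unfolding E_def r_def by (rule poisson_processD(4)[OF PP A])
  have disj: "disjoint_family E" by (auto simp: disjoint_family_on_def E_def)
  have "(\<lambda>n. measure P (E n)) sums measure P (\<Union>n. E n)"
    by (rule finite_measure_UNION[OF _ disj]) auto
  moreover have "(\<lambda>n. measure P (E n)) sums (exp r * exp (- r))"
    unfolding PE using sums_mult2[OF exp_converges[of r], of "exp (- r)"]
    by (simp add: divide_inverse mult_ac)
  ultimately have "measure P (\<Union>n. E n) = 1" by (simp add: sums_iff exp_minus)
  then have ae: "AE \<omega> in P. \<omega> \<in> (\<Union>n. E n)" by (intro AE_prob_1)
  then show "AE \<omega> in P. count_in \<L> A \<omega> < \<infinity>"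
    by eventually_elim (auto simp: E_def of_nat_less_top)
  have "(\<integral>\<^sup>+\<omega>. h (count_in \<L> A \<omega>) \<partial>P) = (\<integral>\<^sup>+\<omega>. (\<Sum>n. h (of_nat n) * indicator (E n) \<omega>) \<partial>P)"
  proof (rule nn_integral_cong_AE, use ae in eventually_elim)
    fix \<omega> assume "\<omega> \<in> (\<Union>n. E n)"
    then obtain m where m: "\<omega> \<in> E m" by auto
    then have cm: "count_in \<L> A \<omega> = of_nat m" by (simp add: E_def)
    have "(\<Sum>n. h (of_nat n) * indicator (E n) \<omega>) = (\<Sum>n. if n = m then h (of_nat m) else 0)"
      using m by (intro suminf_cong) (auto simp: indicator_def E_def)
    also have "\<dots> = h (of_nat m)" using suminf_finite[of "{m}" "\<lambda>n. if n = m then h (of_nat m) else 0"] by simp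
    finally show "h (count_in \<L> A \<omega>) = (\<Sum>n. h (of_nat n) * indicator (E n) \<omega>)" by (simp add: cm)
  qed
  also have "\<dots> = (\<Sum>n. h (of_nat n) * emeasure P (E n))"
    by (simp add: nn_integral_suminf nn_integral_cmult_indicator)
  finally show "(\<integral>\<^sup>+\<omega>. h (count_in \<L> A \<omega>) \<partial>P) =
     (\<Sum>n. h (of_nat n) * ennreal (measure M A ^ n / fact n * exp (- measure M A)))"
    by (simp add: emeasure_eq_measure PE r_def)
qed

lemma expectation_count_in:
  assumes PP: "poisson_process P M \<L>" and A: "A \<in> sets M" "emeasure M A < \<infinity>"
  shows "(\<integral>\<^sup>+\<omega>. count_in \<L> A \<omega> \<partial>P) = emeasure M A"
proof -
  define r where "r = measure M A"
  have "(\<lambda>n. real (Suc n) * (r ^ Suc n / fact (Suc n) * exp (- r))) sums (r * (exp r * exp (- r)))"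
  proof -
    have "real (Suc n) * (r ^ Suc n / fact (Suc n) * exp (- r)) = r * ((r ^ n /\<^sub>R fact n) * exp (- r))" for n
      by (simp add: divide_inverse del: of_nat_Suc)
    then show ?thesis using sums_mult[OF sums_mult2[OF exp_converges[of r], of "exp (- r)"], of r] by simp
  qed
  then have s: "(\<lambda>n. real n * (r ^ n / fact n * exp (- r))) sums r"
    by (subst (asm) sums_Suc_iff) (simp add: exp_minus)
  have "(\<integral>\<^sup>+\<omega>. count_in \<L> A \<omega> \<partial>P) = (\<Sum>n. of_nat n * ennreal (r ^ n / fact n * exp (- r)))"
    unfolding r_def using nn_integral_count_in(1)[OF PP A, of "\<lambda>x. x"] .
  also have "\<dots> = (\<Sum>n. ennreal (real n * (r ^ n / fact n * exp (- r))))"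
    by (intro suminf_cong) (simp add: ennreal_of_nat_eq_real_of_nat ennreal_mult'[symmetric])
  also have "\<dots> = ennreal r"
    using s by (intro suminf_ennreal_eq) (auto simp: r_def)
  also have "\<dots> = emeasure M A" using A by (simp add: r_def emeasure_eq_ennreal_measure less_top)
  finally show ?thesis .
qed

lemma laplace_count_in:
  assumes PP: "poisson_process P M \<L>" and A: "A \<in> sets M" "emeasure M A < \<infinity>"
  shows "(\<integral>\<omega>. exp (- (c * enn2real (count_in \<L> A \<omega>))) \<partial>P) = exp (- ((1 - exp (- c)) * measure M A))"
proof -
  define r where "r = measure M A"
  have [measurable]: "count_in \<L> A \<in> borel_measurable P" by (rule poisson_processD(3)[OF PP A(1)])
  have "(\<lambda>n. (r * exp (- c)) ^ n /\<^sub>R fact n * exp (- r)) sums (exp (r * exp (- c)) * exp (- r))"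
    by (intro sums_mult2 exp_converges)
  moreover have "(r * exp (- c)) ^ n /\<^sub>R fact n * exp (- r) = exp (- (c * real n)) * (r ^ n / fact n * exp (- r))" for n
    by (simp add: power_mult_distrib divide_inverse mult_ac flip: exp_of_nat_mult)
  ultimately have s: "(\<lambda>n. exp (- (c * real n)) * (r ^ n / fact n * exp (- r))) sums (exp (r * exp (- c)) * exp (- r))"
    by simp
  have "(\<integral>\<omega>. exp (- (c * enn2real (count_in \<L> A \<omega>))) \<partial>P) = enn2real (\<integral>\<^sup>+\<omega>. ennreal (exp (- (c * enn2real (count_in \<L> A \<omega>)))) \<partial>P)"
    by (intro integral_eq_nn_integral) auto
  also have "(\<integral>\<^sup>+\<omega>. ennreal (exp (- (c * enn2real (count_in \<L> A \<omega>)))) \<partial>P) =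
     (\<Sum>n. ennreal (exp (- (c * enn2real (of_nat n)))) * ennreal (r ^ n / fact n * exp (- r)))"
    unfolding r_def by (rule nn_integral_count_in(1)[OF PP A])
  also have "\<dots> = (\<Sum>n. ennreal (exp (- (c * real n)) * (r ^ n / fact n * exp (- r))))"
    by (intro suminf_cong) (simp add: ennreal_of_nat_eq_real_of_nat ennreal_mult'[symmetric])
  also have "\<dots> = ennreal (exp (r * exp (- c)) * exp (- r))"
    using s by (intro suminf_ennreal_eq) (auto simp: r_def)
  finally show ?thesis by (simp add: r_def algebra_simps flip: exp_add)
qed

lemma simple_function_level_sets:
  assumes g: "simple_function M g" and fin: "(\<integral>\<^sup>+l. g l \<partial>M) < \<infinity>"
  shows "finite (g ` space M - {0})" "\<And>y. g -` {y} \<inter> space M \<in> sets M"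
    "\<And>y. y \<noteq> 0 \<Longrightarrow> emeasure M (g -` {y} \<inter> space M) < \<infinity>"
    "\<And>l. l \<in> space M \<Longrightarrow> g l = (\<Sum>y\<in>g ` space M - {0}. y * indicator (g -` {y} \<inter> space M) l)"
proof -
  show f: "finite (g ` space M - {0})" using simple_functionD(1)[OF g] by simp
  show m: "g -` {y} \<inter> space M \<in> sets M" for y by (rule simple_functionD(2)[OF g])
  show "g l = (\<Sum>y\<in>g ` space M - {0}. y * indicator (g -` {y} \<inter> space M) l)" if "l \<in> space M" for l
    using simple_function_indicator_representation[OF g that] simple_functionD(1)[OF g]
    by (subst sum.mono_neutral_left[of "g ` space M"]) auto
  show "emeasure M (g -` {y} \<inter> space M) < \<infinity>" if y: "y \<noteq> 0" for y
  proof -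
    have "y * emeasure M (g -` {y} \<inter> space M) = (\<integral>\<^sup>+l. y * indicator (g -` {y} \<inter> space M) l \<partial>M)"
      using m by (simp add: nn_integral_cmult_indicator)
    also have "\<dots> \<le> (\<integral>\<^sup>+l. g l \<partial>M)"
      by (intro nn_integral_mono) (auto simp: indicator_def)
    finally have "y * emeasure M (g -` {y} \<inter> space M) < \<infinity>" using fin by (rule le_less_trans)
    then show ?thesis using y by (auto simp: ennreal_mult_less_top less_top)
  qed
qed

lemma point_sum_simple:
  assumes PP: "poisson_process P M \<L>"
    and g: "simple_function M g" and fin: "(\<integral>\<^sup>+l. g l \<partial>M) < \<infinity>" and \<omega>: "\<omega> \<in> space P"
  shows "point_sum \<L> g \<omega> = (\<Sum>y\<in>g ` space M - {0}. y * count_in \<L> (g -` {y} \<inter> space M) \<omega>)"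
proof -
  let ?A = "\<lambda>y. g -` {y} \<inter> space M"
  have "point_sum \<L> g \<omega> = (\<integral>\<^sup>+l. (\<Sum>y\<in>g ` space M - {0}. y * indicator (?A y) l) \<partial>count_space (\<L> \<omega>))"
    unfolding point_sum_def using poisson_processD(2)[OF PP \<omega>]
    by (intro nn_integral_cong simple_function_level_sets(4)[OF g fin]) auto
  also have "\<dots> = (\<Sum>y\<in>g ` space M - {0}. y * point_sum \<L> (indicator (?A y)) \<omega>)"
    unfolding point_sum_def by (simp add: nn_integral_sum nn_integral_cmult)
  finally show ?thesis by (simp add: point_sum_indicator)
qed

lemma campbell_simple:
  assumes PP: "poisson_process P M \<L>" and g: "simple_function M g" and fin: "(\<integral>\<^sup>+l. g l \<partial>M) < \<infinity>"
  shows "(\<integral>\<^sup>+\<omega>. point_sum \<L> g \<omega> \<partial>P) = (\<integral>\<^sup>+l. g l \<partial>M)"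
proof -
  let ?A = "\<lambda>y. g -` {y} \<inter> space M"
  let ?Y = "g ` space M - {0}"
  note L = simple_function_level_sets[OF g fin]
  have [measurable]: "count_in \<L> (?A y) \<in> borel_measurable P" for y
    by (rule poisson_processD(3)[OF PP L(2)])
  have "(\<integral>\<^sup>+\<omega>. point_sum \<L> g \<omega> \<partial>P) = (\<integral>\<^sup>+\<omega>. (\<Sum>y\<in>?Y. y * count_in \<L> (?A y) \<omega>) \<partial>P)"
    by (intro nn_integral_cong point_sum_simple[OF PP g fin])
  also have "\<dots> = (\<Sum>y\<in>?Y. y * (\<integral>\<^sup>+\<omega>. count_in \<L> (?A y) \<omega> \<partial>P))"
    by (simp add: nn_integral_sum nn_integral_cmult)
  also have "\<dots> = (\<Sum>y\<in>?Y. y * emeasure M (?A y))"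
    by (intro sum.cong refl) (simp add: expectation_count_in[OF PP L(2) L(3)])
  also have "\<dots> = (\<integral>\<^sup>+l. (\<Sum>y\<in>?Y. y * indicator (?A y) l) \<partial>M)"
    using L(2) by (simp add: nn_integral_sum nn_integral_cmult_indicator)
  also have "\<dots> = (\<integral>\<^sup>+l. g l \<partial>M)"
    by (intro nn_integral_cong L(4)[symmetric])
  finally show ?thesis .
qed

lemma simple_approximation_finite_integral:
  fixes f :: "'a \<Rightarrow> ennreal"
  assumes f: "f \<in> borel_measurable M" and fin: "(\<integral>\<^sup>+l. f l \<partial>M) < \<infinity>"
  obtains g :: "nat \<Rightarrow> 'a \<Rightarrow> ennreal" where "\<And>i. simple_function M (g i)" "\<And>i j x. i \<le> j \<Longrightarrow> g i x \<le> g j x" "\<And>i x. g i x < top"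
    "\<And>x. (SUP i. g i x) = f x" "\<And>i x. g i x \<le> f x" "\<And>i. (\<integral>\<^sup>+l. g i l \<partial>M) < \<infinity>"
proof -
  obtain g where g: "\<And>i. simple_function M (g i)" "incseq g" "\<And>i x. g i x < top" "\<And>x. (SUP i. g i x) = f x"
    using borel_measurable_implies_simple_function_sequence'[OF f] by blast
  have le: "g i x \<le> f x" for i x unfolding g(4)[symmetric] by (rule SUP_upper) simp
  show ?thesis
  proof (rule that[OF g(1) _ g(3,4) le])
    show "g i x \<le> g j x" if "i \<le> j" for i j x using g(2) that by (auto simp: incseq_def le_fun_def)
    show "(\<integral>\<^sup>+l. g i l \<partial>M) < \<infinity>" for i
      by (rule le_less_trans[OF nn_integral_mono fin]) (rule le)
  qed
qed

lemma point_sum_SUP: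
  fixes g :: "nat \<Rightarrow> 'l \<Rightarrow> ennreal"
  assumes "\<And>i j x. i \<le> j \<Longrightarrow> g i x \<le> g j x" "\<And>x. (SUP i. g i x) = f x"
  shows "point_sum \<L> f \<omega> = (SUP i. point_sum \<L> (g i) \<omega>)"
  unfolding point_sum_def assms(2)[symmetric]
  by (intro nn_integral_monotone_convergence_SUP) (auto simp: incseq_def le_fun_def assms(1))

text \<open>Only sets of finite intensity have a Poisson count, so the intensity of \<open>f\<close> is required to be
  finite: then so are the intensities of all level sets, at nonzero levels, of the simple functions
  below \<open>f\<close>.\<close>

lemma campbell:
  assumes PP: "poisson_process P M \<L>" and f: "f \<in> borel_measurable M" and fin: "(\<integral>\<^sup>+l. f l \<partial>M) < \<infinity>"
  shows "(\<integral>\<^sup>+\<omega>. point_sum \<L> f \<omega> \<partial>P) = (\<integral>\<^sup>+l. f l \<partial>M)"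
proof -
  obtain g :: "nat \<Rightarrow> _ \<Rightarrow> ennreal" where g: "\<And>i. simple_function M (g i)" and inc: "\<And>i j x. i \<le> j \<Longrightarrow> g i x \<le> g j x"
    and sup: "\<And>x. (SUP i. g i x) = f x" and gf: "\<And>i. (\<integral>\<^sup>+l. g i l \<partial>M) < \<infinity>"
    by (rule simple_approximation_finite_integral[OF f fin]) (rule that)
  have "(\<integral>\<^sup>+\<omega>. point_sum \<L> f \<omega> \<partial>P) = (\<integral>\<^sup>+\<omega>. (SUP i. point_sum \<L> (g i) \<omega>) \<partial>P)"
    by (simp only: point_sum_SUP[OF inc sup])
  also have "\<dots> = (SUP i. \<integral>\<^sup>+\<omega>. point_sum \<L> (g i) \<omega> \<partial>P)"
    by (intro nn_integral_monotone_convergence_SUP measurable_point_sum[OF PP] borel_measurable_simple_function g)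
       (auto simp: incseq_def le_fun_def point_sum_def intro!: nn_integral_mono inc)
  also have "\<dots> = (SUP i. \<integral>\<^sup>+l. g i l \<partial>M)" by (simp add: campbell_simple[OF PP g gf])
  also have "\<dots> = (\<integral>\<^sup>+l. (SUP i. g i l) \<partial>M)"
    by (intro nn_integral_monotone_convergence_SUP[symmetric] borel_measurable_simple_function g)
       (auto simp: incseq_def le_fun_def inc)
  finally show ?thesis by (simp add: sup)
qed

lemma point_sum_finite_AE:
  assumes PP: "poisson_process P M \<L>" and f: "f \<in> borel_measurable M" and fin: "(\<integral>\<^sup>+l. f l \<partial>M) < \<infinity>"
  shows "AE \<omega> in P. point_sum \<L> f \<omega> < \<infinity>"
proof -
  have "AE \<omega> in P. point_sum \<L> f \<omega> \<noteq> \<infinity>"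
    using fin by (intro nn_integral_PInf_AE measurable_point_sum[OF PP f]) (simp add: campbell[OF PP f fin])
  then show ?thesis by (simp add: less_top)
qed

text \<open>The counts of the finitely many level sets at nonzero levels are independent and Poisson, so
  the expectation factorises into the transforms of \<open>laplace_count_in\<close>.\<close>

lemma laplace_functional_simple:
  assumes PP: "poisson_process P M \<L>" and g: "simple_function M g" and fin: "(\<integral>\<^sup>+l. g l \<partial>M) < \<infinity>"
    and top: "\<And>l. g l < top"
  shows "(\<integral>\<omega>. exp (- enn2real (point_sum \<L> g \<omega>)) \<partial>P) = exp (- (\<integral>l. 1 - exp (- enn2real (g l)) \<partial>M))"
proof -
  interpret prob_space P by (rule poisson_processD(1)[OF PP])
  note L = simple_function_level_sets[OF g fin]
  let ?Y = "g ` space M - {0}"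
  \<comment> \<open>Independence of the counts is given for sets indexed by natural numbers.\<close>
  obtain e where e: "bij_betw e {..<card ?Y} ?Y"
    using ex_bij_betw_nat_finite[OF L(1)] by (auto simp: atLeast0LessThan)
  define m where "m = card ?Y"
  define A where "A i = g -` {e i} \<inter> space M" for i
  define c where "c i = enn2real (e i)" for i
  let ?X = "\<lambda>i \<omega>. exp (- (c i * enn2real (count_in \<L> (A i) \<omega>)))"
  have eY: "e i \<in> ?Y" if "i < m" for i using e that by (auto simp: bij_betw_def m_def)
  have einj: "inj_on e {..<m}" using e by (simp add: bij_betw_def m_def)
  have etop: "e i < top" if "i < m" for i using eY[OF that] top by auto
  have Am: "A i \<in> sets M" for i unfolding A_def by (rule L(2))
  have Af: "emeasure M (A i) < \<infinity>" if "i < m" for i unfolding A_def using eY[OF that] by (intro L(3)) auto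
  have disj: "disjoint_family_on A {..<m}"
    using einj by (auto simp: disjoint_family_on_def A_def inj_on_def)
  have sumY: "(\<Sum>y\<in>?Y. F y) = (\<Sum>i<m. F (e i))" for F :: "ennreal \<Rightarrow> 'c::comm_monoid_add"
    using sum.reindex_bij_betw[OF e, of F] by (simp add: m_def)
  have ind: "indep_vars (\<lambda>_. borel) (\<lambda>i. count_in \<L> (A i)) {..<m}"
    by (rule poisson_processD(5)[OF PP _ disj]) (use Am in auto)
  have ind': "indep_vars (\<lambda>_. borel) (\<lambda>i \<omega>. ?X i \<omega>) {..<m}"
    by (rule indep_vars_compose2[OF ind]) measurable
  have cm: "count_in \<L> (A i) \<in> borel_measurable P" for i by (rule poisson_processD(3)[OF PP Am])
  have fc: "AE \<omega> in P. \<forall>i<m. count_in \<L> (A i) \<omega> < \<infinity>"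
    using nn_integral_count_in(2)[OF PP Am Af] by (simp add: AE_all_countable)
  have "(\<integral>\<omega>. exp (- enn2real (point_sum \<L> g \<omega>)) \<partial>P) = (\<integral>\<omega>. (\<Prod>i<m. ?X i \<omega>) \<partial>P)"
  proof (rule integral_cong_AE)
    have "AE \<omega> in P. \<omega> \<in> space P" by simp
    with fc show "AE \<omega> in P. exp (- enn2real (point_sum \<L> g \<omega>)) = (\<Prod>i<m. ?X i \<omega>)"
    proof eventually_elim
      fix \<omega> assume f: "\<forall>i<m. count_in \<L> (A i) \<omega> < \<infinity>" and \<omega>: "\<omega> \<in> space P"
      have "point_sum \<L> g \<omega> = (\<Sum>i<m. e i * count_in \<L> (A i) \<omega>)"
        unfolding point_sum_simple[OF PP g fin \<omega>] sumY A_def ..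
      also have "enn2real \<dots> = (\<Sum>i<m. c i * enn2real (count_in \<L> (A i) \<omega>))"
        using f etop by (subst enn2real_sum) (auto simp: ennreal_mult_less_top enn2real_mult c_def)
      finally show "exp (- enn2real (point_sum \<L> g \<omega>)) = (\<Prod>i<m. ?X i \<omega>)"
        by (simp add: exp_sum flip: sum_negf)
    qed
    show "(\<lambda>\<omega>. exp (- enn2real (point_sum \<L> g \<omega>))) \<in> borel_measurable P"
      using measurable_point_sum[OF PP borel_measurable_simple_function[OF g]] by measurable
    show "(\<lambda>\<omega>. \<Prod>i<m. ?X i \<omega>) \<in> borel_measurable P"
      using cm by measurable
  qed
  also have "\<dots> = (\<Prod>i<m. \<integral>\<omega>. ?X i \<omega> \<partial>P)"
  proof (rule indep_vars_lebesgue_integral[OF _ ind'])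
    show "integrable P (\<lambda>\<omega>. ?X i \<omega>)" for i
      using cm by (intro integrable_const_bound[where B = 1]) (auto simp: c_def)
  qed simp
  also have "\<dots> = (\<Prod>i<m. exp (- ((1 - exp (- c i)) * measure M (A i))))"
    using Af by (intro prod.cong refl laplace_count_in[OF PP Am]) auto
  also have "\<dots> = exp (- (\<Sum>i<m. (1 - exp (- c i)) * measure M (A i)))"
    by (simp add: exp_sum flip: sum_negf)
  also have "(\<Sum>i<m. (1 - exp (- c i)) * measure M (A i)) = (\<integral>l. (\<Sum>i<m. (1 - exp (- c i)) * indicator (A i) l) \<partial>M)"
    using Am Af by (subst Bochner_Integration.integral_sum) auto
  also have "\<dots> = (\<integral>l. 1 - exp (- enn2real (g l)) \<partial>M)"
  proof (intro Bochner_Integration.integral_cong refl)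
    fix l assume l: "l \<in> space M"
    show "(\<Sum>i<m. (1 - exp (- c i)) * indicator (A i) l) = 1 - exp (- enn2real (g l))"
    proof (cases "g l = 0")
      case True
      have "l \<notin> A i" if "i < m" for i using eY[OF that] True by (auto simp: A_def)
      then have "(\<Sum>i<m. (1 - exp (- c i)) * indicator (A i) l) = 0" by (intro sum.neutral) auto
      then show ?thesis using True by simp
    next
      case False
      then have "g l \<in> ?Y" using l by auto
      then obtain j where j: "j < m" "g l = e j" using e by (auto simp: bij_betw_def m_def image_iff)
      have "(\<Sum>i<m. (1 - exp (- c i)) * indicator (A i) l) = (\<Sum>i<m. if i = j then 1 - exp (- c i) else 0)"
      proof (intro sum.cong refl)
        fix i assume "i \<in> {..<m}"
        then have "e i = e j \<longleftrightarrow> i = j" using inj_on_eq_iff[OF einj] j by simp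
        then have "l \<in> A i \<longleftrightarrow> i = j" using j l by (auto simp: A_def)
        then show "(1 - exp (- c i)) * indicator (A i) l = (if i = j then 1 - exp (- c i) else 0)"
          by (cases "i = j") (auto simp: indicator_def)
      qed
      then show ?thesis using j by (simp add: c_def)
    qed
  qed
  finally show ?thesis .
qed

text \<open>Monotone approximation by simple functions. The transforms on the probability space are dominated
  by 1, the integrands \<open>1 - exp (- g)\<close> by \<open>f\<close>.\<close>

lemma laplace_functional:
  assumes PP: "poisson_process P M \<L>" and f: "f \<in> borel_measurable M" and fin: "(\<integral>\<^sup>+l. f l \<partial>M) < \<infinity>"
  shows "(\<integral>\<omega>. exp (- enn2real (point_sum \<L> f \<omega>)) \<partial>P) = exp (- (\<integral>l. 1 - exp (- enn2real (f l)) \<partial>M))"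
proof -
  let ?S = "\<lambda>f \<omega>. enn2real (point_sum \<L> f \<omega>)"
  interpret prob_space P by (rule poisson_processD(1)[OF PP])
  obtain g :: "nat \<Rightarrow> _ \<Rightarrow> ennreal" where g: "\<And>i. simple_function M (g i)" and inc: "\<And>i j x. i \<le> j \<Longrightarrow> g i x \<le> g j x"
    and top: "\<And>i x. g i x < top" and sup: "\<And>x. (SUP i. g i x) = f x" and le: "\<And>i x. g i x \<le> f x"
    and gf: "\<And>i. (\<integral>\<^sup>+l. g i l \<partial>M) < \<infinity>"
    by (rule simple_approximation_finite_integral[OF f fin]) (rule that)
  have gm: "g i \<in> borel_measurable M" for i by (rule borel_measurable_simple_function[OF g])
  have lim: "(\<lambda>i. enn2real (g i l)) \<longlonglongrightarrow> enn2real (f l)" if "f l < \<infinity>" for l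
  proof (rule tendsto_enn2real)
    have "(\<lambda>i. g i l) \<longlonglongrightarrow> f l" unfolding sup[symmetric] by (rule LIMSEQ_SUP) (auto simp: incseq_def inc)
    then show "(\<lambda>i. g i l) \<longlonglongrightarrow> ennreal (enn2real (f l))" using that by simp
  qed simp
  have limp: "(\<lambda>i. ?S (g i) \<omega>) \<longlonglongrightarrow> ?S f \<omega>" if "point_sum \<L> f \<omega> < \<infinity>" for \<omega>
  proof (rule tendsto_enn2real)
    have "point_sum \<L> f \<omega> = (SUP i. point_sum \<L> (g i) \<omega>)" by (rule point_sum_SUP[OF inc sup])
    moreover have "(\<lambda>i. point_sum \<L> (g i) \<omega>) \<longlonglongrightarrow> (SUP i. point_sum \<L> (g i) \<omega>)"
      by (rule LIMSEQ_SUP) (auto simp: incseq_def point_sum_def intro!: nn_integral_mono inc)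
    ultimately show "(\<lambda>i. point_sum \<L> (g i) \<omega>) \<longlonglongrightarrow> ennreal (?S f \<omega>)" using that by simp
  qed simp
  have A1: "(\<lambda>i. \<integral>\<omega>. exp (- ?S (g i) \<omega>) \<partial>P) \<longlonglongrightarrow> (\<integral>\<omega>. exp (- ?S f \<omega>) \<partial>P)"
  proof (rule integral_dominated_convergence[where w = "\<lambda>_. 1"])
    show "AE \<omega> in P. (\<lambda>i. exp (- ?S (g i) \<omega>)) \<longlonglongrightarrow> exp (- ?S f \<omega>)"
      using point_sum_finite_AE[OF PP f fin] by eventually_elim (intro tendsto_intros limp)
    show "(\<lambda>\<omega>. exp (- ?S f \<omega>)) \<in> borel_measurable P"
      "(\<lambda>\<omega>. exp (- ?S (g i) \<omega>)) \<in> borel_measurable P" for i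
      using measurable_point_sum[OF PP f] measurable_point_sum[OF PP gm] by measurable
  qed auto
  have ffin: "AE l in M. f l < \<infinity>"
    using nn_integral_PInf_AE[OF f] fin by (auto simp: less_top)
  have A2: "(\<lambda>i. \<integral>l. 1 - exp (- enn2real (g i l)) \<partial>M) \<longlonglongrightarrow> (\<integral>l. 1 - exp (- enn2real (f l)) \<partial>M)"
  proof (rule integral_dominated_convergence[where w = "\<lambda>l. enn2real (f l)"])
    show "AE l in M. (\<lambda>i. 1 - exp (- enn2real (g i l))) \<longlonglongrightarrow> 1 - exp (- enn2real (f l))"
      using ffin by eventually_elim (intro tendsto_intros lim)
    show "AE l in M. norm (1 - exp (- enn2real (g i l))) \<le> enn2real (f l)" for i
      using ffin
    proof eventually_elim
      fix l assume "f l < \<infinity>"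
      then have "enn2real (g i l) \<le> enn2real (f l)" by (intro enn2real_mono le) simp
      moreover have "1 - exp (- enn2real (g i l)) \<le> enn2real (g i l)"
        using exp_ge_add_one_self[of "- enn2real (g i l)"] by simp
      ultimately show "norm (1 - exp (- enn2real (g i l))) \<le> enn2real (f l)" by simp
    qed
    show "integrable M (\<lambda>l. enn2real (f l))"
    proof (rule integrableI_nonneg)
      have "(\<integral>\<^sup>+l. ennreal (enn2real (f l)) \<partial>M) \<le> (\<integral>\<^sup>+l. f l \<partial>M)"
        by (intro nn_integral_mono) (simp add: ennreal_enn2real_if)
      then show "(\<integral>\<^sup>+l. ennreal (enn2real (f l)) \<partial>M) < \<infinity>" using fin by (rule le_less_trans)
    qed (use f in auto)
  qed (use f gm in auto)
  have "(\<lambda>i. \<integral>\<omega>. exp (- ?S (g i) \<omega>) \<partial>P) \<longlonglongrightarrow> exp (- (\<integral>l. 1 - exp (- enn2real (f l)) \<partial>M))"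
    unfolding laplace_functional_simple[OF PP g gf top] by (intro tendsto_intros A2)
  with A1 show ?thesis by (rule LIMSEQ_unique)
qed

section \<open>The occupation field of the loop process\<close>

lemma loop_of_mem: "l \<in> space loop_space \<Longrightarrow> \<exists>\<gamma>\<in>paths. l = loop_of \<gamma>"
  by (auto simp: space_loop_space quotient_def loop_of_def)

lemma loop_occupation_orthant: "l \<in> space loop_space \<Longrightarrow> loop_occupation l \<in> orthant"
  using loop_of_mem[of l] by (auto simp: loop_occupation_loop_of occupation_orthant)

lemma measurable_loop_occupation [measurable]: "loop_occupation \<in> loop_space \<rightarrow>\<^sub>M borel"
proof (rule measurableI)
  fix B :: "(real^'a) set" assume B: "B \<in> sets borel"
  let ?A = "loop_occupation -` B \<inter> space loop_space"
  have "loop_of -` ?A \<inter> paths = occupation -` B \<inter> space path_space"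
  proof -
    have "loop_of \<gamma> \<in> space loop_space" if "\<gamma> \<in> paths" for \<gamma> :: "('a \<times> real) list"
      using that by (simp add: space_loop_space loop_of_def quotientI)
    then show ?thesis by (auto simp: loop_occupation_loop_of)
  qed
  also have "\<dots> \<in> sets path_space" by (rule measurable_sets[OF measurable_occupation B])
  finally show "?A \<in> sets loop_space"
    unfolding loop_space_def
    by (subst sets_measure_of) (auto simp: loop_space_def[symmetric] space_loop_space intro!: sigma_sets.Basic)
qed simp

lemma sets_loop_measure [simp]: "sets (loop_measure C \<kappa>) = sets loop_space"
  and space_loop_measure [simp]: "space (loop_measure C \<kappa>) = space loop_space"
  by (simp_all add: loop_measure_def)

lemma measurable_loop_of': "loop_of \<in> based_loop_measure C \<kappa> \<rightarrow>\<^sub>M loop_space"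
  using measurable_loop_of by (simp cong: measurable_cong_sets)

lemma nn_integral_loop_linear:
  assumes net: "network C \<kappa>" and \<theta>: "\<theta> \<in> orthant"
  shows "(\<integral>\<^sup>+l. ennreal (\<theta> \<bullet> loop_occupation l) \<partial>loop_measure C \<kappa>) < \<infinity>"
proof -
  have "(\<integral>\<^sup>+l. ennreal (\<theta> \<bullet> loop_occupation l) \<partial>loop_measure C \<kappa>) =
      (\<integral>\<^sup>+\<gamma>. ennreal (\<theta> \<bullet> loop_occupation (loop_of \<gamma>)) \<partial>based_loop_measure C \<kappa>)"
    unfolding loop_measure_def by (rule nn_integral_distr[OF measurable_loop_of']) simp
  also have "\<dots> = (\<integral>\<^sup>+\<gamma>. ennreal (\<theta> \<bullet> occupation \<gamma>) \<partial>based_loop_measure C \<kappa>)"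
    by (intro nn_integral_cong) (simp add: loop_occupation_loop_of)
  also have "\<dots> < \<infinity>"
  proof -
    have "integrable (based_loop_measure C \<kappa>) (\<lambda>\<gamma>. \<theta> \<bullet> occupation \<gamma>)"
      using integrable.intros[OF based_loop_linear[OF net \<theta> zero_in_orthant]] by simp
    then have "(\<integral>\<^sup>+\<gamma>. ennreal (norm (\<theta> \<bullet> occupation \<gamma>)) \<partial>based_loop_measure C \<kappa>) < \<infinity>"
      by (simp add: integrable_iff_bounded)
    moreover have "(\<integral>\<^sup>+\<gamma>. ennreal (norm (\<theta> \<bullet> occupation \<gamma>)) \<partial>based_loop_measure C \<kappa>) =
        (\<integral>\<^sup>+\<gamma>. ennreal (\<theta> \<bullet> occupation \<gamma>) \<partial>based_loop_measure C \<kappa>)"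
      by (intro nn_integral_cong) (simp add: inner_orthant_nonneg[OF \<theta> occupation_orthant])
    ultimately show ?thesis by simp
  qed
  finally show ?thesis .
qed

lemma total_occupation_eq:
  assumes "\<L> \<omega> \<subseteq> space loop_space"
  shows "total_occupation (\<L> \<omega>) $ x = enn2real (point_sum \<L> (\<lambda>l. ennreal (loop_occupation l $ x)) \<omega>)"
  unfolding total_occupation_def point_sum_def vec_lambda_beta
  using loop_occupation_orthant assms by (intro infsum_eq_nn_integral) (auto simp: orthant_def)

lemma total_occupation_orthant:
  assumes "poisson_process P (loop_measure C \<kappa>) \<L>" "\<omega> \<in> space P"
  shows "total_occupation (\<L> \<omega>) \<in> orthant"
  using poisson_processD(2)[OF assms] by (simp add: orthant_def total_occupation_eq)

lemma measurable_total_occupation: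
  assumes PP: "poisson_process P (loop_measure C \<kappa>) \<L>"
  shows "(\<lambda>\<omega>. total_occupation (\<L> \<omega>)) \<in> borel_measurable P"
proof (rule borel_measurable_vec)
  fix x
  have "(\<lambda>l. ennreal (loop_occupation l $ x)) \<in> borel_measurable (loop_measure C \<kappa>)"
    by (subst measurable_cong_sets[OF sets_loop_measure refl]) measurable
  from measurable_point_sum[OF PP this]
  have "(\<lambda>\<omega>. enn2real (point_sum \<L> (\<lambda>l. ennreal (loop_occupation l $ x)) \<omega>)) \<in> borel_measurable P"
    by measurable
  then show "(\<lambda>\<omega>. total_occupation (\<L> \<omega>) $ x) \<in> borel_measurable P"
    by (rule measurable_cong[THEN iffD1, rotated])
       (use poisson_processD(2)[OF PP] in \<open>simp add: total_occupation_eq\<close>)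
qed

text \<open>The Laplace functional of the loop process at \<open>\<langle>\<theta>, loop_occupation l\<rangle>\<close>. By
  Campbell's formula every \<open>point_sum\<close> of an occupation field is almost surely finite, so the
  convention for divergent sums in \<open>total_occupation\<close> only acts on a null event.\<close>

lemma laplace_total_occupation:
  assumes net: "network C \<kappa>" and PP: "poisson_process P (loop_measure C \<kappa>) \<L>" and \<theta>: "\<theta> \<in> orthant"
  shows "(\<integral>\<omega>. exp (- (\<theta> \<bullet> total_occupation (\<L> \<omega>))) \<partial>P) =
    exp (- (\<integral>\<gamma>. 1 - exp (- (\<theta> \<bullet> occupation \<gamma>)) \<partial>based_loop_measure C \<kappa>))"
proof -
  let ?M = "loop_measure C \<kappa>"
  let ?o = "\<lambda>x l. ennreal (loop_occupation l $ x)"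
  let ?f = "\<lambda>l. ennreal (\<theta> \<bullet> loop_occupation l)"
  have th: "0 \<le> \<theta> $ x" for x using \<theta> by (simp add: orthant_def)
  have lm: "(\<lambda>l. ennreal (\<eta> \<bullet> loop_occupation l)) \<in> borel_measurable ?M" for \<eta>
    by (subst measurable_cong_sets[OF sets_loop_measure refl]) measurable
  have ax: "axis x 1 \<in> orthant" "axis x 1 \<bullet> u = u $ x" for x :: 'a and u :: "real^'a"
    by (simp add: orthant_def axis_def) (simp add: inner_axis')
  have fx: "AE \<omega> in P. \<forall>x. point_sum \<L> (?o x) \<omega> < \<infinity>"
    unfolding AE_all_countable
    using point_sum_finite_AE[OF PP lm nn_integral_loop_linear[OF net ax(1)]] by (simp add: ax(2))
  have "AE \<omega> in P. \<theta> \<bullet> total_occupation (\<L> \<omega>) = enn2real (point_sum \<L> ?f \<omega>)"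
    using fx AE_space
  proof eventually_elim
    fix \<omega> assume f: "\<forall>x. point_sum \<L> (?o x) \<omega> < \<infinity>" and \<omega>: "\<omega> \<in> space P"
    have sub: "\<L> \<omega> \<subseteq> space loop_space" using poisson_processD(2)[OF PP \<omega>] by simp
    have nn: "0 \<le> loop_occupation l $ x" if "l \<in> \<L> \<omega>" for l x
      using loop_occupation_orthant sub that by (auto simp: orthant_def)
    have "point_sum \<L> ?f \<omega> =
        (\<integral>\<^sup>+l. (\<Sum>x\<in>UNIV. ennreal (\<theta> $ x) * ennreal (loop_occupation l $ x)) \<partial>count_space (\<L> \<omega>))"
      unfolding point_sum_def
      by (intro nn_integral_cong) (simp add: inner_vec_def ennreal_mult'[symmetric] sum_ennreal nn th)
    also have "\<dots> = (\<Sum>x\<in>UNIV. ennreal (\<theta> $ x) * point_sum \<L> (?o x) \<omega>)"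
      by (simp add: point_sum_def nn_integral_sum nn_integral_cmult)
    also have "enn2real \<dots> = (\<Sum>x\<in>UNIV. \<theta> $ x * total_occupation (\<L> \<omega>) $ x)"
      using f th by (subst enn2real_sum) (auto simp: ennreal_mult_less_top enn2real_mult total_occupation_eq[of \<L> \<omega>] sub)
    finally show "\<theta> \<bullet> total_occupation (\<L> \<omega>) = enn2real (point_sum \<L> ?f \<omega>)"
      by (simp add: inner_vec_def)
  qed
  then have "(\<integral>\<omega>. exp (- (\<theta> \<bullet> total_occupation (\<L> \<omega>))) \<partial>P) =
      (\<integral>\<omega>. exp (- enn2real (point_sum \<L> ?f \<omega>)) \<partial>P)"
    using measurable_total_occupation[OF PP] measurable_point_sum[OF PP lm]
    by (intro integral_cong_AE) auto
  also have "\<dots> = exp (- (\<integral>l. 1 - exp (- enn2real (ennreal (\<theta> \<bullet> loop_occupation l))) \<partial>?M))"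
    by (rule laplace_functional[OF PP lm nn_integral_loop_linear[OF net \<theta>]])
  also have "(\<integral>l. 1 - exp (- enn2real (ennreal (\<theta> \<bullet> loop_occupation l))) \<partial>?M) =
     (\<integral>\<gamma>. 1 - exp (- enn2real (ennreal (\<theta> \<bullet> loop_occupation (loop_of \<gamma>)))) \<partial>based_loop_measure C \<kappa>)"
    unfolding loop_measure_def by (rule integral_distr[OF measurable_loop_of']) measurable
  also have "\<dots> = (\<integral>\<gamma>. 1 - exp (- (\<theta> \<bullet> occupation \<gamma>)) \<partial>based_loop_measure C \<kappa>)"
    by (intro Bochner_Integration.integral_cong refl)
       (simp add: loop_occupation_loop_of inner_orthant_nonneg[OF \<theta> occupation_orthant])
  finally show ?thesis .
qed

section \<open>The isomorphism\<close>

lemma bounded_pointwise_continuous_integral: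
  fixes T :: "'w \<Rightarrow> 'a::topological_space" and D :: "'w \<Rightarrow> 'b::{banach, second_countable_topology}"
  assumes T [measurable]: "T \<in> borel_measurable M" and D: "integrable M D"
  shows "bounded_pointwise_continuous (\<lambda>F. \<integral>\<omega>. F (T \<omega>) *\<^sub>R D \<omega> \<partial>M)"
proof -
  have Dm [measurable]: "D \<in> borel_measurable M" using D by auto
  have int: "integrable M (\<lambda>\<omega>. F (T \<omega>) *\<^sub>R D \<omega>)" if F: "bounded_borel F" for F
  proof -
    have [measurable]: "F \<in> borel_measurable borel" using F by (simp add: bounded_borel_def)
    obtain B where B: "\<And>u. \<bar>F u\<bar> \<le> B" using F by (auto simp: bounded_borel_def bounded_iff)
    show ?thesis
    proof (rule Bochner_Integration.integrable_bound[OF integrable_mult_right[OF integrable_norm[OF D], of B]])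
      show "AE \<omega> in M. norm (F (T \<omega>) *\<^sub>R D \<omega>) \<le> norm (B * norm (D \<omega>))"
        using B by (intro AE_I2) (auto simp: abs_mult intro!: mult_right_mono order_trans[OF B])
    qed simp
  qed
  show ?thesis
    unfolding bounded_pointwise_continuous_def
  proof (intro conjI allI impI)
    fix F G :: "'a \<Rightarrow> real" assume "bounded_borel F" "bounded_borel G"
    then show "(\<integral>\<omega>. (F (T \<omega>) + G (T \<omega>)) *\<^sub>R D \<omega> \<partial>M) = (\<integral>\<omega>. F (T \<omega>) *\<^sub>R D \<omega> \<partial>M) + (\<integral>\<omega>. G (T \<omega>) *\<^sub>R D \<omega> \<partial>M)"
      by (simp add: scaleR_add_left int)
  next
    fix c and F :: "'a \<Rightarrow> real"
    show "(\<integral>\<omega>. (c * F (T \<omega>)) *\<^sub>R D \<omega> \<partial>M) = c *\<^sub>R (\<integral>\<omega>. F (T \<omega>) *\<^sub>R D \<omega> \<partial>M)"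
      by (simp flip: scaleR_scaleR)
  next
    fix F and G :: "'a \<Rightarrow> real" and B assume F: "\<forall>n. bounded_borel (F n)" and B: "\<forall>n u. \<bar>F n u\<bar> \<le> B" and lim: "\<forall>u. (\<lambda>n. F n u) \<longlonglongrightarrow> G u"
    have Fm [measurable]: "F n \<in> borel_measurable borel" for n using F by (simp add: bounded_borel_def)
    have Gm [measurable]: "G \<in> borel_measurable borel"
      by (rule borel_measurable_LIMSEQ_real[of borel F]) (use lim in auto)
    show "(\<lambda>n. \<integral>\<omega>. F n (T \<omega>) *\<^sub>R D \<omega> \<partial>M) \<longlonglongrightarrow> (\<integral>\<omega>. G (T \<omega>) *\<^sub>R D \<omega> \<partial>M)"
    proof (rule integral_dominated_convergence[where w = "\<lambda>\<omega>. B * norm (D \<omega>)"])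
      show "integrable M (\<lambda>\<omega>. B * norm (D \<omega>))" using D by simp
      show "AE \<omega> in M. (\<lambda>n. F n (T \<omega>) *\<^sub>R D \<omega>) \<longlonglongrightarrow> G (T \<omega>) *\<^sub>R D \<omega>"
        using lim by (intro AE_I2 tendsto_scaleR tendsto_const) auto
      show "AE \<omega> in M. norm (F n (T \<omega>) *\<^sub>R D \<omega>) \<le> B * norm (D \<omega>)" for n
        using B by (intro AE_I2) (auto intro!: mult_right_mono)
    qed auto
  qed
qed

lemma bounded_pointwise_continuous_diff:
  assumes "bounded_pointwise_continuous I" "bounded_pointwise_continuous J"
  shows "bounded_pointwise_continuous (\<lambda>F. I F - J F)"
  unfolding bounded_pointwise_continuous_def
proof (intro conjI allI impI)
  fix F G :: "'a \<Rightarrow> real" assume "bounded_borel F" "bounded_borel G"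
  then show "I (\<lambda>u. F u + G u) - J (\<lambda>u. F u + G u) = I F - J F + (I G - J G)"
    using assms by (simp add: bounded_pointwise_continuous_def)
next
  fix c and F :: "'a \<Rightarrow> real" assume "bounded_borel F"
  then show "I (\<lambda>u. c * F u) - J (\<lambda>u. c * F u) = c *\<^sub>R (I F - J F)"
    using assms by (simp add: bounded_pointwise_continuous_def scaleR_diff_right)
next
  fix F and G :: "'a \<Rightarrow> real" and B
  assume "\<forall>n. bounded_borel (F n)" "\<forall>n u. \<bar>F n u\<bar> \<le> B" "\<forall>u. (\<lambda>n. F n u) \<longlonglongrightarrow> G u"
  then have "(\<lambda>n. I (F n)) \<longlonglongrightarrow> I G" "(\<lambda>n. J (F n)) \<longlonglongrightarrow> J G"
    using assms unfolding bounded_pointwise_continuous_def by blast+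
  then show "(\<lambda>n. I (F n) - J (F n)) \<longlonglongrightarrow> I G - J G" by (rule tendsto_diff)
qed

text \<open>Comparison of two possibly vector-valued weighted laws on the orthant. Functions on the orthant
  are extended by 0 to bring them into the scope of \<open>laplace_determines_functional\<close>.\<close>

lemma laplace_determines_integral:
  fixes D :: "'w \<Rightarrow> 'b::{banach, second_countable_topology}" and E :: "'v \<Rightarrow> 'b"
    and S :: "'w \<Rightarrow> real^'x::finite" and T :: "'v \<Rightarrow> real^'x"
  assumes S: "S \<in> borel_measurable M" "\<And>\<omega>. \<omega> \<in> space M \<Longrightarrow> S \<omega> \<in> orthant" and D: "integrable M D"
    and T: "T \<in> borel_measurable N" "\<And>v. v \<in> space N \<Longrightarrow> T v \<in> orthant" and E: "integrable N E"
    and lap: "\<And>\<theta>. \<theta> \<in> orthant \<Longrightarrow>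
      (\<integral>\<omega>. exp (- (\<theta> \<bullet> S \<omega>)) *\<^sub>R D \<omega> \<partial>M) = (\<integral>v. exp (- (\<theta> \<bullet> T v)) *\<^sub>R E v \<partial>N)"
    and F: "F \<in> borel_measurable (restrict_space borel orthant)" "bounded (F ` orthant)"
  shows "(\<integral>\<omega>. F (S \<omega>) *\<^sub>R D \<omega> \<partial>M) = (\<integral>v. F (T v) *\<^sub>R E v \<partial>N)"
proof -
  define I where "I G = (\<integral>\<omega>. G (S \<omega>) *\<^sub>R D \<omega> \<partial>M) - (\<integral>v. G (T v) *\<^sub>R E v \<partial>N)" for G
  define F' where "F' u = (if u \<in> orthant then F u else 0)" for u
  have restr: "(\<integral>\<omega>. (if S \<omega> \<in> orthant then G (S \<omega>) else 0) *\<^sub>R D \<omega> \<partial>M) = (\<integral>\<omega>. G (S \<omega>) *\<^sub>R D \<omega> \<partial>M)"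
    "(\<integral>v. (if T v \<in> orthant then G (T v) else 0) *\<^sub>R E v \<partial>N) = (\<integral>v. G (T v) *\<^sub>R E v \<partial>N)" for G
    using S(2) T(2) by (auto intro!: Bochner_Integration.integral_cong)
  have "I F' = 0"
  proof (rule laplace_determines_functional)
    show "bounded_pointwise_continuous I"
      unfolding I_def
      by (intro bounded_pointwise_continuous_diff bounded_pointwise_continuous_integral S(1) D T(1) E)
    show "I (\<lambda>u. if u \<in> orthant then exp (- (\<Sum>x\<in>UNIV. k x * u $ x)) else 0) = 0" for k :: "'x \<Rightarrow> nat"
    proof -
      let ?\<theta> = "(\<chi> x. real (k x)) :: real^'x"
      have "?\<theta> \<in> orthant" by (simp add: orthant_def)
      moreover have "?\<theta> \<bullet> u = (\<Sum>x\<in>UNIV. k x * u $ x)" for u by (simp add: inner_vec_def)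
      ultimately show ?thesis using lap[of ?\<theta>]
        by (simp add: I_def restr[of "\<lambda>u. exp (- (\<Sum>x\<in>UNIV. real (k x) * u $ x))"])
    qed
    have "F' \<in> borel_measurable borel"
      using F(1) unfolding F'_def[abs_def] by (subst (asm) measurable_restrict_space_iff) auto
    moreover have "bounded (range F')"
    proof -
      obtain K where K: "\<And>u. u \<in> orthant \<Longrightarrow> \<bar>F u\<bar> \<le> K" using F(2) by (auto simp: bounded_iff)
      have "0 \<le> K" using K[OF zero_in_orthant] by linarith
      then have "norm (F' u) \<le> K" for u using K by (simp add: F'_def)
      then show ?thesis unfolding bounded_iff by blast
    qed
    ultimately show "bounded_borel F'" by (simp add: bounded_borel_def)
  qed (simp add: F'_def)
  then show ?thesis by (simp add: I_def F'_def restr[of F])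
qed

text \<open>The normalising constant of the density is identified as the inverse of the partition function
  because the law has total mass 1; the integrability of \<open>gauss\<close> follows at the same time.\<close>

lemma gaussian_law:
  fixes C :: "real^'x^'x::finite" and \<phi> :: "'v \<Rightarrow> complex^'x"
  assumes Q: "prob_space Q" and D: "distributed Q lborel \<phi> (\<lambda>z. ennreal (gaussian_density C \<kappa> z))"
  shows "\<phi> \<in> borel_measurable Q" and "integrable lborel (gauss C \<kappa>)"
    and "\<And>(f :: complex^'x \<Rightarrow> 'b::{banach, second_countable_topology}) c.
      f \<in> borel_measurable borel \<Longrightarrow> has_bochner_integral lborel (\<lambda>z. gauss C \<kappa> z *\<^sub>R f z) c \<Longrightarrow>
      has_bochner_integral Q (\<lambda>v. f (\<phi> v)) (c /\<^sub>R partition_function C \<kappa>)"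
proof -
  interpret prob_space Q by fact
  define a where "a = det (rate_matrix C \<kappa> - C) / (2 * pi) ^ CARD('x)"
  have gd: "gaussian_density C \<kappa> z = a * gauss C \<kappa> z" for z by (simp add: gaussian_density_def gauss_def a_def)
  have law: "distr Q lborel \<phi> = density lborel (\<lambda>z. ennreal (a * gauss C \<kappa> z))"
    using D by (simp add: distributed_def gd)
  show m [measurable]: "\<phi> \<in> borel_measurable Q" using D by (simp add: distributed_def)
  have "emeasure (distr Q lborel \<phi>) UNIV = 1"
    by (subst emeasure_distr) (auto simp: emeasure_space_1)
  then have one: "(\<integral>\<^sup>+z. ennreal (a * gauss C \<kappa> z) \<partial>lborel) = 1"
    unfolding law by (subst (asm) emeasure_density) auto
  have a: "0 < a"
  proof (rule ccontr)
    assume "\<not> 0 < a"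
    then have "a * gauss C \<kappa> z \<le> 0" for z using gauss_pos[of C \<kappa> z] by (simp add: mult_le_0_iff)
    then have "ennreal (a * gauss C \<kappa> z) = 0" for z by (rule ennreal_neg)
    then show False using one by simp
  qed
  have hb: "has_bochner_integral lborel (\<lambda>z. a * gauss C \<kappa> z) 1"
    by (rule has_bochner_integral_nn_integral) (use a one gauss_pos[of C \<kappa>] in \<open>auto simp: less_imp_le\<close>)
  show int: "integrable lborel (gauss C \<kappa>)"
    using integrable.intros[OF hb] a by simp
  have aZ: "a * partition_function C \<kappa> = 1"
    using has_bochner_integral_integral_eq[OF hb] by (simp add: partition_function_def)
  then have Z: "a = inverse (partition_function C \<kappa>)" by (metis inverse_unique mult.commute)
  show "has_bochner_integral Q (\<lambda>v. f (\<phi> v)) (c /\<^sub>R partition_function C \<kappa>)"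
    if f [measurable]: "f \<in> borel_measurable borel" and c: "has_bochner_integral lborel (\<lambda>z. gauss C \<kappa> z *\<^sub>R f z) c"
    for f :: "complex^'x \<Rightarrow> 'b" and c
  proof -
    have "has_bochner_integral lborel (\<lambda>z. a *\<^sub>R gauss C \<kappa> z *\<^sub>R f z) (a *\<^sub>R c)"
      using c by (rule has_bochner_integral_scaleR_right)
    then have i: "integrable lborel (\<lambda>z. (a * gauss C \<kappa> z) *\<^sub>R f z)" "(\<integral>z. (a * gauss C \<kappa> z) *\<^sub>R f z \<partial>lborel) = a *\<^sub>R c"
      by (auto simp: has_bochner_integral_iff)
    have nn: "AE z in lborel. 0 \<le> a * gauss C \<kappa> z" using a gauss_pos[of C \<kappa>] by (simp add: less_imp_le)
    have "integrable (distr Q lborel \<phi>) f" unfolding law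
      by (subst integrable_density) (use i nn in auto)
    then have "integrable Q (\<lambda>v. f (\<phi> v))" by (subst (asm) integrable_distr_eq) auto
    moreover have "(\<integral>v. f (\<phi> v) \<partial>Q) = a *\<^sub>R c"
    proof -
      have "(\<integral>v. f (\<phi> v) \<partial>Q) = (\<integral>z. f z \<partial>distr Q lborel \<phi>)" by (subst integral_distr) auto
      also have "\<dots> = (\<integral>z. (a * gauss C \<kappa> z) *\<^sub>R f z \<partial>lborel)" unfolding law
        by (subst integral_density) (use nn in auto)
      finally show ?thesis by (simp add: i)
    qed
    ultimately show ?thesis by (simp add: has_bochner_integral_iff Z)
  qed
qed

lemma integral_indicator_comp:
  assumes f: "f \<in> M \<rightarrow>\<^sub>M N" and A: "A \<in> sets N"
  shows "(\<integral>x. indicator A (f x) \<partial>M) = measure M (f -` A \<inter> space M)"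
proof -
  have "(\<integral>x. indicator A (f x) \<partial>M) = (\<integral>x. indicator (f -` A \<inter> space M) x \<partial>M :: real)"
    by (intro Bochner_Integration.integral_cong) (auto simp: indicator_def)
  then show ?thesis using measurable_sets[OF f A] by simp
qed

theorem theorem5:
  fixes C :: "real^'x^'x::finite" and \<kappa> :: "real^'x"
    and Q :: "'v measure" and \<phi> :: "'v \<Rightarrow> complex^'x"
    and P :: "'w measure" and \<L> :: "'w \<Rightarrow> ('x \<times> real) list set set"
  assumes "\<forall>x y. C $ x $ y = C $ y $ x"
    and "\<forall>x y. 0 \<le> C $ x $ y"
    and "\<forall>x. C $ x $ x = 0"
    and "irreducible_conductance C"
    and "\<forall>x. 0 \<le> \<kappa> $ x"
    and "\<forall>x. 0 < total_rate C \<kappa> $ x"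
    and "\<forall>z. z \<noteq> 0 \<longrightarrow> 0 < energy C \<kappa> z"
    and "prob_space Q"
    and "distributed Q lborel \<phi> (\<lambda>z. ennreal (gaussian_density C \<kappa> z))"
    and "poisson_process P (loop_measure C \<kappa>) \<L>"
  shows "distr P borel (\<lambda>\<omega>. total_occupation (\<L> \<omega>)) = distr Q borel (\<lambda>v. half_square (\<phi> v)) \<and>
    (\<forall>x y. \<forall>F :: real^'x \<Rightarrow> real.
       F \<in> borel_measurable (restrict_space borel {u. \<forall>x. 0 \<le> u $ x}) \<and>
       bounded (F ` {u. \<forall>x. 0 \<le> u $ x}) \<longrightarrow>
       (\<integral>v. 1 / 2 * \<phi> v $ x * cnj (\<phi> v $ y) * of_real (F (half_square (\<phi> v))) \<partial>Q) =
       complex_of_real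
         (\<integral>\<gamma>. (\<integral>\<omega>. F (total_occupation (\<L> \<omega>) + occupation \<gamma>) \<partial>P) \<partial>bridge_measure C \<kappa> x y))"
proof -
  have net: "network C \<kappa>" using assms by (simp add: network_def)
  note PP = \<open>poisson_process P (loop_measure C \<kappa>) \<L>\<close>
  note law = gaussian_law[OF \<open>prob_space Q\<close> \<open>distributed Q lborel \<phi> (\<lambda>z. ennreal (gaussian_density C \<kappa> z))\<close>]
  interpret Q: prob_space Q by fact
  interpret P: prob_space P by (rule poisson_processD(1)[OF PP])
  have [measurable]: "\<phi> \<in> borel_measurable Q" by (rule law(1))
  note int = law(2)
  let ?h = "\<lambda>v. half_square (\<phi> v)"
  let ?L = "\<lambda>\<omega>. total_occupation (\<L> \<omega>)"
  have Lm [measurable]: "?L \<in> borel_measurable P" by (rule measurable_total_occupation[OF PP])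
  define Z where "Z \<theta> = partition_function C (\<kappa> + \<theta>)" for \<theta>
  have Z0: "0 < Z 0" unfolding Z_def using partition_function_pos[OF int] by simp
  have gaussZ: "has_bochner_integral Q (\<lambda>v. exp (- (\<theta> \<bullet> ?h v))) (Z \<theta> / Z 0)" if \<theta>: "\<theta> \<in> orthant" for \<theta>
  proof -
    have "has_bochner_integral lborel (\<lambda>z. gauss C \<kappa> z *\<^sub>R exp (- (\<theta> \<bullet> half_square z))) (Z \<theta>)"
    proof -
      have "gauss C \<kappa> z *\<^sub>R exp (- (\<theta> \<bullet> half_square z)) = gauss C (\<kappa> + \<theta>) z" for z
        by (simp add: gauss_add mult.commute)
      then show ?thesis
        using has_bochner_integral_integrable[OF integrable_gauss_add[OF int \<theta>]]
        by (simp only: Z_def partition_function_def)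
    qed
    from law(3)[OF _ this] show ?thesis by (simp add: Z_def divide_inverse mult.commute)
  qed
  have loopZ: "(\<integral>\<omega>. exp (- (\<theta> \<bullet> ?L \<omega>)) \<partial>P) = Z \<theta> / Z 0" if \<theta>: "\<theta> \<in> orthant" for \<theta>
    unfolding laplace_total_occupation[OF net PP \<theta>] Z_def
    using partition_function_ratio[OF net int \<theta>] partition_function_pos[OF int] by simp
  have fields: "(\<integral>\<omega>. F (?L \<omega>) \<partial>P) = (\<integral>v. F (?h v) \<partial>Q)"
    if F: "F \<in> borel_measurable (restrict_space borel orthant)" "bounded (F ` orthant)" for F :: "real^'x \<Rightarrow> real"
  proof -
    have "(\<integral>\<omega>. F (?L \<omega>) *\<^sub>R (1::real) \<partial>P) = (\<integral>v. F (?h v) *\<^sub>R (1::real) \<partial>Q)"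
      by (rule laplace_determines_integral[OF Lm total_occupation_orthant[OF PP] _ _ half_square_orthant _ _ F])
         (use loopZ has_bochner_integral_integral_eq[OF gaussZ] in auto)
    then show ?thesis by simp
  qed
  have a: "distr P borel ?L = distr Q borel ?h"
  proof (rule measure_eqI)
    fix A assume "A \<in> sets (distr P borel ?L)"
    then have A [measurable]: "A \<in> sets borel" by simp
    have "(\<integral>\<omega>. indicator A (?L \<omega>) \<partial>P) = (\<integral>v. indicator A (?h v) \<partial>Q :: real)"
      by (rule fields) (auto intro!: measurable_restrict_space1 simp: bounded_iff indicator_def intro: exI[of _ 1])
    moreover have hm: "?h \<in> borel_measurable Q" by measurable
    ultimately show "emeasure (distr P borel ?L) A = emeasure (distr Q borel ?h) A"
      by (simp add: emeasure_distr P.emeasure_eq_measure Q.emeasure_eq_measure integral_indicator_comp[OF Lm A] integral_indicator_comp[OF hm A])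
  qed simp
  have b: "(\<integral>v. 1 / 2 * \<phi> v $ x * cnj (\<phi> v $ y) * of_real (F (?h v)) \<partial>Q) =
       complex_of_real (\<integral>\<gamma>. (\<integral>\<omega>. F (?L \<omega> + occupation \<gamma>) \<partial>P) \<partial>bridge_measure C \<kappa> x y)"
    if F: "F \<in> borel_measurable (restrict_space borel orthant)" "bounded (F ` orthant)" for x y and F :: "real^'x \<Rightarrow> real"
  proof -
    let ?B = "bridge_measure C \<kappa> x y"
    let ?T = "\<lambda>(\<gamma>, \<omega>). ?L \<omega> + occupation \<gamma>"
    interpret B: finite_measure ?B by (rule finite_bridge_measure[OF net])
    interpret BP: pair_sigma_finite ?B P ..
    interpret BP: finite_measure "?B \<Otimes>\<^sub>M P"
      by (rule finite_measure_pair_measure) unfold_locales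
    have om [measurable]: "occupation \<in> borel_measurable ?B"
      by (subst measurable_cong_sets[OF sets_bridge_measure refl]) measurable
    have Tm [measurable]: "?T \<in> borel_measurable (?B \<Otimes>\<^sub>M P)" by measurable
    have To: "?T p \<in> orthant" if "p \<in> space (?B \<Otimes>\<^sub>M P)" for p
    proof -
      have "fst p \<in> paths" "snd p \<in> space P" using that by (auto simp: space_pair_measure)
      then show ?thesis
        using total_occupation_orthant[OF PP, of "snd p"] occupation_orthant[of "fst p"]
        by (auto simp: orthant_def split_beta)
    qed
    let ?D = "\<lambda>v. 1 / 2 * \<phi> v $ x * cnj (\<phi> v $ y)"
    have cm [measurable]: "(\<lambda>z :: complex^'x. z $ u) \<in> borel_measurable borel"
      "(\<lambda>z :: complex^'x. cnj (z $ u)) \<in> borel_measurable borel" for u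
      by (intro borel_measurable_continuous_onI continuous_intros)+
    \<comment> \<open>Tilting changes the covariance from \<open>\<kappa>\<close> to \<open>\<kappa> + \<theta>\<close> and costs the ratio of the partition
      functions.\<close>
    have corr: "has_bochner_integral Q (\<lambda>v. exp (- (\<theta> \<bullet> ?h v)) *\<^sub>R ?D v)
        (of_real (green C (\<kappa> + \<theta>) x y * (Z \<theta> / Z 0)))" if \<theta>: "\<theta> \<in> orthant" for \<theta>
    proof -
      have "has_bochner_integral lborel (\<lambda>z. 1 / 2 * z $ x * cnj (z $ y) * of_real (gauss C (\<kappa> + \<theta>) z)) (of_real (green C (\<kappa> + \<theta>) x y * Z \<theta>))"
        unfolding Z_def by (rule gauss_covariance[OF network_add[OF net \<theta>] integrable_gauss_add[OF int \<theta>]])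
      then have h: "has_bochner_integral lborel (\<lambda>z. gauss C \<kappa> z *\<^sub>R (exp (- (\<theta> \<bullet> half_square z)) *\<^sub>R (1 / 2 * z $ x * cnj (z $ y)))) (of_real (green C (\<kappa> + \<theta>) x y * Z \<theta>))"
        by (simp add: gauss_add scaleR_conv_of_real mult_ac)
      have m: "(\<lambda>z. exp (- (\<theta> \<bullet> half_square z)) *\<^sub>R (1 / 2 * z $ x * cnj (z $ y))) \<in> borel_measurable borel"
        by measurable
      have e: "of_real (green C (\<kappa> + \<theta>) x y * Z \<theta>) /\<^sub>R partition_function C \<kappa> =
          complex_of_real (green C (\<kappa> + \<theta>) x y * (Z \<theta> / Z 0))"
        by (simp add: Z_def scaleR_conv_of_real divide_inverse)
      from law(3)[OF m h] show ?thesis unfolding e .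
    qed
    \<comment> \<open>Loops and bridge are independent, so the transform of the sum of their fields factorises.\<close>
    have bridgeZ: "(\<integral>p. exp (- (\<theta> \<bullet> ?T p)) \<partial>(?B \<Otimes>\<^sub>M P)) = green C (\<kappa> + \<theta>) x y * (Z \<theta> / Z 0)" if \<theta>: "\<theta> \<in> orthant" for \<theta>
    proof -
      have i: "integrable (?B \<Otimes>\<^sub>M P) (\<lambda>p. exp (- (\<theta> \<bullet> ?T p)))"
        using To inner_orthant_nonneg[OF \<theta>]
        by (intro BP.integrable_const_bound[where B = 1]) auto
      have "(\<integral>p. exp (- (\<theta> \<bullet> ?T p)) \<partial>(?B \<Otimes>\<^sub>M P)) = (\<integral>\<gamma>. (\<integral>\<omega>. exp (- (\<theta> \<bullet> ?T (\<gamma>, \<omega>))) \<partial>P) \<partial>?B)"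
        by (rule BP.integral_fst'[OF i, symmetric])
      also have "\<dots> = (\<integral>\<gamma>. exp (- (\<theta> \<bullet> occupation \<gamma>)) * (Z \<theta> / Z 0) \<partial>?B)"
      proof (intro Bochner_Integration.integral_cong refl)
        fix \<gamma>
        have "exp (- (\<theta> \<bullet> ?T (\<gamma>, \<omega>))) = exp (- (\<theta> \<bullet> occupation \<gamma>)) * exp (- (\<theta> \<bullet> ?L \<omega>))" for \<omega>
          by (simp add: inner_add_right flip: exp_add)
        then show "(\<integral>\<omega>. exp (- (\<theta> \<bullet> ?T (\<gamma>, \<omega>))) \<partial>P) = exp (- (\<theta> \<bullet> occupation \<gamma>)) * (Z \<theta> / Z 0)"
          by (simp only: integral_mult_right_zero loopZ[OF \<theta>])
      qed
      also have "\<dots> = (\<integral>\<gamma>. exp (- (\<theta> \<bullet> occupation \<gamma>)) \<partial>?B) * (Z \<theta> / Z 0)"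
        by simp
      also have "(\<integral>\<gamma>. exp (- (\<theta> \<bullet> occupation \<gamma>)) \<partial>?B) = green C (\<kappa> + \<theta>) x y"
        by (subst integral_eq_nn_integral) (auto simp: bridge_measure_exp[OF net \<theta>] green_nonneg network_add[OF net \<theta>])
      finally show ?thesis .
    qed
    have "(\<integral>v. F (?h v) *\<^sub>R ?D v \<partial>Q) = (\<integral>p. F (?T p) *\<^sub>R (1::complex) \<partial>(?B \<Otimes>\<^sub>M P))"
    proof (rule laplace_determines_integral[OF _ half_square_orthant _ Tm To _ _ F])
      show "integrable Q ?D" using integrable.intros[OF corr[OF zero_in_orthant]] by simp
      show "(\<integral>v. exp (- (\<theta> \<bullet> ?h v)) *\<^sub>R ?D v \<partial>Q) = (\<integral>p. exp (- (\<theta> \<bullet> ?T p)) *\<^sub>R (1::complex) \<partial>(?B \<Otimes>\<^sub>M P))"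
        if \<theta>: "\<theta> \<in> orthant" for \<theta>
      proof -
        have "(\<integral>p. exp (- (\<theta> \<bullet> ?T p)) *\<^sub>R (1::complex) \<partial>(?B \<Otimes>\<^sub>M P)) = complex_of_real (\<integral>p. exp (- (\<theta> \<bullet> ?T p)) \<partial>(?B \<Otimes>\<^sub>M P))"
          by (simp only: scaleR_conv_of_real mult_1_right integral_complex_of_real)
        then show ?thesis
          by (simp only: has_bochner_integral_integral_eq[OF corr[OF \<theta>]] bridgeZ[OF \<theta>])
      qed
    qed auto
    also have "\<dots> = complex_of_real (\<integral>p. F (?T p) \<partial>(?B \<Otimes>\<^sub>M P))"
      by (simp only: scaleR_conv_of_real mult_1_right integral_complex_of_real)
    also have "(\<integral>p. F (?T p) \<partial>(?B \<Otimes>\<^sub>M P)) = (\<integral>\<gamma>. (\<integral>\<omega>. F (?T (\<gamma>, \<omega>)) \<partial>P) \<partial>?B)"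
    proof (rule BP.integral_fst'[symmetric])
      obtain K where K: "\<And>u. u \<in> orthant \<Longrightarrow> \<bar>F u\<bar> \<le> K" using F(2) by (auto simp: bounded_iff)
      show "integrable (?B \<Otimes>\<^sub>M P) (\<lambda>p. F (?T p))"
      proof (rule BP.integrable_const_bound[where B = K])
        show "AE p in ?B \<Otimes>\<^sub>M P. norm (F (?T p)) \<le> K" using K[OF To] by (intro AE_I2) simp
        have "?T \<in> (?B \<Otimes>\<^sub>M P) \<rightarrow>\<^sub>M restrict_space borel orthant"
          by (rule measurable_restrict_space2) (use To Tm in auto)
        from measurable_compose[OF this F(1)] show "(\<lambda>p. F (?T p)) \<in> borel_measurable (?B \<Otimes>\<^sub>M P)" .
      qed
    qed
    finally show ?thesis by (simp add: scaleR_conv_of_real mult_ac)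
  qed
  show ?thesis using a b by (auto simp: orthant_def)
qed

end
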